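(* Let $\Sigma$ be a finite relational signature. Then $\mathcal P^\Sigma[\mathsf U](\mathcal{EL})$ is polynomially characterisable within $\mathcal Q_p^\Sigma[\mathsf U](\mathcal{EL})$, while $\mathcal P^\Sigma[\mathsf U](\mathcal{ELI})$ is exponentially, but not polynomially, characterisable within $\mathcal Q_p^\Sigma[\mathsf U](\mathcal{ELI})$.
   Context: **Data.** A relational signature $\Sigma$ is a finite nonempty set of unary and binary predicate symbols. A $\Sigma$-data instance $\mathcal A$ is a finite set of facts $A(a)$, $P(a,b)$ with $A,P\in\Sigma$ and individual names $a,b$; we write $P^-(a,b)\in\mathcal A$ iff $P(b,a)\in\mathcal A$. $\mathrm{ind}(\mathcal A)$ is the set of individual names in $\mathcal A$. A temporal $\Sigma$-data instance is a finite sequence $\mathcal D=\mathcal A_0,\dots,\mathcal A_n$ of $\Sigma$-data instances, with $\mathcal A_\ell=\emptyset$ for $\ell>n$; $\mathrm{ind}(\mathcal D)=\bigcup_{i=0}^n\mathrm{ind}(\mathcal A_i)$ and $|\mathcal D|=\sum_i|\mathcal A_i|$. **Queries.** $\mathcal{ELI}$-queries are built from $\top$ and unary symbols using $\wedge$ and $\exists S.r$, where $S$ is $P$ or $P^-$ for a binary symbol $P$; $\mathcal{EL}$-queries are those without inverses $P^-$. For $\mathcal L\in\{\mathcal{EL},\mathcal{ELI}\}$, $\mathcal Q_p^\Sigma[\mathsf U](\mathcal L)$ is the class of queries $$q=r_0\wedge(l_1\mathbin{\mathsf U}(r_1\wedge(l_2\mathbin{\mathsf U}(\dots(l_n\mathbin{\mathsf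 U}r_n)\dots)))),$$ where each $r_i$ is an $\mathcal L$-query and each $l_i$ is an $\mathcal L$-query or $\bot$, with all predicate symbols in $\Sigma$. Truth: $\mathcal D,a,\ell\models A$ iff $A(a)\in\mathcal A_\ell$; $\mathcal D,a,\ell\models\exists S.r$ iff there is $b\in\mathrm{ind}(\mathcal A_\ell)$ with $S(a,b)\in\mathcal A_\ell$ and $\mathcal D,b,\ell\models r$; $\mathcal D,a,\ell\models q_1\mathbin{\mathsf U}q_2$ iff there is $m>\ell$ with $\mathcal D,a,m\models q_2$ and $\mathcal D,a,k\models q_1$ for all $k$ with $\ell<k<m$; $\top$ is always true, $\bot$ is never true, and $\wedge$ is as usual. We write $q\models q'$ if $\mathcal D,a,\ell\models q$ implies $\mathcal D,a,\ell\models q'$ for all $\mathcal D,a,\ell$; $\equiv$ is mutual entailment. $|q|$ is the number of symbols in $q$. The class $\mathcal P^\Sigma[\mathsf U](\mathcal L)$ of peerless queries consists of those queries in $\mathcal Q_p^\Sigma[\mathsf U](\mathcal L)$ of the displayed form such that, for each $i\in\{1,\dots,n\}$, either $l_i=\bot$, or $l_i\not\models r_i$ and $r_i\not\models l_i$. **Characterisability.** An example set is a pair $E=(E^+,E^-)$ of finite sets of pointed temporal $\Sigma$-data instances $(\mathcal D,a)$ with $a\in\mathrm{ind}(\mathcal D)$; $|E|$ is the sum of the $|\mathcal D|$ over all its members. A query $q$ fits $E$ if $\mathcal D,a,0\models q$ for all $(\mathcal D,a)\in E^+$ and $\mathcal D,a,0\not\models q$ for all $(\mathcal D,a)\in E^-$.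 $E$ uniquely characterises $q$ within a class $\mathcal Q$ if $q$ fits $E$ and $q\equiv q'$ for all $q'\in\mathcal Q$ that fit $E$. A class $\mathcal Q$ is polynomially (exponentially) characterisable within $\mathcal Q'\supseteq\mathcal Q$ if there is a polynomial $f$ such that every $q\in\mathcal Q$ is uniquely characterised within $\mathcal Q'$ by some $E$ with $|E|\le f(|q|)$ (respectively, $|E|\le 2^{f(|q|)}$).
   Formalization: The claim "not polynomially characterisable" for ELI is stated only for signatures with at least one binary predicate symbol, since with only unary symbols ELI and EL coincide and the claim is false; both positive claims hold for every finite signature. *)

theory Defs
  imports "HOL-Computational_Algebra.Polynomial"
begin

text \<open>Unary and binary predicate symbols have separate types, so a symbol has a unique arity.
  Individual names are natural numbers, i.e. there are countably infinitely many.\<close>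

datatype ('u, 'b) signature = Signature (unary: "'u set") (binary: "'b set")

definition relational_signature :: "('u, 'b) signature \<Rightarrow> bool" where
  "relational_signature \<Sigma> \<longleftrightarrow>
     finite (unary \<Sigma>) \<and> finite (binary \<Sigma>) \<and> (unary \<Sigma> \<noteq> {} \<or> binary \<Sigma> \<noteq> {})"


subsection \<open>Data\<close>

datatype ('u, 'b) assertion = UFact 'u nat | BFact 'b nat nat

fun assertion_over :: "('u, 'b) signature \<Rightarrow> ('u, 'b) assertion \<Rightarrow> bool" where
  "assertion_over \<Sigma> (UFact A a) \<longleftrightarrow> A \<in> unary \<Sigma>"
| "assertion_over \<Sigma> (BFact P a b) \<longleftrightarrow> P \<in> binary \<Sigma>"

fun names :: "('u, 'b) assertion \<Rightarrow> nat set" where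
  "names (UFact A a) = {a}"
| "names (BFact P a b) = {a, b}"

type_synonym ('u, 'b) data = "('u, 'b) assertion set"

definition data_instance :: "('u, 'b) signature \<Rightarrow> ('u, 'b) data \<Rightarrow> bool" where
  "data_instance \<Sigma> \<A> \<longleftrightarrow> finite \<A> \<and> (\<forall>\<alpha>\<in>\<A>. assertion_over \<Sigma> \<alpha>)"

definition ind :: "('u, 'b) data \<Rightarrow> nat set" where
  "ind \<A> = (\<Union>\<alpha>\<in>\<A>. names \<alpha>)"

datatype 'b role = Fwd 'b | Inv 'b

fun role_holds :: "('u, 'b) data \<Rightarrow> 'b role \<Rightarrow> nat \<Rightarrow> nat \<Rightarrow> bool" where
  "role_holds \<A> (Fwd P) a b \<longleftrightarrow> BFact P a b \<in> \<A>"
| "role_holds \<A> (Inv P) a b \<longleftrightarrow> BFact P b a \<in> \<A>"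

type_synonym ('u, 'b) tdata = "('u, 'b) data list"

text \<open>A sequence \<open>\<A>\<^sub>0, \<dots>, \<A>\<^sub>n\<close> has at least one member; the members may be empty.\<close>

definition temporal_instance :: "('u, 'b) signature \<Rightarrow> ('u, 'b) tdata \<Rightarrow> bool" where
  "temporal_instance \<Sigma> \<D> \<longleftrightarrow> \<D> \<noteq> [] \<and> (\<forall>\<A>\<in>set \<D>. data_instance \<Sigma> \<A>)"

definition slice :: "('u, 'b) tdata \<Rightarrow> nat \<Rightarrow> ('u, 'b) data" where
  "slice \<D> l = (if l < length \<D> then \<D> ! l else {})"

definition tind :: "('u, 'b) tdata \<Rightarrow> nat set" where
  "tind \<D> = (\<Union>\<A>\<in>set \<D>. ind \<A>)"

definition tsize :: "('u, 'b) tdata \<Rightarrow> nat" where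
  "tsize \<D> = (\<Sum>\<A>\<leftarrow>\<D>. card \<A>)"


subsection \<open>Queries\<close>

datatype ('u, 'b) query =
    Top
  | Bot
  | Atom 'u
  | Conj "('u, 'b) query" "('u, 'b) query"
  | Exists "'b role" "('u, 'b) query"
  | Until "('u, 'b) query" "('u, 'b) query"

fun sat :: "('u, 'b) tdata \<Rightarrow> nat \<Rightarrow> nat \<Rightarrow> ('u, 'b) query \<Rightarrow> bool" where
  "sat \<D> a l Top \<longleftrightarrow> True"
| "sat \<D> a l Bot \<longleftrightarrow> False"
| "sat \<D> a l (Atom A) \<longleftrightarrow> UFact A a \<in> slice \<D> l"
| "sat \<D> a l (Conj q1 q2) \<longleftrightarrow> sat \<D> a l q1 \<and> sat \<D> a l q2"
| "sat \<D> a l (Exists S r) \<longleftrightarrow>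
     (\<exists>b\<in>ind (slice \<D> l). role_holds (slice \<D> l) S a b \<and> sat \<D> b l r)"
| "sat \<D> a l (Until q1 q2) \<longleftrightarrow>
     (\<exists>m>l. sat \<D> a m q2 \<and> (\<forall>k. l < k \<and> k < m \<longrightarrow> sat \<D> a k q1))"

text \<open>Number of symbols, without parentheses; \<open>P\<close> and \<open>P\<^sup>-\<close> each count as one symbol.\<close>

fun qsize :: "('u, 'b) query \<Rightarrow> nat" where
  "qsize Top = 1"
| "qsize Bot = 1"
| "qsize (Atom A) = 1"
| "qsize (Conj q1 q2) = qsize q1 + 1 + qsize q2"
| "qsize (Exists S r) = 2 + qsize r"
| "qsize (Until q1 q2) = qsize q1 + 1 + qsize q2"

definition entails ::
    "('u, 'b) signature \<Rightarrow> ('u, 'b) query \<Rightarrow> ('u, 'b) query \<Rightarrow> bool" where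
  "entails \<Sigma> q q' \<longleftrightarrow> (\<forall>\<D> a l. temporal_instance \<Sigma> \<D> \<longrightarrow> sat \<D> a l q \<longrightarrow> sat \<D> a l q')"

definition equivalent ::
    "('u, 'b) signature \<Rightarrow> ('u, 'b) query \<Rightarrow> ('u, 'b) query \<Rightarrow> bool" where
  "equivalent \<Sigma> q q' \<longleftrightarrow> entails \<Sigma> q q' \<and> entails \<Sigma> q' q"

inductive_set EL :: "('u, 'b) signature \<Rightarrow> ('u, 'b) query set"
  for \<Sigma> :: "('u, 'b) signature" where
  EL_Top: "Top \<in> EL \<Sigma>"
| EL_Atom: "A \<in> unary \<Sigma> \<Longrightarrow> Atom A \<in> EL \<Sigma>"
| EL_Conj: "q1 \<in> EL \<Sigma> \<Longrightarrow> q2 \<in> EL \<Sigma> \<Longrightarrow> Conj q1 q2 \<in> EL \<Sigma>"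
| EL_Fwd: "P \<in> binary \<Sigma> \<Longrightarrow> r \<in> EL \<Sigma> \<Longrightarrow> Exists (Fwd P) r \<in> EL \<Sigma>"

inductive_set ELI :: "('u, 'b) signature \<Rightarrow> ('u, 'b) query set"
  for \<Sigma> :: "('u, 'b) signature" where
  ELI_Top: "Top \<in> ELI \<Sigma>"
| ELI_Atom: "A \<in> unary \<Sigma> \<Longrightarrow> Atom A \<in> ELI \<Sigma>"
| ELI_Conj: "q1 \<in> ELI \<Sigma> \<Longrightarrow> q2 \<in> ELI \<Sigma> \<Longrightarrow> Conj q1 q2 \<in> ELI \<Sigma>"
| ELI_Fwd: "P \<in> binary \<Sigma> \<Longrightarrow> r \<in> ELI \<Sigma> \<Longrightarrow> Exists (Fwd P) r \<in> ELI \<Sigma>"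
| ELI_Inv: "P \<in> binary \<Sigma> \<Longrightarrow> r \<in> ELI \<Sigma> \<Longrightarrow> Exists (Inv P) r \<in> ELI \<Sigma>"

text \<open>\<open>path_query r\<^sub>0 [(l\<^sub>1, r\<^sub>1), \<dots>, (l\<^sub>n, r\<^sub>n)]\<close> is
  \<open>r\<^sub>0 \<and> (l\<^sub>1 U (r\<^sub>1 \<and> (l\<^sub>2 U (\<dots> (l\<^sub>n U r\<^sub>n) \<dots>))))\<close>, and just \<open>r\<^sub>0\<close> if \<open>n = 0\<close>.
  If no \<open>r\<^sub>i\<close> contains \<open>U\<close>, the components are determined by the query.\<close>

fun path_query ::
    "('u, 'b) query \<Rightarrow> (('u, 'b) query \<times> ('u, 'b) query) list \<Rightarrow> ('u, 'b) query" where
  "path_query r [] = r"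
| "path_query r ((l, s) # ps) = Conj r (Until l (path_query s ps))"

definition path_queries :: "('u, 'b) query set \<Rightarrow> ('u, 'b) query set" where
  "path_queries L = {path_query r ps | r ps.
     r \<in> L \<and> (\<forall>(l, s)\<in>set ps. (l \<in> L \<or> l = Bot) \<and> s \<in> L)}"

definition peerless :: "('u, 'b) signature \<Rightarrow> ('u, 'b) query set \<Rightarrow> ('u, 'b) query set" where
  "peerless \<Sigma> L = {path_query r ps | r ps.
     r \<in> L \<and> (\<forall>(l, s)\<in>set ps. (l \<in> L \<or> l = Bot) \<and> s \<in> L) \<and>
     (\<forall>(l, s)\<in>set ps. l = Bot \<or> (\<not> entails \<Sigma> l s \<and> \<not> entails \<Sigma> s l))}"

lemma peerless_subset_path_queries: "peerless \<Sigma> L \<subseteq> path_queries L"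
  unfolding peerless_def path_queries_def by blast

text \<open>Over a signature without binary symbols the two description languages coincide, so the
  separation between them can only be claimed if \<open>binary \<Sigma> \<noteq> {}\<close>.\<close>

lemma ELI_eq_EL:
  assumes "binary \<Sigma> = {}"
  shows "ELI \<Sigma> = EL \<Sigma>"
proof
  show "ELI \<Sigma> \<subseteq> EL \<Sigma>"
  proof
    fix q assume "q \<in> ELI \<Sigma>"
    then show "q \<in> EL \<Sigma>" by induction (auto simp: assms intro: EL.intros)
  qed
  show "EL \<Sigma> \<subseteq> ELI \<Sigma>"
  proof
    fix q assume "q \<in> EL \<Sigma>"
    then show "q \<in> ELI \<Sigma>" by induction (auto intro: ELI.intros)
  qed
qed


subsection \<open>Characterisability\<close>

type_synonym ('u, 'b) examples =
  "(('u, 'b) tdata \<times> nat) set \<times> (('u, 'b) tdata \<times> nat) set"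

definition pointed_instance :: "('u, 'b) signature \<Rightarrow> ('u, 'b) tdata \<times> nat \<Rightarrow> bool" where
  "pointed_instance \<Sigma> = (\<lambda>(\<D>, a). temporal_instance \<Sigma> \<D> \<and> a \<in> tind \<D>)"

definition example_set :: "('u, 'b) signature \<Rightarrow> ('u, 'b) examples \<Rightarrow> bool" where
  "example_set \<Sigma> = (\<lambda>(Epos, Eneg). finite Epos \<and> finite Eneg \<and>
     (\<forall>e\<in>Epos. pointed_instance \<Sigma> e) \<and> (\<forall>e\<in>Eneg. pointed_instance \<Sigma> e))"

definition esize :: "('u, 'b) examples \<Rightarrow> nat" where
  "esize = (\<lambda>(Epos, Eneg). (\<Sum>(\<D>, a)\<in>Epos. tsize \<D>) + (\<Sum>(\<D>, a)\<in>Eneg. tsize \<D>))"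

definition fits :: "('u, 'b) query \<Rightarrow> ('u, 'b) examples \<Rightarrow> bool" where
  "fits q = (\<lambda>(Epos, Eneg).
     (\<forall>(\<D>, a)\<in>Epos. sat \<D> a 0 q) \<and> (\<forall>(\<D>, a)\<in>Eneg. \<not> sat \<D> a 0 q))"

definition uniquely_characterises ::
    "('u, 'b) signature \<Rightarrow> ('u, 'b) examples \<Rightarrow> ('u, 'b) query \<Rightarrow> ('u, 'b) query set \<Rightarrow> bool" where
  "uniquely_characterises \<Sigma> E q Q' \<longleftrightarrow>
     fits q E \<and> (\<forall>q'\<in>Q'. fits q' E \<longrightarrow> equivalent \<Sigma> q q')"

definition polynomially_characterisable ::
    "('u, 'b) signature \<Rightarrow> ('u, 'b) query set \<Rightarrow> ('u, 'b) query set \<Rightarrow> bool" where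
  "polynomially_characterisable \<Sigma> Q Q' \<longleftrightarrow> (\<exists>f :: nat poly. \<forall>q\<in>Q. \<exists>E.
     example_set \<Sigma> E \<and> uniquely_characterises \<Sigma> E q Q' \<and> esize E \<le> poly f (qsize q))"

definition exponentially_characterisable ::
    "('u, 'b) signature \<Rightarrow> ('u, 'b) query set \<Rightarrow> ('u, 'b) query set \<Rightarrow> bool" where
  "exponentially_characterisable \<Sigma> Q Q' \<longleftrightarrow> (\<exists>f :: nat poly. \<forall>q\<in>Q. \<exists>E.
     example_set \<Sigma> E \<and> uniquely_characterises \<Sigma> E q Q' \<and> esize E \<le> 2 ^ poly f (qsize q))"

end

(*
  Idea. Only the point a matters over time, so a temporal instance is a word whose letters are pointed
  static instances. Trim q = r0 & l1 U (r1 & ... ln U rn) so that rn is not trivial. The word r0 ... rn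
  and words made of the largest letter with one position avoiding ri force every fitting q' to have the
  same n and equivalent ri, so only the left arguments l'i of q' are open. They are controlled by the
  positive words r0 l1 r1 ... lt rt r(t+1) ... rn, where each li other than bottom occurs once up to t,
  and by negative words in which a letter avoiding li (and possibly ri) is inserted before ri. A fitting
  l'i that does not entail li must entail ri, and then reading such a letter as ri is harmless, because
  ri & X qi entails qi for the tail qi of q. If l't fails to absorb lt, then the ri before it are all
  equivalent to lt back to a gap of q' that absorbs the block instead.

  Letters avoiding given queries exist with a size exponential in the queries for ELI, and polynomial
  for EL, where an element needs to avoid at most two conjuncts at a time.

  Conversely, the negative examples for X r contain, for each ELI query l not entailing r, a point where
  l holds and r fails. For r = EX P. AND i. EX P-. yi with independent yi, there are 2^m queries l no
  two of which can hold at the same such point.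
*)
theory Submission
  imports Defs "HOL-Library.Nat_Bijection"
begin

text \<open>A rival of a peerless query need not be peerless, and then equivalent queries can differ
  gap by gap. For incomparable \<open>x\<close> and \<open>y\<close>, both
  \<open>bot U (x & (x U y))\<close> and \<open>x U (x & (bot U y))\<close> ask for one or more
  points with \<open>x\<close> followed at once by \<open>y\<close>; only the first is peerless. So
  left arguments cannot be compared one at a time. The gaps where the comparison fails are called
  \<open>lost\<close>, and equivalence is proved for tails, from the last conjunct backwards. The
  second obstacle is that reading an inserted letter as \<open>r i\<close> is safe only if the tail
  behind it tolerates blocks of every length. An embedding has only n + 1 conjuncts to place, so if
  a query fails on some word of this family, it fails on one whose blocks have at most n + 2
  letters. A single such word represents the whole family. The argument on words is the same for EL
  and ELI; only the number and the size of the avoiding letters differ.\<close>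

subsection \<open>Words and embeddings\<close>

text \<open>A letter stands for a pointed static instance: \<open>can x\<close> for the most general one satisfying \<open>x\<close>,
  \<open>e\<close> for the one without facts, and \<open>N x y\<close> for the most general ones falsifying \<open>x\<close> and \<open>y\<close>.\<close>

locale letters =
  fixes S :: "'a \<Rightarrow> 'q \<Rightarrow> bool" and L :: "'q set" and bot :: 'q
    and can :: "'q \<Rightarrow> 'a" and e :: 'a and full :: 'a and N :: "'q \<Rightarrow> 'q \<Rightarrow> 'a set"
  assumes can: "x \<in> L \<Longrightarrow> y \<in> insert bot L \<Longrightarrow> S (can x) y \<longleftrightarrow> (\<forall>a. S a x \<longrightarrow> S a y)"
    and bot: "\<not> S a bot"
    and empty: "x \<in> L \<Longrightarrow> S e x \<Longrightarrow> S a x"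
    and full: "x \<in> L \<Longrightarrow> S full x"
    and N_avoids: "A \<in> N x y \<Longrightarrow> x \<in> insert bot L \<Longrightarrow> y \<in> insert bot L \<Longrightarrow> \<not> S A x \<and> \<not> S A y"
    and N_complete: "x \<in> insert bot L \<Longrightarrow> y \<in> insert bot L \<Longrightarrow> z \<in> L \<Longrightarrow>
      \<not> (\<forall>a. S a z \<longrightarrow> S a x) \<Longrightarrow> \<not> (\<forall>a. S a z \<longrightarrow> S a y) \<Longrightarrow> \<exists>A\<in>N x y. S A z"
begin

definition ent :: "'q \<Rightarrow> 'q \<Rightarrow> bool" where "ent x y \<longleftrightarrow> (\<forall>a. S a x \<longrightarrow> S a y)"

lemma ent_refl: "ent x x" by (simp add: ent_def)
lemma ent_trans: "ent x y \<Longrightarrow> ent y z \<Longrightarrow> ent x z" by (simp add: ent_def)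
lemma entD: "ent x y \<Longrightarrow> S a x \<Longrightarrow> S a y" by (simp add: ent_def)
lemma ent_bot: "ent bot y" by (simp add: ent_def bot)
lemma not_ent_bot: "x \<in> L \<Longrightarrow> \<not> ent x bot" using full bot by (auto simp: ent_def)
lemma can_ent: "x \<in> L \<Longrightarrow> y \<in> insert bot L \<Longrightarrow> S (can x) y \<longleftrightarrow> ent x y"
  using can by (simp add: ent_def)
lemma can_self: "x \<in> L \<Longrightarrow> S (can x) x" by (simp add: can)

text \<open>\<open>N x y\<close> acts as a split partner (a homomorphism dual) of \<open>x\<close>
  and \<open>y\<close>. The case \<open>z = bot\<close> cannot arise under these hypotheses, as
  \<open>bot\<close> entails everything.\<close>

lemma N_ex:
  "x \<in> insert bot L \<Longrightarrow> y \<in> insert bot L \<Longrightarrow> z \<in> insert bot L \<Longrightarrow> \<not> ent z x \<Longrightarrow> \<not> ent z y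
   \<Longrightarrow> \<exists>A\<in>N x y. S A z"
  using N_complete[of x y z] by (auto simp: ent_def bot)

text \<open>\<open>psat w r l n i p\<close> is the truth of the tail \<open>r\<^sub>i \<and> (l\<^sub>i\<^sub>+\<^sub>1 U (\<dots> (l\<^sub>n U r\<^sub>n)))\<close> at
  position \<open>p\<close> of \<open>w\<close>; so \<open>l j\<close> is the gap before \<open>r j\<close>, and \<open>l 0\<close> is meaningless.\<close>

definition emb where
  "emb w r l n i f \<longleftrightarrow> (\<forall>j. i \<le> j \<and> j \<le> n \<longrightarrow> S (w (f j)) (r j)) \<and>
     (\<forall>j. i \<le> j \<and> j < n \<longrightarrow> f j < f (Suc j) \<and>
        (\<forall>k. f j < k \<and> k < f (Suc j) \<longrightarrow> S (w k) (l (Suc j))))" for f :: "nat \<Rightarrow> nat"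

definition psat where
  "psat w r l n i p \<longleftrightarrow> (\<exists>f. f i = p \<and> emb w r l n i f)" for p :: nat

lemma psatI: "emb w r l n i f \<Longrightarrow> f i = p \<Longrightarrow> psat w r l n i p"
  unfolding psat_def by blast

lemma emb_S: "emb w r l n i f \<Longrightarrow> i \<le> j \<Longrightarrow> j \<le> n \<Longrightarrow> S (w (f j)) (r j)"
  by (simp add: emb_def)
lemma emb_less: "emb w r l n i f \<Longrightarrow> i \<le> j \<Longrightarrow> j < n \<Longrightarrow> f j < f (Suc j)"
  by (simp add: emb_def)
lemma emb_gap: "emb w r l n i f \<Longrightarrow> i \<le> j \<Longrightarrow> j < n \<Longrightarrow> f j < k \<Longrightarrow> k < f (Suc j) \<Longrightarrow> S (w k) (l (Suc j))"
  by (simp add: emb_def)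

lemma emb_mono:
  assumes "emb w r l n i f" "i \<le> j" "j \<le> k" "k \<le> n"
  shows "f j + (k - j) \<le> f k"
  using assms(3,4)
proof (induction k rule: dec_induct)
  case (step k)
  then show ?case using emb_less[OF assms(1), of k] assms(2) by simp
qed simp

lemma emb_le: "emb w r l n i f \<Longrightarrow> i \<le> j \<Longrightarrow> j \<le> k \<Longrightarrow> k \<le> n \<Longrightarrow> f j \<le> f k"
  using emb_mono[of w r l n i f j k] by linarith

lemma emb_tail: "emb w r l n i f \<Longrightarrow> i \<le> j \<Longrightarrow> emb w r l n j f"
  by (simp add: emb_def)

lemma psat_last: "psat w r l n n p \<longleftrightarrow> S (w p) (r n)"
  unfolding psat_def emb_def by (auto intro: exI[of _ "\<lambda>_. p"])

text \<open>This recursion ties \<open>psat\<close> to the semantics of \<open>U\<close> and allows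
  backward induction on tails without naming an embedding.\<close>

lemma psat_step:
  assumes "i < n"
  shows "psat w r l n i p \<longleftrightarrow> S (w p) (r i) \<and>
    (\<exists>u>p. (\<forall>k. p < k \<and> k < u \<longrightarrow> S (w k) (l (Suc i))) \<and> psat w r l n (Suc i) u)"
    (is "?A \<longleftrightarrow> ?B")
proof
  assume ?A
  then obtain f where f: "f i = p" "emb w r l n i f" by (auto simp: psat_def)
  have "psat w r l n (Suc i) (f (Suc i))" using emb_tail[OF f(2), of "Suc i"] by (auto simp: psat_def)
  then show ?B using f assms emb_S[OF f(2), of i] emb_less[OF f(2), of i] emb_gap[OF f(2), of i] by auto
next
  assume B: ?B
  then obtain u f where u: "u > p" "\<And>k. p < k \<Longrightarrow> k < u \<Longrightarrow> S (w k) (l (Suc i))"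
    "f (Suc i) = u" "emb w r l n (Suc i) f" by (auto simp: psat_def)
  have "emb w r l n i (f(i := p))"
    using B u unfolding emb_def by (auto simp: le_Suc_eq Suc_le_eq)
  then show ?A by (auto simp: psat_def intro!: exI[of _ "f(i:=p)"])
qed

lemma psat_first: "i \<le> n \<Longrightarrow> psat w r l n i p \<Longrightarrow> S (w p) (r i)"
  by (auto simp: psat_def dest: emb_S)

section \<open>Duplicating and inserting letters\<close>

definition dup where "dup p w q = (if q \<le> p then w q else w (q - 1))" for p q :: nat
definition ins where "ins p A w q = (if q < p then w q else if q = p then A else w (q - 1))" for p q :: nat

text \<open>A position that no conjunct occupies lies in a gap or behind the last conjunct. A second
  copy of its letter is read the same way, and the later conjuncts shift by one.\<close>

lemma psat_dup:
  assumes f: "emb w r l n 0 f" "f 0 = 0" and p: "p \<notin> f ` {0..n}"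
  shows "psat (dup p w) r l n 0 0"
proof -
  define g where "g j = (if f j \<le> p then f j else Suc (f j))" for j
  have ne: "f j \<noteq> p" if "j \<le> n" for j using p that by auto
  have "emb (dup p w) r l n 0 g"
    unfolding emb_def
  proof (intro conjI allI impI)
    fix j assume "0 \<le> j \<and> j \<le> n"
    then show "S (dup p w (g j)) (r j)" using emb_S[OF f(1), of j] by (auto simp: g_def dup_def)
  next
    fix j assume j: "0 \<le> j \<and> j < n"
    then show "g j < g (Suc j)" using emb_less[OF f(1), of j] by (auto simp: g_def)
    fix k assume k: "g j < k \<and> k < g (Suc j)"
    show "S (dup p w k) (l (Suc j))"
    proof (cases "k \<le> p")
      case True
      then have "f j < k" "k < f (Suc j)" using k ne[of "Suc j"] j by (auto simp: g_def split: if_splits)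
      then show ?thesis using True emb_gap[OF f(1), of j k] j by (simp add: dup_def)
    next
      case False
      then have "f j < k - 1" "k - 1 < f (Suc j)" using k ne[of j] j by (auto simp: g_def split: if_splits)
      then show ?thesis using False emb_gap[OF f(1), of j "k-1"] j by (simp add: dup_def)
    qed
  qed
  moreover have "g 0 = 0" using f(2) by (simp add: g_def)
  ultimately show ?thesis by (auto simp: psat_def)
qed

text \<open>Inside a constant block it makes no difference which copy is repeated, so an unoccupied
  position found by counting can be traded for the start of the block.\<close>

lemma dup_block:
  assumes "\<And>q. s \<le> q \<Longrightarrow> q < s + K \<Longrightarrow> w q = x" "s \<le> p" "p < s + K"
  shows "dup p w = dup s w"
proof
  fix q
  show "dup p w q = dup s w q"
    using assms(1)[of q] assms(1)[of "q-1"] assms(2,3) by (auto simp: dup_def)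
qed

text \<open>Pigeonhole: n + 1 conjuncts cannot occupy all of n + 2 or more equal letters, and an
  unoccupied one may be duplicated. Contrapositively, shortening a long block keeps a failing query
  failing.\<close>

lemma psat_pump:
  assumes x: "\<And>q. s \<le> q \<Longrightarrow> q < s + K \<Longrightarrow> w q = x" and K: "n + 2 \<le> K"
    and "psat w r l n 0 0"
  shows "psat (dup s w) r l n 0 0"
proof -
  obtain f where f: "f 0 = 0" "emb w r l n 0 f" using assms(3) by (auto simp: psat_def)
  have "\<not> {s..<s+K} \<subseteq> f ` {0..n}"
  proof
    assume "{s..<s+K} \<subseteq> f ` {0..n}"
    then have "card {s..<s+K} \<le> card (f ` {0..n})" by (intro card_mono) auto
    also have "\<dots> \<le> n + 1" using card_image_le[of "{0..n}" f] by simp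
    finally show False using K by simp
  qed
  then obtain p where "s \<le> p" "p < s + K" "p \<notin> f ` {0..n}" unfolding subset_iff atLeastLessThan_iff by blast
  then show ?thesis using psat_dup[OF f(2,1), of p] dup_block[of s K w x p] x by metis
qed

end

section \<open>Positions of the conjuncts in a canonical word\<close>

primrec cpos :: "(nat \<Rightarrow> nat) \<Rightarrow> nat \<Rightarrow> nat" where
  "cpos k 0 = 0"
| "cpos k (Suc h) = Suc (cpos k h + k (Suc h))"

lemma cpos_mono: "strict_mono (cpos k)" by (simp add: strict_mono_Suc_iff)

lemma cpos_le: "i \<le> j \<Longrightarrow> cpos k i \<le> cpos k j" using cpos_mono by (simp add: strict_mono_less_eq)
lemma cpos_less_iff: "cpos k i < cpos k j \<longleftrightarrow> i < j" using cpos_mono by (rule strict_mono_less)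
lemma cpos_le_iff: "cpos k i \<le> cpos k j \<longleftrightarrow> i \<le> j" using cpos_mono by (rule strict_mono_less_eq)

lemma cpos_ge: "h \<le> cpos k h" by (induction h) auto

lemma cpos_zero: "(\<And>j. 1 \<le> j \<Longrightarrow> j \<le> h \<Longrightarrow> k j = 0) \<Longrightarrow> cpos k h = h" by (induction h) auto

lemma cpos_upd: "1 \<le> j \<Longrightarrow> cpos (k(j := Suc (k j))) h = cpos k h + (if j \<le> h then 1 else 0)"
  by (induction h) (auto simp: le_Suc_eq)

lemma cpos_bound: "(\<And>j. 1 \<le> j \<Longrightarrow> j \<le> h \<Longrightarrow> k j \<le> K) \<Longrightarrow> cpos k h \<le> h * (K + 1)"
proof (induction h)
  case (Suc h)
  then have "k (Suc h) \<le> K" "cpos k h \<le> h * (K+1)" by auto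
  then show ?case by simp
qed simp

lemma cpos_cases:
  obtains (beyond) "cpos k n < p" | (hit) h where "h \<le> n" "p = cpos k h"
  | (gap) h where "h < n" "cpos k h < p" "p < cpos k (Suc h)"
proof (cases "cpos k n < p")
  case False
  define h where "h = (LEAST h. p \<le> cpos k h)"
  have h: "p \<le> cpos k h" unfolding h_def by (rule LeastI[of _ n]) (use False in simp)
  have min: "h' < h \<Longrightarrow> cpos k h' < p" for h' unfolding h_def by (meson not_le not_less_Least)
  have hn: "h \<le> n" unfolding h_def by (rule Least_le) (use False in simp)
  show ?thesis
  proof (cases "p = cpos k h")
    case True then show ?thesis using hit hn by blast
  next
    case F: False
    then obtain h' where "h = Suc h'" using h by (cases h) auto
    then show ?thesis using gap[of h'] hn h F min[of h'] by simp
  qed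
qed (rule beyond)

context letters
begin

text \<open>The word \<open>r\<^sub>0 l\<^sub>1\<^sup>k\<^sup>1 r\<^sub>1 \<dots> l\<^sub>n\<^sup>k\<^sup>n r\<^sub>n\<close> of canonical letters, in which \<open>r\<^sub>h\<close> is at position \<open>cpos k h\<close>.\<close>

definition ew where
  "ew n r l k p = (if cpos k n < p then e
     else let h = (LEAST h. p \<le> cpos k h) in if p = cpos k h then can (r h) else can (l h))"

lemma ew_hit: "h \<le> n \<Longrightarrow> ew n r l k (cpos k h) = can (r h)"
proof -
  assume h: "h \<le> n"
  have "(LEAST h'. cpos k h \<le> cpos k h') = h" by (rule Least_equality) (auto simp: cpos_le_iff)
  then show ?thesis using cpos_le[OF h, of k] by (auto simp: ew_def)
qed

lemma ew_gap: "h < n \<Longrightarrow> cpos k h < p \<Longrightarrow> p < cpos k (Suc h) \<Longrightarrow> ew n r l k p = can (l (Suc h))"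
proof -
  assume h: "h < n" "cpos k h < p" "p < cpos k (Suc h)"
  have "(LEAST h'. p \<le> cpos k h') = Suc h"
  proof (rule Least_equality)
    show "p \<le> cpos k (Suc h)" using h by simp
    fix y assume "p \<le> cpos k y"
    then have "cpos k h < cpos k y" using h by linarith
    then show "Suc h \<le> y" by (simp only: cpos_less_iff Suc_le_eq)
  qed
  moreover have "p < cpos k n" using cpos_le[of "Suc h" n k] h by linarith
  ultimately show ?thesis using h by (auto simp: ew_def)
qed

lemma ew_beyond: "cpos k n < p \<Longrightarrow> ew n r l k p = e" by (simp add: ew_def)

text \<open>The block has to be non-empty already: otherwise position
  \<open>Suc (cpos k (j - 1))\<close> carries the letter of \<open>r j\<close>, not one of
  \<open>l j\<close>.\<close>

lemma ew_dup:
  assumes j: "1 \<le> j" "j \<le> n" "0 < k j"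
  shows "ew n r l (k(j := Suc (k j))) = dup (Suc (cpos k (j - 1))) (ew n r l k)"
proof
  fix q
  obtain i where i: "j = Suc i" using j by (cases j) auto
  let ?k = "k(j := Suc (k j))" and ?s = "Suc (cpos k i)"
  note c = cpos_upd[OF j(1), of k]
  have s: "?s < cpos k j" using j i by simp
  show "ew n r l ?k q = dup (Suc (cpos k (j - 1))) (ew n r l k) q"
  proof (cases rule: cpos_cases[of ?k n q])
    case beyond
    then have "cpos k n < q - 1" using c[of n] j by simp
    moreover have "?s < cpos k n" using s cpos_le[OF j(2), of k] by linarith
    ultimately have "?s < q" by linarith
    with \<open>cpos k n < q - 1\<close> show ?thesis using ew_beyond beyond by (simp add: dup_def i)
  next
    case (hit h)
    have e1: "ew n r l ?k q = can (r h)" using ew_hit[OF hit(1)] hit(2) by blast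
    show ?thesis
    proof (cases "j \<le> h")
      case True
      then have "q = Suc (cpos k h)" using hit c by simp
      moreover have "?s < q" using s cpos_le[OF True, of k] calculation by linarith
      ultimately show ?thesis using e1 ew_hit[OF hit(1), of r l k] by (simp add: dup_def i)
    next
      case False
      then have "q = cpos k h" using hit c by simp
      moreover have "cpos k h \<le> cpos k i" using False i by (intro cpos_le) simp
      ultimately show ?thesis using e1 ew_hit[OF hit(1), of r l k] by (simp add: dup_def i)
    qed
  next
    case (gap h)
    have e1: "ew n r l ?k q = can (l (Suc h))" by (rule ew_gap[OF gap])
    show ?thesis
    proof (cases "j \<le> Suc h")
      case True
      show ?thesis
      proof (cases "j = Suc h")
        case T: True
        then have hi: "h = i" using i by simp
        have g1: "cpos k h < q" "q < Suc (cpos k (Suc h))" using gap c[of h] c[of "Suc h"] T by auto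
        have d: "dup (Suc (cpos k (j - 1))) (ew n r l k) q = ew n r l k (if q \<le> ?s then q else q - 1)"
          by (simp add: dup_def i)
        have "ew n r l k (if q \<le> ?s then q else q - 1) = can (l (Suc h))"
          by (rule ew_gap) (use g1 hi s T gap(1) in auto)
        then show ?thesis using e1 d by simp
      next
        case F: False
        then have jh: "j \<le> h" using True by simp
        have g: "cpos k h < q - 1" "q - 1 < cpos k (Suc h)" using gap c[of h] c[of "Suc h"] jh by auto
        have "?s < q" using s g cpos_le[OF jh, of k] by linarith
        then show ?thesis using e1 ew_gap[OF gap(1) g, of r l] by (simp add: dup_def i)
      qed
    next
      case False
      have g: "cpos k h < q" "q < cpos k (Suc h)" using gap c[of h] c[of "Suc h"] False by auto
      have "cpos k (Suc h) \<le> cpos k i" using False i by (intro cpos_le) simp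
      then have "q \<le> ?s" using g by linarith
      then show ?thesis using e1 ew_gap[OF gap(1) g, of r l] by (simp add: dup_def i)
    qed
  qed
qed

lemma emb_ew:
  assumes r: "\<And>j. i \<le> j \<Longrightarrow> j \<le> n \<Longrightarrow> r j \<in> L"
    and l: "\<And>j. i < j \<Longrightarrow> j \<le> n \<Longrightarrow> l j \<in> insert bot L"
    and k: "\<And>j. i < j \<Longrightarrow> j \<le> n \<Longrightarrow> l j = bot \<Longrightarrow> k j = 0"
  shows "emb (ew n r l k) r l n i (cpos k)"
  unfolding emb_def
proof (intro conjI allI impI)
  fix j assume j: "i \<le> j \<and> j < n"
  show "cpos k j < cpos k (Suc j)" by simp
  fix p assume p: "cpos k j < p \<and> p < cpos k (Suc j)"
  then have "l (Suc j) \<in> L" using l[of "Suc j"] k[of "Suc j"] j by fastforce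
  then show "S (ew n r l k p) (l (Suc j))" using ew_gap[of j n k p r l] p j by (simp add: can_self del: cpos.simps)
qed (use r ew_hit can_self in auto)

end

subsection \<open>Canonical words with one inserted letter\<close>

locale peerless_seq = letters S L bot can e full N
  for S :: "'a \<Rightarrow> 'q \<Rightarrow> bool" and L and bot :: 'q
    and can :: "'q \<Rightarrow> 'a" and e :: 'a and full :: 'a and N :: "'q \<Rightarrow> 'q \<Rightarrow> 'a set" +
  fixes n :: nat and r l :: "nat \<Rightarrow> 'q"
  assumes n_pos: "1 \<le> n"
    and r_in: "i \<le> n \<Longrightarrow> r i \<in> L"
    and l_in: "1 \<le> i \<Longrightarrow> i \<le> n \<Longrightarrow> l i \<in> insert bot L"
    and last: "\<not> S e (r n)"
    and r_l: "1 \<le> i \<Longrightarrow> i \<le> n \<Longrightarrow> \<not> ent (r i) (l i)"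
    and l_r: "1 \<le> i \<Longrightarrow> i \<le> n \<Longrightarrow> l i \<noteq> bot \<Longrightarrow> \<not> ent (l i) (r i)"
begin

abbreviation EW where "EW \<equiv> ew n r l"

text \<open>The first \<open>i\<close> blocks are empty, so \<open>r c\<close> sits at position
  \<open>c\<close> for every \<open>c \<le> i\<close>, and a letter inserted at \<open>i\<close>
  stands directly before \<open>r i\<close>. Blocks of \<open>bot\<close> are empty because no
  letter satisfies it.\<close>

definition adm where
  "adm i k \<longleftrightarrow> (\<forall>j\<le>i. k j = 0) \<and> (\<forall>j. 1 \<le> j \<and> j \<le> n \<and> l j = bot \<longrightarrow> k j = (0::nat))"

text \<open>No blocks follow \<open>r t\<close>, which leaves the later conjuncts of a rival no
  slack.\<close>

definition once where "once t j = (if 1 \<le> j \<and> j \<le> t \<and> l j \<noteq> bot then 1 else 0 :: nat)"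

lemma adm_zero: "adm i (\<lambda>_. 0)" by (simp add: adm_def)

lemma adm_once: "adm 0 (once t)" by (simp add: adm_def once_def)

lemma r_in': "i \<le> n \<Longrightarrow> r i \<in> insert bot L" using r_in by blast

lemma EW_hit_S: "h \<le> n \<Longrightarrow> y \<in> insert bot L \<Longrightarrow> S (EW k (cpos k h)) y \<longleftrightarrow> ent (r h) y"
  by (simp add: ew_hit can_ent r_in)

lemma adm_cpos: "adm i k \<Longrightarrow> j \<le> i \<Longrightarrow> cpos k j = j"
  by (rule cpos_zero) (auto simp: adm_def)

lemma EW_self: "adm i k \<Longrightarrow> emb (EW k) r l n 0 (cpos k)"
  by (rule emb_ew) (use r_in l_in in \<open>auto simp: adm_def\<close>)

text \<open>No letter up to position \<open>i\<close> can be read in a gap: \<open>r c\<close> does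
  not entail \<open>l c\<close>, and \<open>A\<close> fails \<open>l i\<close>. So each conjunct is
  read at the first opportunity, and \<open>A\<close> is read by \<open>r i\<close>.\<close>

lemma ins_canon:
  assumes A: "\<not> S A (l i)" and i: "1 \<le> i" "i \<le> n" and k: "adm i k"
    and g: "emb (ins i A (EW k)) r l n 0 g" "g 0 = 0" and c: "c \<le> i"
  shows "g c = c"
  using c
proof (induction c)
  case (Suc c)
  then have gc: "g c = c" by simp
  show ?case
  proof (rule ccontr)
    assume "g (Suc c) \<noteq> Suc c"
    then have "g (Suc c) > Suc c" using emb_less[OF g(1), of c] gc Suc.prems i by simp
    then have S: "S (ins i A (EW k) (Suc c)) (l (Suc c))"
      using emb_gap[OF g(1), of c "Suc c"] gc Suc.prems i by simp
    show False
    proof (cases "Suc c = i")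
      case True
      then show False using S A by (simp add: ins_def)
    next
      case False
      then have "S (EW k (cpos k (Suc c))) (l (Suc c))"
        using S adm_cpos[OF k, of "Suc c"] Suc.prems by (simp add: ins_def del: cpos.simps)
      then show False using EW_hit_S[of "Suc c" "l (Suc c)" k] r_l[of "Suc c"] l_in[of "Suc c"] Suc.prems i by simp
    qed
  qed
qed (simp add: g)

end

text \<open>\<open>neg1\<close> and \<open>neg2\<close> express the negative examples
  contrapositively, since a word is a negative example only if it falsifies the given query. In
  \<open>neg2\<close> the two \<open>k\<close> may differ, because one bounded word stands for all
  failing ones.\<close>

locale rival = peerless_seq +
  fixes l' :: "nat \<Rightarrow> 'b"
  assumes l'_in: "1 \<le> i \<Longrightarrow> i \<le> n \<Longrightarrow> l' i \<in> insert bot L"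
    and pos: "t \<le> n \<Longrightarrow> psat (EW (once t)) r l' n 0 0"
    and neg1: "1 \<le> i \<Longrightarrow> i \<le> n \<Longrightarrow> A \<in> N (l i) (r i) \<union> N (l i) (l i) \<Longrightarrow>
      psat (ins i A (EW (\<lambda>_. 0))) r l' n 0 0 \<Longrightarrow> psat (ins i A (EW (\<lambda>_. 0))) r l n 0 0"
    and neg2: "1 \<le> i \<Longrightarrow> i \<le> n \<Longrightarrow> A \<in> N (l i) (l i) \<Longrightarrow> adm i k \<Longrightarrow> \<not> psat (ins i A (EW k)) r l n 0 0
      \<Longrightarrow> \<exists>k. adm i k \<and> \<not> psat (ins i A (EW k)) r l' n 0 0"
begin

lemma ins_sat:
  assumes i: "1 \<le> i" "i \<le> n" and A: "S A (l' i)" and k: "adm i k" and p: "psat (EW k) r l' n i i"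
  shows "psat (ins i A (EW k)) r l' n 0 0"
proof -
  obtain f where f: "f i = i" "emb (EW k) r l' n i f" using p by (auto simp: psat_def)
  define g where "g j = (if j < i then j else Suc (f j))" for j
  have fi: "i \<le> f j" if "i \<le> j" "j \<le> n" for j using emb_mono[OF f(2), of i j] f(1) that by simp
  have "emb (ins i A (EW k)) r l' n 0 g"
    unfolding emb_def
  proof (intro conjI allI impI)
    fix j assume j: "0 \<le> j \<and> j \<le> n"
    show "S (ins i A (EW k) (g j)) (r j)"
    proof (cases "j < i")
      case True
      then show ?thesis using EW_hit_S[of j "r j" k] adm_cpos[OF k, of j] j r_in' ent_refl
        by (simp add: g_def ins_def)
    next
      case False
      then show ?thesis using emb_S[OF f(2), of j] fi[of j] j by (simp add: g_def ins_def)
    qed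
  next
    fix j assume j: "0 \<le> j \<and> j < n"
    show "g j < g (Suc j)"
      using emb_less[OF f(2), of j] fi[of "Suc j"] j by (auto simp: g_def)
    fix q assume q: "g j < q \<and> q < g (Suc j)"
    show "S (ins i A (EW k) q) (l' (Suc j))"
    proof (cases "Suc j < i")
      case True then show ?thesis using q by (auto simp: g_def)
    next
      case F: False
      show ?thesis
      proof (cases "j < i")
        case True
        then have ji: "Suc j = i" using F by simp
        then have "q = i" using q f(1) by (auto simp: g_def)
        then show ?thesis using A ji by (simp add: ins_def)
      next
        case False
        then have "f j < q - 1" "q - 1 < f (Suc j)" using q by (auto simp: g_def)
        then show ?thesis using emb_gap[OF f(2), of j "q-1"] fi[of j] False j by (auto simp: ins_def)
      qed
    qed
  qed
  moreover have "g 0 = 0" using i by (simp add: g_def)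
  ultimately show ?thesis by (auto simp: psat_def)
qed

lemma cpos_const0: "cpos (\<lambda>_. 0) h = h" by (rule cpos_zero) simp

text \<open>All gaps are empty, so the same word serves every choice of left arguments.\<close>

lemma psat_EW0: "i \<le> n \<Longrightarrow> psat (EW (\<lambda>_. 0)) r x n i i"
  by (rule psatI[of _ _ _ _ _ id])
    (use EW_hit_S[of _ _ "\<lambda>_. 0"] r_in' ent_refl in \<open>auto simp: emb_def cpos_const0\<close>)

text \<open>Otherwise a letter avoiding both \<open>l i\<close> and \<open>r i\<close> satisfies
  \<open>l' i\<close>. The rival reads it in gap \<open>i\<close>, so the given query must hold in
  that word too, but \<open>ins_canon\<close> leaves \<open>r i\<close> as the only reader of the
  letter.\<close>

lemma foreign_r:
  assumes i: "1 \<le> i" "i \<le> n" and fo: "\<not> ent (l' i) (l i)"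
  shows "ent (l' i) (r i)"
proof (rule ccontr)
  assume "\<not> ent (l' i) (r i)"
  then obtain A where A: "A \<in> N (l i) (r i)" "S A (l' i)"
    using N_ex[of "l i" "r i" "l' i"] fo i l_in l'_in r_in' by blast
  have "psat (ins i A (EW (\<lambda>_. 0))) r l' n 0 0"
    using ins_sat[OF i A(2) adm_zero] psat_EW0 i by blast
  then obtain g where g: "g 0 = 0" "emb (ins i A (EW (\<lambda>_. 0))) r l n 0 g"
    using neg1[OF i, of A] A by (auto simp: psat_def)
  have nA: "\<not> S A (l i)" "\<not> S A (r i)" using N_avoids[OF A(1)] i l_in r_in' by blast+
  have "g i = i" using ins_canon[OF nA(1) i adm_zero g(2,1)] by simp
  then show False using emb_S[OF g(2), of i] i nA by (simp add: ins_def)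
qed

text \<open>An inserted letter satisfying \<open>l' i\<close> but not \<open>l i\<close> is read by \<open>r i\<close>, so it pushes the later conjuncts one step
  ahead until some gap \<open>l d\<close> swallows the surplus letter.\<close>

lemma foreign_chain:
  assumes i: "1 \<le> i" "i \<le> n" and fo: "\<not> ent (l' i) (l i)"
  obtains d where "i < d" "d \<le> Suc n" "\<And>c. i < c \<Longrightarrow> c < d \<Longrightarrow> ent (r (c - 1)) (r c)"
    "d \<le> n \<Longrightarrow> ent (r (d - 1)) (l d)"
proof -
  obtain A where A: "A \<in> N (l i) (l i)" "S A (l' i)"
    using N_ex[of "l i" "l i" "l' i"] fo i l_in l'_in by blast
  have "psat (ins i A (EW (\<lambda>_. 0))) r l' n 0 0"
    using ins_sat[OF i A(2) adm_zero] psat_EW0 i by blast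
  then obtain g where g: "g 0 = 0" "emb (ins i A (EW (\<lambda>_. 0))) r l n 0 g"
    using neg1[OF i, of A] A by (auto simp: psat_def)
  have nA: "\<not> S A (l i)" using N_avoids[OF A(1)] i l_in by blast
  have gi: "g i = i" using ins_canon[OF nA i adm_zero g(2,1)] by simp
  have letter: "S (ins i A (EW (\<lambda>_. 0)) c) y \<longleftrightarrow> ent (r (c - 1)) y" if "i < c" "c \<le> Suc n" "y \<in> insert bot L" for c y
    using that EW_hit_S[of "c-1" y "\<lambda>_. 0"] by (simp add: ins_def cpos_const0)
  \<comment> \<open>\<open>d\<close> is the first index after \<open>i\<close> whose conjunct is not
    read at the position of the same number. Before \<open>d\<close>, position \<open>c\<close>
    carries the letter of \<open>r (c - 1)\<close> and is read by \<open>r c\<close>. The value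
    \<open>Suc n\<close> means that this goes on to the end.\<close>
  define d where "d = (LEAST d. i < d \<and> (n < d \<or> g d \<noteq> d))"
  have d: "i < d \<and> (n < d \<or> g d \<noteq> d)" unfolding d_def by (rule LeastI[of _ "Suc n"]) (use i in simp)
  have below: "c \<le> n \<and> g c = c" if "i < c" "c < d" for c
    using not_less_Least[of c "\<lambda>d. i < d \<and> (n < d \<or> g d \<noteq> d)"] that unfolding d_def[symmetric] by auto
  have "d \<le> Suc n" unfolding d_def by (rule Least_le) (use i in simp)
  moreover have "ent (r (c - 1)) (r c)" if "i < c" "c < d" for c
    using below[OF that] emb_S[OF g(2), of c] letter[of c "r c"] that r_in' by auto
  moreover have "ent (r (d - 1)) (l d)" if "d \<le> n"
  proof -
    have gd1: "g (d - 1) = d - 1" using below[of "d-1"] gi d by (cases "d - 1 = i") auto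
    have "d - 1 < n" "Suc (d - 1) = d" using d that i by linarith+
    then have "g d > d" using emb_less[OF g(2), of "d-1"] gd1 d that by auto
    then have "S (ins i A (EW (\<lambda>_. 0)) d) (l d)"
      using emb_gap[OF g(2), of "d-1" d] gd1 d that by simp
    then show ?thesis using letter[of d "l d"] d that l_in[of d] i by simp
  qed
  ultimately show ?thesis using that d by blast
qed

text \<open>Inductively \<open>r (Suc h)\<close> is read behind \<open>cpos k h\<close>, and inside
  the following block it cannot be read, because \<open>l (Suc h)\<close> does not entail
  it.\<close>

lemma late:
  assumes f: "emb (EW k) r x n 0 f" "f 0 = 0" and k: "adm 0 k" and h: "h \<le> n"
  shows "cpos k h \<le> f h"
  using h
proof (induction h)
  case (Suc h)
  then have IH: "cpos k h \<le> f h" "h < n" by auto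
  have lt: "f h < f (Suc h)" using emb_less[OF f(1), of h] IH by simp
  show ?case
  proof (rule ccontr)
    assume "\<not> cpos k (Suc h) \<le> f (Suc h)"
    then have "cpos k h < f (Suc h)" "f (Suc h) < cpos k (Suc h)" using IH lt by linarith+
    then have "EW k (f (Suc h)) = can (l (Suc h))" "0 < k (Suc h)" using ew_gap[OF IH(2)] by auto
    moreover have "l (Suc h) \<noteq> bot" using k \<open>0 < k (Suc h)\<close> IH unfolding adm_def
      by (metis Suc_leI le_add1 less_numeral_extra(3) plus_1_eq_Suc)
    moreover have "l (Suc h) \<in> L" using l_in[of "Suc h"] IH calculation by auto
    ultimately show False using emb_S[OF f(1), of "Suc h"] l_r[of "Suc h"] IH r_in'[of "Suc h"]
      by (simp add: can_ent)
  qed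
qed (simp add: f)

end

subsection \<open>Blocks lost by their own gap\<close>

context rival begin

text \<open>If the letter for \<open>l t\<close> in \<open>EW (once t)\<close> is not read in gap \<open>t\<close>, the embedding runs late from some gap
  \<open>i < t\<close> on; every letter from there to this one is then read by an earlier index than its own,
  which together with \<open>foreign_chain\<close> forces all these conjuncts to be equivalent.\<close>

lemma lost_gap:
  assumes t: "1 \<le> t" "t \<le> n" "l t \<noteq> bot" and lost: "\<not> ent (l t) (l' t)"
  obtains i where "1 \<le> i" "i < t" "\<And>b. i \<le> b \<Longrightarrow> b < t \<Longrightarrow> ent (r i) (r b) \<and> ent (r b) (r i)"
    "\<And>b. i < b \<Longrightarrow> b < t \<Longrightarrow> l b = bot" "ent (l t) (r i)" "ent (r i) (l t)"
    "ent (l' i) (r i)" "ent (r i) (l' i)"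
proof -
  let ?c = "cpos (once t)" and ?w = "EW (once t)"
  obtain f where f: "f 0 = 0" "emb ?w r l' n 0 f" using pos[OF t(2)] by (auto simp: psat_def)
  have ge: "?c h \<le> f h" if "h \<le> n" for h by (rule late[OF f(2,1) adm_once that])
  have fn: "f n \<le> ?c n"
  proof (rule ccontr)
    assume "\<not> f n \<le> ?c n"
    then have "?w (f n) = e" by (simp add: ew_beyond)
    then show False using emb_S[OF f(2), of n] last by simp
  qed
  have lin: "?c n = ?c h + (n - h)" if "t \<le> h" "h \<le> n" for h
    using that(2,1) by (induction rule: inc_induct) (auto simp: once_def)
  have ct: "?c t = Suc (Suc (?c (t - 1)))" using t by (cases t) (auto simp: once_def)
  \<comment> \<open>Behind \<open>r t\<close> the word has exactly one letter per remaining
    conjunct, so the lower bound \<open>ge\<close> and the end of the word determine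
    \<open>f t\<close>.\<close>
  have ft: "f t = ?c t"
    using ge[OF t(2)] emb_mono[OF f(2), of t n] lin[of t] fn t by simp
  have tt: "Suc (t - 1) = t" "t - 1 < n" using t by auto
  have ftl: "f (t - 1) < f t" using emb_less[OF f(2), of "t-1"] tt by simp
  have lt_in: "l t \<in> L" using l_in t by blast
  have letter_l: "S (?w (?c b - 1)) y \<longleftrightarrow> ent (l b) y"
    if "1 \<le> b" "b \<le> t" "l b \<noteq> bot" "y \<in> insert bot L" for b y
  proof -
    define b' where "b' = b - 1"
    have b': "b = Suc b'" using that by (simp add: b'_def)
    have "?w (?c b - 1) = can (l b)" unfolding b'
      by (rule ew_gap) (use that b' t in \<open>auto simp: once_def\<close>)
    then show ?thesis using l_in[of b] that t by (auto simp: can_ent)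
  qed
  \<comment> \<open>With equality the single letter of \<open>l t\<close> would lie in gap
    \<open>t\<close>, where \<open>l' t\<close> would have to hold.\<close>
  have "f (t - 1) \<noteq> ?c (t - 1)"
  proof
    assume "f (t - 1) = ?c (t - 1)"
    then have "S (?w (?c t - 1)) (l' t)" using emb_gap[OF f(2), of "t-1" "?c t - 1"] tt ft ct by simp
    then show False using letter_l[of t "l' t"] t lost l'_in by simp
  qed
  moreover have "?c (t - 1) \<le> f (t - 1)" using ge[of "t-1"] tt by simp
  ultimately have ft1: "f (t - 1) = ?c t - 1" using ftl ft ct by linarith
  \<comment> \<open>\<open>i\<close> is the last index before \<open>t\<close> whose gap is entered
    before the letter of \<open>r i\<close>; index 1 is a candidate since \<open>f 0 = 0\<close>.
    From \<open>i\<close> up to \<open>t - 1\<close> every conjunct is read strictly later than its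
    own letter.\<close>
  define i where "i = (GREATEST i. 1 \<le> i \<and> i < t \<and> f (i - 1) < ?c i)"
  have t2: "t \<noteq> 1" using \<open>f (t - 1) \<noteq> ?c (t - 1)\<close> f by auto
  have ex: "1 \<le> (1::nat) \<and> 1 < t \<and> f (1 - 1) < ?c 1" using f t t2 by simp
  have i: "1 \<le> i" "i < t" "f (i - 1) < ?c i"
    using GreatestI_nat[of "\<lambda>i. 1 \<le> i \<and> i < t \<and> f (i - 1) < ?c i" 1 t, OF ex] unfolding i_def by auto
  have lag: "?c a \<le> f (a - 1)" if "i < a" "a < t" for a
    using Greatest_le_nat[of "\<lambda>i. 1 \<le> i \<and> i < t \<and> f (i - 1) < ?c i" a t] that i unfolding i_def[symmetric]
    by fastforce
  have lag2: "?c a < f a" if "i \<le> a" "a < t" for a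
  proof (cases "a = t - 1")
    case True then show ?thesis using ft1 ct by simp
  next
    case False
    then have "?c (Suc a) \<le> f a" using lag[of "Suc a"] that by simp
    then show ?thesis by simp
  qed
  \<comment> \<open>Each letter strictly between those of \<open>r i\<close> and \<open>r t\<close>
    is read by some conjunct or gap with index \<open>a\<close> from \<open>i\<close> on. As these
    conjuncts run late, \<open>a\<close> is smaller than the index the letter belongs to.\<close>
  have absorb: "\<exists>a. i \<le> a \<and> a < b \<and> (S (?w p) (r a) \<or> S (?w p) (l' a))"
    if p: "?c i < p" "p < ?c t" "p \<le> ?c b" and b: "i < b" "b \<le> t" "p = ?c b \<Longrightarrow> b < t" for p b
  proof -
    define a where "a = (LEAST a. p \<le> f a)"
    have "p \<le> f (t - 1)" using ft1 p by simp
    then have a: "p \<le> f a" "a \<le> t - 1" unfolding a_def by (auto intro: LeastI Least_le)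
    have amin: "f a' < p" if "a' < a" for a' using that unfolding a_def by (meson not_le not_less_Least)
    have fi1: "f (i - 1) < p" using i p by simp
    have ia: "i \<le> a"
    proof (rule ccontr)
      assume "\<not> i \<le> a"
      then have "f a \<le> f (i - 1)" using emb_le[OF f(2), of a "i-1"] i t by simp
      then show False using a fi1 by simp
    qed
    show ?thesis
    proof (cases "p = f a")
      case True
      have "?c a < p" using lag2[OF ia] a i True by simp
      then have "?c a < ?c b" using p by linarith
      then have "a < b" by (simp only: cpos_less_iff)
      then show ?thesis using True emb_S[OF f(2), of a] a ia t by auto
    next
      case False
      then have pl: "p < f a" using a by simp
      have fa1: "f (a - 1) < p" using amin[of "a-1"] ia i by simp
      have "S (?w p) (l' a)" using emb_gap[OF f(2), of "a-1" p] fa1 pl ia i a t by simp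
      moreover have "a < b"
      proof (cases "a = i")
        case False
        then have "i < a" "a < t" using ia a i by simp_all
        then have "?c a < p" using lag[of a] fa1 by linarith
        then have "?c a < ?c b" using p by linarith
        then show ?thesis by (simp only: cpos_less_iff)
      qed (use b in simp)
      ultimately show ?thesis using ia by blast
    qed
  qed
  have absorb_r: "\<exists>a. i \<le> a \<and> a < b \<and> (ent (r b) (r a) \<or> ent (r b) (l' a))" if b: "i < b" "b < t" for b
  proof -
    obtain a where a: "i \<le> a" "a < b" "S (?w (?c b)) (r a) \<or> S (?w (?c b)) (l' a)"
      using absorb[of "?c b" b] b by (auto simp: cpos_less_iff)
    then show ?thesis using EW_hit_S[of b _ "once t"] r_in'[of a] l'_in[of a] i t b by auto
  qed
  have absorb_l: "\<exists>a. i \<le> a \<and> a < b \<and> (ent (l b) (r a) \<or> ent (l b) (l' a))"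
    if b: "i < b" "b \<le> t" "l b \<noteq> bot" for b
  proof -
    define b' where "b' = b - 1"
    have b': "b = Suc b'" using that by (simp add: b'_def)
    have "?c i \<le> ?c b'" using b b' by (simp add: cpos_le_iff)
    moreover have "?c b = Suc (Suc (?c b'))" using b b' i by (simp add: once_def)
    moreover have "?c b \<le> ?c t" using b by (simp add: cpos_le_iff)
    ultimately obtain a where a: "i \<le> a" "a < b" "S (?w (?c b - 1)) (r a) \<or> S (?w (?c b - 1)) (l' a)"
      using absorb[of "?c b - 1" b] b by auto
    then show ?thesis using letter_l[of b] r_in'[of a] l'_in[of a] i t b by auto
  qed
  \<comment> \<open>The letter of \<open>r i\<close> is passed after \<open>r (i - 1)\<close> and
    before \<open>r i\<close> has been read, hence inside gap \<open>i\<close>.\<close>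
  have ri: "ent (r i) (l' i)"
  proof -
    have "S (?w (?c i)) (l' i)" using emb_gap[OF f(2), of "i-1" "?c i"] i lag2[of i] t by simp
    then show ?thesis using EW_hit_S[of i "l' i"] l'_in[of i] i t by simp
  qed
  have iin: "i \<le> n" using i t by simp
  have fo: "\<not> ent (l' i) (l i)" using ri r_l[of i] ent_trans i iin by blast
  obtain d where d: "i < d" "d \<le> Suc n" "\<And>c. i < c \<Longrightarrow> c < d \<Longrightarrow> ent (r (c - 1)) (r c)"
    "d \<le> n \<Longrightarrow> ent (r (d - 1)) (l d)" using foreign_chain[OF i(1) iin fo] by blast
  have li: "ent (l' i) (r i)" by (rule foreign_r[OF i(1) iin fo])
  \<comment> \<open>For \<open>a > i\<close> with \<open>l a = bot\<close> a left argument
    \<open>l' a\<close> other than \<open>bot\<close> cannot entail \<open>l a\<close>, so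
    \<open>foreign_r\<close> replaces it by \<open>r a\<close>, which entails
    \<open>r i\<close>.\<close>
  have below: "ent y (r i)"
    if IH: "\<And>a. i \<le> a \<Longrightarrow> a \<le> b \<Longrightarrow> ent (r a) (r i) \<and> (i < a \<longrightarrow> l a = bot)"
      and a: "i \<le> a" "a < Suc b" "ent y (r a) \<or> ent y (l' a)" and b: "b < t" for y a b
  proof -
    have "ent (l' a) (r i)"
    proof (cases "a = i")
      case False
      then have la: "l a = bot" using IH[of a] a by auto
      show ?thesis
      proof (cases "l' a = bot")
        case False
        then have "\<not> ent (l' a) (l a)" using l'_in[of a] a b i t la not_ent_bot by auto
        then have "ent (l' a) (r a)" using foreign_r[of a] a b i t by auto
        then show ?thesis using IH[of a] a ent_trans by auto
      qed (simp add: ent_bot)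
    qed (use li in simp)
    then show ?thesis using a IH[of a] ent_trans by auto
  qed
  have chain: "b < d \<and> ent (r i) (r b) \<and> ent (r b) (r i) \<and> (i < b \<longrightarrow> l b = bot)"
    if "i \<le> b" "b < t" for b
    using that
  proof (induction b rule: less_induct)
    case (less b)
    show ?case
    proof (cases "b = i")
      case False
      then obtain b' where b': "b = Suc b'" "i \<le> b'" using less.prems by (cases b) auto
      have IH: "a < d \<and> ent (r i) (r a) \<and> ent (r a) (r i) \<and> (i < a \<longrightarrow> l a = bot)" if "i \<le> a" "a \<le> b'" for a
        using less.IH[of a] that b' less.prems by simp
      have IH': "\<And>a. i \<le> a \<Longrightarrow> a \<le> b' \<Longrightarrow> ent (r a) (r i) \<and> (i < a \<longrightarrow> l a = bot)" using IH by blast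
      have rb: "ent (r b) (r i)"
      proof -
        obtain a where "i \<le> a" "a < Suc b'" "ent (r b) (r a) \<or> ent (r b) (l' a)"
          using absorb_r[of b] b' less.prems by auto
        then show ?thesis using below[OF IH'] b' less.prems by simp
      qed
      \<comment> \<open>At \<open>d = b\<close> the conjunct \<open>r b\<close> would entail
        \<open>l b\<close>, against peerlessness.\<close>
      have "d \<noteq> b"
      proof
        assume "d = b"
        then have "ent (r b') (l b)" using d(4) b' less.prems t by simp
        then have "ent (r b) (l b)" using rb IH[of b'] b' ent_trans by blast
        then show False using r_l[of b] b' less.prems t by simp
      qed
      then have db: "b < d" using IH[of b'] b' by simp
      have "ent (r b') (r b)" using d(3)[of b] db b' by simp
      then have rib: "ent (r i) (r b)" using IH[of b'] b' ent_trans by blast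
      have "l b = bot"
      proof (rule ccontr)
        assume nb: "l b \<noteq> bot"
        obtain a where "i \<le> a" "a < Suc b'" "ent (l b) (r a) \<or> ent (l b) (l' a)"
          using absorb_l[of b] b' less.prems nb by auto
        then have "ent (l b) (r i)" using below[OF IH'] b' less.prems by simp
        then have "ent (l b) (r b)" using rib ent_trans by blast
        then show False using l_r[of b] nb b' less.prems t by simp
      qed
      then show ?thesis using db rib rb by blast
    qed (use d ent_refl in simp)
  qed
  have ltri: "ent (l t) (r i)"
  proof -
    have c': "\<And>a. i \<le> a \<Longrightarrow> a \<le> t - 1 \<Longrightarrow> ent (r a) (r i) \<and> (i < a \<longrightarrow> l a = bot)" using chain t by simp
    obtain a where "i \<le> a" "a < Suc (t - 1)" "ent (l t) (r a) \<or> ent (l t) (l' a)"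
      using absorb_l[of t] i t by auto
    then show ?thesis using below[OF c'] t by simp
  qed
  have "i \<le> t - 1" "t - 1 < t" using i by linarith+
  then have c1: "t - 1 < d" "ent (r i) (r (t - 1))" "ent (r (t - 1)) (r i)" using chain[of "t-1"] by blast+
  \<comment> \<open>A chain running past \<open>t\<close> would lead from \<open>l t\<close> through
    \<open>r (t - 1)\<close> to \<open>r t\<close>, again against peerlessness.\<close>
  have "d \<le> t"
  proof (rule ccontr)
    assume "\<not> d \<le> t"
    then have "ent (r (t - 1)) (r t)" using d(3)[of t] i by simp
    moreover have "ent (l t) (r (t - 1))" using ltri c1 ent_trans by blast
    ultimately show False using l_r[of t] t ent_trans by blast
  qed
  then have "d = t" using c1 by linarith
  then have "ent (r (t - 1)) (l t)" using d(4) t by simp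
  then have "ent (r i) (l t)" using c1 ent_trans by blast
  moreover have "ent (r i) (r b) \<and> ent (r b) (r i)" if "i \<le> b" "b < t" for b using chain[OF that] by blast
  moreover have "l b = bot" if "i < b" "b < t" for b using chain[of b] that by simp
  ultimately show ?thesis using that[of i] i ltri li ri by blast
qed

section \<open>Tails of the rival query around lost gaps\<close>

definition lost where "lost t \<longleftrightarrow> 1 \<le> t \<and> t \<le> n \<and> l t \<noteq> bot \<and> \<not> ent (l t) (l' t)"

definition start where "start t = (SOME i. 1 \<le> i \<and> i < t \<and>
  (\<forall>b. i \<le> b \<and> b < t \<longrightarrow> ent (r i) (r b) \<and> ent (r b) (r i)) \<and> (\<forall>b. i < b \<and> b < t \<longrightarrow> l b = bot) \<and>
  ent (l t) (r i) \<and> ent (r i) (l t) \<and> ent (l' i) (r i) \<and> ent (r i) (l' i))"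

lemma start:
  assumes "lost t"
  shows "1 \<le> start t" "start t < t" "\<And>b. start t \<le> b \<Longrightarrow> b < t \<Longrightarrow> ent (r (start t)) (r b) \<and> ent (r b) (r (start t))"
    "\<And>b. start t < b \<Longrightarrow> b < t \<Longrightarrow> l b = bot" "ent (l t) (r (start t))" "ent (r (start t)) (l t)"
    "ent (l' (start t)) (r (start t))" "ent (r (start t)) (l' (start t))"
proof -
  have "\<exists>i. 1 \<le> i \<and> i < t \<and>
  (\<forall>b. i \<le> b \<and> b < t \<longrightarrow> ent (r i) (r b) \<and> ent (r b) (r i)) \<and> (\<forall>b. i < b \<and> b < t \<longrightarrow> l b = bot) \<and>
  ent (l t) (r i) \<and> ent (r i) (l t) \<and> ent (l' i) (r i) \<and> ent (r i) (l' i)"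
    by (rule lost_gap[of t]) (use assms in \<open>auto simp: lost_def intro!: exI\<close>)
  from someI_ex[OF this, folded start_def]
  show "1 \<le> start t" "start t < t" "\<And>b. start t \<le> b \<Longrightarrow> b < t \<Longrightarrow> ent (r (start t)) (r b) \<and> ent (r b) (r (start t))"
    "\<And>b. start t < b \<Longrightarrow> b < t \<Longrightarrow> l b = bot" "ent (l t) (r (start t))" "ent (r (start t)) (l t)"
    "ent (l' (start t)) (r (start t))" "ent (r (start t)) (l' (start t))" by blast+
qed

text \<open>The rival query may have to use the gap \<open>start t\<close> for the block lost by gap \<open>t\<close>, so it need
  not read \<open>r a\<close> at the first opportunity; \<open>reads a\<close> leaves this choice open.\<close>

definition reads where
  "reads a \<longleftrightarrow> (\<forall>w s. psat w r l n a (Suc s) \<longrightarrow>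
     (\<exists>u>s. (\<forall>k. s < k \<and> k < u \<longrightarrow> S (w k) (l' a)) \<and> psat w r l' n a u))"

text \<open>Letters of gap \<open>Suc a\<close> before \<open>u\<close> carry over, because a
  non-bottom gap that is not lost satisfies \<open>ent (l (Suc a)) (l' (Suc a))\<close>. From
  \<open>u\<close> on, the assumption \<open>reads (Suc a)\<close> fills the gap up to wherever the
  rival continues.\<close>

lemma tail_step:
  assumes a: "a \<le> n" and nl: "a < n \<Longrightarrow> \<not> lost (Suc a)" and rd: "a < n \<Longrightarrow> reads (Suc a)"
    and p: "psat w r l n a p"
  shows "psat w r l' n a p"
proof (cases "a = n")
  case True then show ?thesis using p by (simp add: psat_last)
next
  case False
  then have an: "a < n" using a by simp
  obtain u where u: "S (w p) (r a)" "p < u" "\<And>k. p < k \<Longrightarrow> k < u \<Longrightarrow> S (w k) (l (Suc a))" "psat w r l n (Suc a) u"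
    using p unfolding psat_step[OF an] by blast
  obtain v where v: "v > u - 1" "\<And>k. u - 1 < k \<Longrightarrow> k < v \<Longrightarrow> S (w k) (l' (Suc a))" "psat w r l' n (Suc a) v"
    using rd[OF an, unfolded reads_def, rule_format, of w "u - 1"] u(2,4) by auto
  have "S (w k) (l' (Suc a))" if "p < k" "k < v" for k
  proof (cases "k < u")
    case True
    then have "S (w k) (l (Suc a))" using u(3) that by blast
    then have "l (Suc a) \<noteq> bot" using bot by metis
    then have "ent (l (Suc a)) (l' (Suc a))" using nl an by (auto simp: lost_def)
    then show ?thesis using \<open>S (w k) (l (Suc a))\<close> entD by blast
  qed (use v(2) that in simp)
  moreover have "p < v" using u(2) v(1) by linarith
  ultimately show ?thesis unfolding psat_step[OF an] using u(1) v(3) by blast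
qed

end

subsection \<open>Equivalence with a rival query\<close>

context letters begin

lemma psat_cons:
  assumes "i < n" "S (w p) (r i)" "p < u" "\<And>k. p < k \<Longrightarrow> k < u \<Longrightarrow> S (w k) (l (Suc i))" "psat w r l n (Suc i) u"
  shows "psat w r l n i p"
  unfolding psat_step[OF assms(1)] using assms by blast

lemma psat_adjacent:
  assumes "a \<le> b" "b \<le> n" "psat w r l n b (p + (b - a))" "\<And>c. a \<le> c \<Longrightarrow> c < b \<Longrightarrow> S (w (p + (c - a))) (r c)"
  shows "psat w r l n a p"
proof -
  have "psat w r l n c (p + (c - a))" if "a \<le> c" "c \<le> b" for c
    using that(2,1)
  proof (induction c rule: inc_induct)
    case (step c)
    show ?case
      by (rule psat_cons[where u = "p + (Suc c - a)"]) (use step assms in auto)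
  qed (use assms in simp)
  from this[of a] show ?thesis using assms by simp
qed

lemma psat_bot_run:
  assumes "psat w r l n a p" "a \<le> b" "b \<le> n" "\<And>c. a < c \<Longrightarrow> c \<le> b \<Longrightarrow> l c = bot"
  shows "psat w r l n b (p + (b - a))"
  using assms(2,3,4)
proof (induction b rule: dec_induct)
  case (step b)
  then have IH: "psat w r l n b (p + (b - a))" "b < n" by simp_all
  then obtain u where u: "p + (b - a) < u" "\<And>k. p + (b - a) < k \<Longrightarrow> k < u \<Longrightarrow> S (w k) (l (Suc b))"
    "psat w r l n (Suc b) u" unfolding psat_step[OF IH(2)] by blast
  have "u = Suc (p + (b - a))"
  proof (rule ccontr)
    assume "u \<noteq> Suc (p + (b - a))"
    then have "S (w (Suc (p + (b - a)))) (l (Suc b))" using u(1,2) by simp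
    then show False using step bot by simp
  qed
  then show ?case using u(3) step by (simp add: Suc_diff_le)
qed (use assms in simp)

end

context rival begin

text \<open>On this stretch the conjuncts are equivalent, the gaps between them are
  \<open>bot\<close>, and \<open>l t\<close> is equivalent to the conjuncts. The tail therefore sees
  one uninterrupted run with room for \<open>t - a\<close> conjuncts, followed by tail
  \<open>t\<close>.\<close>

lemma lost_run:
  assumes t: "lost t" and a: "start t \<le> a" "a < t" and p: "psat w r l n a p"
  obtains u where "p + (t - a) \<le> u" "psat w r l n t u" "\<And>k. p \<le> k \<Longrightarrow> k < u \<Longrightarrow> S (w k) (r (start t))"
proof -
  let ?x = "r (start t)"
  have tn: "t \<le> n" using t by (simp add: lost_def)
  have run: "psat w r l n b (p + (b - a))" if "a \<le> b" "b < t" for b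
    by (rule psat_bot_run[OF p that(1)]) (use that tn start(4)[OF t] a in auto)
  have S: "S (w (p + (b - a))) ?x" if "a \<le> b" "b < t" for b
    using psat_first[OF _ run[OF that]] start(3)[OF t, of b] that a tn entD by auto
  have t1: "a \<le> t - 1" "t - 1 < t" "t - 1 < n" "Suc (t - 1) = t" using a tn by auto
  obtain u where u: "p + (t - 1 - a) < u" "\<And>k. p + (t - 1 - a) < k \<Longrightarrow> k < u \<Longrightarrow> S (w k) (l t)"
    "psat w r l n t u" using run[OF t1(1,2)] unfolding psat_step[OF t1(3)] t1(4) by blast
  have "S (w k) ?x" if k: "p \<le> k" "k < u" for k
  proof (cases "k \<le> p + (t - 1 - a)")
    case True
    then show ?thesis using S[of "a + (k - p)"] k t1 by simp
  next
    case False
    then show ?thesis using u(2)[of k] k start(5)[OF t] entD by simp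
  qed
  then show ?thesis using that[of u] u t1 by simp
qed

text \<open>At \<open>a = start t\<close> the rival reads the surplus of the run in gap
  \<open>a\<close> and places conjuncts \<open>a\<close> to \<open>t - 1\<close> at the end of the
  run, where the given query places them at its beginning. Elsewhere it reads \<open>r a\<close> at
  once. Strictly inside a stretch nothing guarantees that \<open>l' a\<close> accepts a surplus,
  hence the exclusion.\<close>

lemma reads:
  assumes "1 \<le> a" "a \<le> n" "\<And>t. lost t \<Longrightarrow> start t < a \<Longrightarrow> a < t \<Longrightarrow> False"
  shows "reads a"
  using assms
proof (induction "n - a" arbitrary: a rule: less_induct)
  case less
  show ?case
  proof (cases "\<exists>t. lost t \<and> start t = a")
    case True
    then obtain t where t: "lost t" "start t = a" by blast
    have tn: "t \<le> n" "l t \<noteq> bot" using t by (auto simp: lost_def)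
    note st = start[OF t(1), unfolded t(2)]
    \<comment> \<open>No lost stretch has \<open>t\<close> strictly inside, because its inner gaps
      are \<open>bot\<close> and \<open>l t\<close> is not.\<close>
    have "reads t" by (rule less.hyps) (use st(2) tn start(4) in auto)
    show ?thesis
      unfolding reads_def
    proof (intro allI impI)
      fix w s assume "psat w r l n a (Suc s)"
      then obtain u where u: "Suc s + (t - a) \<le> u" "psat w r l n t u" "\<And>k. s < k \<Longrightarrow> k < u \<Longrightarrow> S (w k) (r a)"
        using lost_run[OF t(1) _ st(2)] t(2) Suc_le_eq by (metis order_refl)
      then obtain v where v: "u - 1 < v" "\<And>k. u - 1 < k \<Longrightarrow> k < v \<Longrightarrow> S (w k) (l' t)" "psat w r l' n t v"
        using \<open>reads t\<close>[unfolded reads_def, rule_format, of w "u - 1"] by auto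
      have t1: "t - 1 < n" "Suc (t - 1) = t" "a \<le> t - 1" using tn st by auto
      define z where "z = u - (t - a)"
      have z: "s < z" "z + (t - 1 - a) = u - 1" "u - 1 < u" using u(1) st(2) by (auto simp: z_def)
      have Sb: "S (w k) (r b)" if "s < k" "k < u" "a \<le> b" "b < t" for k b
        using u(3)[OF that(1,2)] st(3)[OF that(3,4)] entD by blast
      have "psat w r l' n (t - 1) (u - 1)"
        by (rule psat_cons[OF t1(1) _ v(1)]) (use v Sb z t1 st in auto)
      then have "psat w r l' n a z"
        by (intro psat_adjacent[OF t1(3)]) (use z t1 Sb in auto)
      moreover have "\<forall>k. s < k \<and> k < z \<longrightarrow> S (w k) (l' a)"
        using u(3) st(8) entD by (auto simp: z_def)
      ultimately show "\<exists>u>s. (\<forall>k. s < k \<and> k < u \<longrightarrow> S (w k) (l' a)) \<and> psat w r l' n a u" using z by blast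
    qed
  next
    case False
    have nl: "\<not> lost (Suc a)"
    proof
      assume l: "lost (Suc a)"
      then have "start (Suc a) < a" using start(2)[OF l] False by (metis less_Suc_eq)
      then show False using less.prems(3)[OF l] by simp
    qed
    have "reads (Suc a)" if "a < n"
    proof (rule less.hyps)
      fix t assume t: "lost t" "start t < Suc a" "Suc a < t"
      then have "start t < a" using False by (metis less_Suc_eq)
      then show False using less.prems(3)[OF t(1)] t by simp
    qed (use that in auto)
    then have "psat w r l' n a (Suc s)" if "psat w r l n a (Suc s)" for w s
      using tail_step[OF less.prems(2) _ _ that] nl by simp
    then show ?thesis unfolding reads_def by (metis less_Suc_eq not_less_eq)
  qed
qed

lemma clean_tail:
  assumes a: "a \<le> n" and clean: "\<And>t. lost t \<Longrightarrow> start t \<le> a \<Longrightarrow> a < t \<Longrightarrow> False" and p: "psat w r l n a p"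
  shows "psat w r l' n a p"
proof (rule tail_step[OF a _ _ p])
  show "\<not> lost (Suc a)" using clean[of "Suc a"] start(2)[of "Suc a"] by auto
  show "reads (Suc a)" if "a < n"
  proof (rule reads)
    fix t assume "lost t" "start t < Suc a" "Suc a < t"
    then show False using clean[of t] by simp
  qed (use that in auto)
qed

text \<open>The extra letter at \<open>s\<close> is harmless for one of two reasons. On a lost
  stretch it merely lengthens a run whose surplus gap \<open>t\<close> absorbs. Otherwise the given
  query holds in all words \<open>ins i A (EW k)\<close>, and a suitable \<open>k\<close> transfers
  this to \<open>w\<close>.\<close>

lemma repeat_head:
  assumes i: "1 \<le> i" "i \<le> n" and fo: "\<not> ent (l' i) (l i)"
    and s: "S (w s) (r i)" and p: "psat w r l n i (Suc s)"
  shows "psat w r l n i s"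
proof (cases "\<exists>t. lost t \<and> start t \<le> i \<and> i < t")
  case True
  then obtain t where t: "lost t" "start t \<le> i" "i < t" by blast
  have tn: "t \<le> n" using t by (simp add: lost_def)
  obtain u where u: "Suc s + (t - i) \<le> u" "psat w r l n t u" "\<And>k. Suc s \<le> k \<Longrightarrow> k < u \<Longrightarrow> S (w k) (r (start t))"
    using lost_run[OF t p] by blast
  have "S (w s) (r (start t))" using s start(3)[OF t(1), of i] t entD by blast
  then have S: "S (w k) (r (start t))" if "s \<le> k" "k < u" for k using u(3)[of k] that by (cases "k = s") auto
  have Sb: "S (w k) (r b)" if "s \<le> k" "k < u" "i \<le> b" "b < t" for k b
    using S[OF that(1,2)] start(3)[OF t(1), of b] that t entD by auto
  have t1: "t - 1 < n" "Suc (t - 1) = t" "i \<le> t - 1" using tn t by auto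
  have "psat w r l n (t - 1) (s + (t - 1 - i))"
    by (rule psat_cons[OF t1(1), where u = u])
      (use Sb S u t1 start(6)[OF t(1)] entD in auto)
  then show ?thesis by (intro psat_adjacent[OF t1(3)]) (use t1 u Sb in auto)
next
  case False
  obtain A where A: "A \<in> N (l i) (l i)" "S A (l' i)"
    using N_ex[of "l i" "l i" "l' i"] fo i l_in l'_in by blast
  have nA: "\<not> S A (l i)" using N_avoids[OF A(1)] i l_in by blast
  \<comment> \<open>If the given query failed for some \<open>k\<close>, the rival would fail for an
    admissible \<open>k\<close> too. But there it reads \<open>A\<close> in gap \<open>i\<close> and
    the rest by \<open>clean_tail\<close>, since \<open>i\<close> lies on no lost stretch.\<close>
  have all: "psat (ins i A (EW k)) r l n 0 0" if k: "adm i k" for k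
  proof (rule ccontr)
    assume "\<not> ?thesis"
    then obtain k where k: "adm i k" "\<not> psat (ins i A (EW k)) r l' n 0 0" using neg2[OF i A(1) k] by blast
    have "psat (EW k) r l n i i"
      using psatI[OF emb_tail[OF EW_self[OF k(1)], of i]] adm_cpos[OF k(1), of i] by simp
    then have "psat (EW k) r l' n i i" using clean_tail[OF i(2)] False by blast
    then show False using ins_sat[OF i A(2) k(1)] k(2) by blast
  qed
  obtain f where f: "f i = Suc s" "emb w r l n i f" using p by (auto simp: psat_def)
  \<comment> \<open>The blocks get the lengths of the gaps of \<open>f\<close>. From index
    \<open>i\<close> on, every letter of \<open>EW k\<close> then faces a letter of \<open>w\<close>
    that satisfies at least the same queries of \<open>L\<close>, which is \<open>dom\<close>
    below.\<close>
  define k where "k j = (if i < j \<and> j \<le> n then f j - f (j - 1) - 1 else 0)" for j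
  have "adm i k"
    unfolding adm_def
  proof (intro conjI allI impI)
    fix j assume j: "1 \<le> j \<and> j \<le> n \<and> l j = bot"
    show "k j = 0"
    proof (rule ccontr)
      assume "k j \<noteq> 0"
      then have "i < j" "Suc (f (j - 1)) < f j" by (auto simp: k_def split: if_splits)
      then have "S (w (Suc (f (j-1)))) (l j)" using emb_gap[OF f(2), of "j-1" "Suc (f (j-1))"] j by (cases j) auto
      then show False using j bot by simp
    qed
  qed (simp add: k_def)
  have c: "cpos k j = i + (f j - Suc s)" if "i \<le> j" "j \<le> n" for j
    using that
  proof (induction j rule: dec_induct)
    case base then show ?case using adm_cpos[OF \<open>adm i k\<close>] f by simp
  next
    case (step j)
    then show ?case using emb_less[OF f(2), of j] emb_le[OF f(2), of i j] f(1) by (simp add: k_def)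
  qed
  have dom: "S (w (Suc s + (q - i))) y" if q: "i \<le> q" and y: "y \<in> L" "S (EW k q) y" for q y
  proof (cases rule: cpos_cases[of k n q])
    case beyond
    then show ?thesis using y empty by (auto simp: ew_beyond)
  next
    case (hit h)
    have ih: "i \<le> h"
    proof (rule ccontr)
      assume "\<not> i \<le> h"
      then show False using hit q adm_cpos[OF \<open>adm i k\<close>, of h] by simp
    qed
    have fh: "Suc s \<le> f h" using emb_le[OF f(2), of i h] f(1) ih hit by simp
    have "ent (r h) y" using y hit EW_hit_S[of h y k] by simp
    moreover have "Suc s + (q - i) = f h" using c[OF ih hit(1)] hit(2) fh by simp
    ultimately show ?thesis using emb_S[OF f(2) ih hit(1)] entD by simp
  next
    case (gap h)
    have ih: "i \<le> h"
    proof (rule ccontr)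
      assume "\<not> i \<le> h"
      then show False using gap q adm_cpos[OF \<open>adm i k\<close>, of "Suc h"] by simp
    qed
    have fh: "Suc s \<le> f h" "f h < f (Suc h)" using emb_le[OF f(2), of i h] emb_less[OF f(2), of h] f(1) ih gap by auto
    have "EW k q = can (l (Suc h))" by (rule ew_gap[OF gap])
    moreover have "l (Suc h) \<in> L"
    proof -
      have "k (Suc h) \<noteq> 0" using gap by (intro notI) simp
      then have "l (Suc h) \<noteq> bot" using \<open>adm i k\<close> gap(1) unfolding adm_def by fastforce
      then show ?thesis using l_in[of "Suc h"] gap by auto
    qed
    ultimately have en: "ent (l (Suc h)) y" using y by (simp add: can_ent)
    have "f h < Suc s + (q - i)" "Suc s + (q - i) < f (Suc h)"
      using c[OF ih] c[of "Suc h"] gap ih fh by (auto simp del: cpos.simps)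
    then show ?thesis using emb_gap[OF f(2) ih gap(1)] en entD by blast
  qed
  obtain g where g: "g 0 = 0" "emb (ins i A (EW k)) r l n 0 g" using all[OF \<open>adm i k\<close>] by (auto simp: psat_def)
  have gi: "g i = i" using ins_canon[OF nA i \<open>adm i k\<close> g(2,1)] by simp
  have gt: "i < g j" if "i < j" "j \<le> n" for j
    using emb_mono[OF g(2), of i j] gi that by simp
  have dom': "S (w (s + (q - i))) y" if "i < q" "y \<in> insert bot L" "S (ins i A (EW k) q) y" for q y
  proof -
    have "y \<in> L" using that bot by auto
    moreover have "S (EW k (q - 1)) y" using that by (simp add: ins_def)
    ultimately have "S (w (Suc s + (q - 1 - i))) y" using dom[of "q-1" y] that by simp
    moreover have "Suc s + (q - 1 - i) = s + (q - i)" using that by simp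
    ultimately show ?thesis by (simp only:)
  qed
  \<comment> \<open>\<open>A\<close> is read by \<open>r i\<close> alone, so the letter of
    \<open>w\<close> at \<open>s\<close> can take its place; all later letters are dominated by
    those of \<open>w\<close>.\<close>
  have "emb w r l n i (\<lambda>j. s + (g j - i))"
    unfolding emb_def
  proof (intro conjI allI impI)
    fix j assume j: "i \<le> j \<and> j \<le> n"
    show "S (w (s + (g j - i))) (r j)"
    proof (cases "j = i")
      case True then show ?thesis using s gi by simp
    next
      case False
      then show ?thesis using dom'[of "g j" "r j"] gt[of j] emb_S[OF g(2), of j] j r_in' by simp
    qed
  next
    fix j assume j: "i \<le> j \<and> j < n"
    then show "s + (g j - i) < s + (g (Suc j) - i)"
      using emb_less[OF g(2), of j] gt[of "Suc j"] by simp
    fix q assume q: "s + (g j - i) < q \<and> q < s + (g (Suc j) - i)"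
    have gj: "i \<le> g j" using gt[of j] gi j by (cases "j = i") auto
    obtain q' where q': "i < q'" "g j < q'" "q' < g (Suc j)" "s + (q' - i) = q"
      by (rule that[of "i + (q - s)"]) (use q gj in auto)
    have "S (ins i A (EW k) q') (l (Suc j))" using emb_gap[OF g(2), of j] j q' by simp
    then show "S (w q) (l (Suc j))" using dom'[OF q'(1) l_in[of "Suc j"]] j q'(4) by simp
  qed
  then show ?thesis by (rule psatI) (simp add: gi)
qed

text \<open>If \<open>l' (Suc a)\<close> does not entail \<open>l (Suc a)\<close>, every letter of
  that gap satisfies \<open>r (Suc a)\<close> by \<open>foreign_r\<close>. Then
  \<open>repeat_head\<close> moves the start of the tail back letter by letter until the gap is
  empty.\<close>

lemma rival_tail: "a \<le> n \<Longrightarrow> psat w r l' n a p \<Longrightarrow> psat w r l n a p"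
proof (induction a arbitrary: p rule: inc_induct)
  case base then show ?case by (simp add: psat_last)
next
  case (step a)
  obtain u where u: "S (w p) (r a)" "p < u" "\<And>k. p < k \<Longrightarrow> k < u \<Longrightarrow> S (w k) (l' (Suc a))" "psat w r l' n (Suc a) u"
    using step.prems unfolding psat_step[OF step(2)] by blast
  have pu: "psat w r l n (Suc a) u" by (rule step.IH[OF u(4)])
  have i: "1 \<le> Suc a" "Suc a \<le> n" using step by auto
  show ?case
  proof (cases "ent (l' (Suc a)) (l (Suc a))")
    case True
    then show ?thesis using psat_cons[OF step(2) u(1,2) _ pu] u(3) entD by blast
  next
    case False
    have "psat w r l n (Suc a) v" if "p < v" "v \<le> u" for v
      using that(2,1)
    proof (induction v rule: inc_induct)
      case (step v)
      then show ?case
        using repeat_head[OF i False, of w v] u(3)[of v] foreign_r[OF i False] entD by simp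
    qed (rule pu)
    then have "psat w r l n (Suc a) (Suc p)" using u(2) by simp
    moreover have "S (w k) (l (Suc a))" if "p < k" "k < Suc p" for k using that by simp
    ultimately show ?thesis using psat_cons[where w = w and r = r and l = l and p = p and u = "Suc p", OF step(2) u(1) lessI] by blast
  qed
qed

text \<open>Lost stretches start at 1 or later, so index 0 lies outside all of them and
  \<open>clean_tail\<close> applies.\<close>

lemma rival_equiv: "psat w r l n 0 p \<longleftrightarrow> psat w r l' n 0 p"
proof
  show "psat w r l n 0 p \<Longrightarrow> psat w r l' n 0 p"
    by (rule clean_tail[of 0]) (use start(1) in force)+
qed (rule rival_tail[of 0, simplified])

end

subsection \<open>The example words\<close>

context peerless_seq begin

lemma ins_dup: "i < s \<Longrightarrow> ins i A (dup s w) = dup (Suc s) (ins i A w)"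
  by (auto simp: ins_def dup_def fun_eq_iff)

lemma pump_block:
  assumes k: "adm i k" and j: "i < j" "j \<le> n" "n + 2 \<le> k j"
    and p: "psat (ins i A (EW k)) r l n 0 0"
  shows "psat (ins i A (EW (k(j := Suc (k j))))) r l n 0 0"
proof -
  let ?s = "Suc (cpos k (j - 1))"
  have s: "i < ?s" using cpos_ge[of "j-1" k] j by linarith
  have "EW (k(j := Suc (k j))) = dup ?s (EW k)" by (rule ew_dup) (use j in auto)
  then have eq: "ins i A (EW (k(j := Suc (k j)))) = dup (Suc ?s) (ins i A (EW k))"
    using ins_dup[OF s] by simp
  have cj: "cpos k j = ?s + k j" using j by (cases j) auto
  show ?thesis
    unfolding eq
  proof (rule psat_pump[OF _ j(3) p])
    fix q assume q: "Suc ?s \<le> q" "q < Suc ?s + k j"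
    have "EW k (q - 1) = can (l (Suc (j - 1)))"
      by (rule ew_gap) (use q cj j in \<open>auto simp del: cpos.simps\<close>)
    then show "ins i A (EW k) q = can (l j)" using q s j by (simp add: ins_def)
  qed
qed

text \<open>Shortening a block of more than n + 2 letters preserves failure by
  \<open>pump_block\<close>, and the total length decreases.\<close>

lemma bounded_failure:
  assumes "adm i k" "\<not> psat (ins i A (EW k)) r l n 0 0"
  shows "\<exists>k. adm i k \<and> \<not> psat (ins i A (EW k)) r l n 0 0 \<and> (\<forall>j. 1 \<le> j \<and> j \<le> n \<longrightarrow> k j \<le> n + 2)"
  using assms
proof (induction "sum k {1..n}" arbitrary: k rule: less_induct)
  case less
  show ?case
  proof (cases "\<forall>j. 1 \<le> j \<and> j \<le> n \<longrightarrow> k j \<le> n + 2")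
    case False
    then obtain j where j: "1 \<le> j" "j \<le> n" "n + 2 < k j" by auto
    define k0 where "k0 = k(j := k j - 1)"
    have k: "k = k0(j := Suc (k0 j))" using j by (auto simp: k0_def)
    have a0: "adm i k0" using less.prems(1) by (auto simp: adm_def k0_def)
    have ij: "i < j" by (rule ccontr) (use less.prems(1) j in \<open>auto simp: adm_def not_less\<close>)
    have "\<not> psat (ins i A (EW k0)) r l n 0 0"
    proof
      assume "psat (ins i A (EW k0)) r l n 0 0"
      moreover have "n + 2 \<le> k0 j" using j by (simp add: k0_def)
      ultimately have "psat (ins i A (EW (k0(j := Suc (k0 j))))) r l n 0 0" using pump_block[OF a0 ij j(2)] by blast
      then show False using less.prems(2) k[symmetric] by simp
    qed
    moreover have "sum k0 {1..n} < sum k {1..n}"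
    proof (rule sum_strict_mono_ex1)
      show "\<exists>x\<in>{1..n}. k0 x < k x" by (rule bexI[of _ j]) (use j in \<open>auto simp: k0_def\<close>)
    qed (auto simp: k0_def)
    ultimately show ?thesis using less.hyps a0 by blast
  qed (use less.prems in blast)
qed

text \<open>Too few letters for the given query, but enough for every query with fewer conjuncts,
  whatever they are.\<close>

definition short where "short p = (if p < n then full else e)"

text \<open>There is room for exactly n + 1 conjuncts, and only the one at \<open>i\<close> is put
  to a test.\<close>

definition defect where "defect i A p = (if p = i then A else if p \<le> n then full else e)"

definition bad where "bad i A = (SOME k. adm i k \<and> \<not> psat (ins i A (EW k)) r l n 0 0 \<and>
  (\<forall>j. 1 \<le> j \<and> j \<le> n \<longrightarrow> k j \<le> n + 2))"

lemma bad:
  assumes "adm i k" "\<not> psat (ins i A (EW k)) r l n 0 0"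
  shows "adm i (bad i A)" "\<not> psat (ins i A (EW (bad i A))) r l n 0 0"
    "1 \<le> j \<Longrightarrow> j \<le> n \<Longrightarrow> bad i A j \<le> n + 2"
  using someI_ex[OF bounded_failure[OF assms]] unfolding bad_def by blast+

definition Pos where "Pos = (\<lambda>t. EW (once t)) ` {..n}"

definition NegD where "NegD = (\<lambda>(i, A). defect i A) ` (SIGMA i:{..n}. N (r i) (r i))"
definition NegI where "NegI = {w \<in> (\<lambda>(i, A). ins i A (EW (\<lambda>_. 0))) `
    (SIGMA i:{1..n}. N (l i) (r i) \<union> N (l i) (l i)). \<not> psat w r l n 0 0}"
definition NegB where "NegB = (\<lambda>(i, A). ins i A (EW (bad i A))) `
    {iA \<in> (SIGMA i:{1..n}. N (l i) (l i)).
      \<exists>k. adm (fst iA) k \<and> \<not> psat (ins (fst iA) (snd iA) (EW k)) r l n 0 0}"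

definition Neg where "Neg = insert short (NegD \<union> NegI \<union> NegB)"

lemma cpos_once0: "cpos (once 0) h = h" by (rule cpos_zero) (simp add: once_def)

lemma Pos_sat: "w \<in> Pos \<Longrightarrow> psat w r l n 0 0"
  unfolding Pos_def using psatI[OF EW_self[OF adm_once]] by auto

lemma Neg_unsat: "w \<in> Neg \<Longrightarrow> \<not> psat w r l n 0 0"
proof
  assume w: "w \<in> Neg" and p: "psat w r l n 0 0"
  obtain f where f: "f 0 = 0" "emb w r l n 0 f" using p by (auto simp: psat_def)
  have fn: "n \<le> f n" using emb_mono[OF f(2), of 0 n] f(1) by simp
  have wn: "w (f n) \<noteq> e" using emb_S[OF f(2), of n] last by auto
  from w consider "w = short" | "w \<in> NegD" | "w \<in> NegI" | "w \<in> NegB" by (auto simp: Neg_def)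
  then show False
  proof cases
    case 1
    then show ?thesis using wn fn by (simp add: short_def)
  next
    case 2
    then obtain i A where iA: "i \<le> n" "A \<in> N (r i) (r i)" "w = defect i A" by (auto simp: NegD_def)
    have "f n \<le> n" using wn iA fn by (auto simp: defect_def split: if_splits)
    then have "f i = i" using emb_mono[OF f(2), of 0 i] emb_mono[OF f(2), of i n] iA f(1) by simp
    then have "S A (r i)" using emb_S[OF f(2), of i] iA by (simp add: defect_def)
    then show ?thesis using N_avoids[OF iA(2)] r_in'[OF iA(1)] by blast
  next
    case 3 then show ?thesis using p by (simp add: NegI_def)
  next
    case 4 then show ?thesis using p bad(2) by (auto simp: NegB_def)
  qed
qed

text \<open>The word \<open>EW (once 0)\<close> gives \<open>m \<le> n\<close> and
  \<open>ent (r i) (r' i)\<close>; \<open>short\<close> excludes \<open>m < n\<close>, and the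
  \<open>defect\<close> words give the converse entailments. After exchanging equivalent conjuncts,
  the query is a \<open>rival\<close>.\<close>

lemma unique:
  assumes r': "\<And>i. i \<le> m \<Longrightarrow> r' i \<in> L" and l': "\<And>i. 1 \<le> i \<Longrightarrow> i \<le> m \<Longrightarrow> l' i \<in> insert bot L"
    and lst: "1 \<le> m \<Longrightarrow> \<not> S e (r' m)"
    and P: "\<And>w. w \<in> Pos \<Longrightarrow> psat w r' l' m 0 0" and Ng: "\<And>w. w \<in> Neg \<Longrightarrow> \<not> psat w r' l' m 0 0"
  shows "psat w r l n 0 p \<longleftrightarrow> psat w r' l' m 0 p"
proof -
  have "EW (once 0) \<in> Pos" by (auto simp: Pos_def)
  then obtain f where f: "f 0 = 0" "emb (EW (once 0)) r' l' m 0 f" using P by (auto simp: psat_def)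
  have fm: "f m \<le> n"
  proof (cases "1 \<le> m")
    case True
    then have "EW (once 0) (f m) \<noteq> e" using emb_S[OF f(2), of m] lst by auto
    then show ?thesis using ew_beyond[of "once 0" n "f m" r l] cpos_once0[of n] by (metis not_less)
  qed (use f in \<open>cases m; simp\<close>)
  then have mn: "m \<le> n" using emb_mono[OF f(2), of 0 m] f(1) by simp
  have "m = n"
  proof (rule ccontr)
    assume "m \<noteq> n"
    then have "emb short r' l' m 0 id" using mn full r' by (auto simp: emb_def short_def)
    then show False using Ng[of short] psatI[of short r' l' m 0 id 0] by (simp add: Neg_def)
  qed
  note m = this
  have fi: "f i = i" if "i \<le> n" for i
    using emb_mono[OF f(2), of 0 i] emb_mono[OF f(2), of i n] that f(1) fm m by simp
  have rr': "ent (r i) (r' i)" if "i \<le> n" for i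
    using emb_S[OF f(2), of i] fi[OF that] EW_hit_S[of i "r' i" "once 0"] cpos_once0 that r' m by simp
  have r'r: "ent (r' i) (r i)" if "i \<le> n" for i
  proof (rule ccontr)
    assume "\<not> ent (r' i) (r i)"
    moreover have "r i \<in> insert bot L" "r' i \<in> insert bot L" using r_in' r' m that by auto
    ultimately obtain A where A: "A \<in> N (r i) (r i)" "S A (r' i)"
      using N_ex[of "r i" "r i" "r' i"] by blast
    then have "emb (defect i A) r' l' n 0 id" using full r' m by (auto simp: emb_def defect_def)
    moreover have "defect i A \<in> Neg" using A that by (auto simp: Neg_def NegD_def)
    ultimately show False using Ng[of "defect i A"] psatI[of "defect i A" r' l' n 0 id 0] m by simp
  qed
  have eq: "psat w r' l' m 0 p \<longleftrightarrow> psat w r l' n 0 p" for w p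
  proof -
    have "S a (r' i) \<longleftrightarrow> S a (r i)" if "i \<le> n" for a i using rr'[OF that] r'r[OF that] entD by blast
    then show ?thesis unfolding psat_def emb_def m by auto
  qed
  interpret rival S L bot can e full N n r l l'
  proof
    show "1 \<le> i \<Longrightarrow> i \<le> n \<Longrightarrow> l' i \<in> insert bot L" for i using l' m by simp
    show "t \<le> n \<Longrightarrow> psat (EW (once t)) r l' n 0 0" for t using P[of "EW (once t)"] eq by (auto simp: Pos_def)
    fix i A assume i: "1 \<le> i" "i \<le> n"
    { assume A: "A \<in> N (l i) (r i) \<union> N (l i) (l i)" "psat (ins i A (EW (\<lambda>_. 0))) r l' n 0 0"
      have "ins i A (EW (\<lambda>_. 0)) \<in> (\<lambda>(i, A). ins i A (EW (\<lambda>_. 0))) ` (SIGMA i:{1..n}. N (l i) (r i) \<union> N (l i) (l i))"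
        by (rule image_eqI[of _ _ "(i, A)"]) (use i A in auto)
      then show "psat (ins i A (EW (\<lambda>_. 0))) r l n 0 0"
        using Ng[of "ins i A (EW (\<lambda>_. 0))"] eq A(2) by (auto simp: Neg_def NegI_def) }
    fix k assume A: "A \<in> N (l i) (l i)" "adm i k" "\<not> psat (ins i A (EW k)) r l n 0 0"
    have "ins i A (EW (bad i A)) \<in> NegB" unfolding NegB_def
      by (rule image_eqI[of _ _ "(i, A)"]) (use i A in auto)
    then show "\<exists>k. adm i k \<and> \<not> psat (ins i A (EW k)) r l' n 0 0"
      using Ng[of "ins i A (EW (bad i A))"] eq bad(1)[OF A(2,3)] by (auto simp: Neg_def)
  qed
  show ?thesis using rival_equiv[of w p] eq by simp
qed

lemma EW_bound:
  assumes "\<And>j. 1 \<le> j \<Longrightarrow> j \<le> n \<Longrightarrow> k j \<le> n + 2"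
  shows "cpos k n \<le> n * (n + 3)"
  using cpos_bound[of n k "n+2"] assms by (simp add: algebra_simps)

text \<open>With blocks of at most n + 2 letters the last conjunct is at \<open>n * (n + 3)\<close>
  or earlier; position 0 and one inserted letter add 2.\<close>

definition word_len where "word_len = n * (n + 3) + 2"

lemma len_ge: "n + 2 \<le> word_len" unfolding word_len_def by simp

lemma Pos_Neg_cases:
  assumes "w \<in> Pos \<union> Neg"
  obtains (expansion) t where "w = EW (once t)" "t \<le> n"
  | (short) "w = short"
  | (defect) i A where "i \<le> n" "A \<in> N (r i) (r i)" "w = defect i A"
  | (ins) i A k where "1 \<le> i" "i \<le> n" "A \<in> N (l i) (r i) \<union> N (l i) (l i)" "w = ins i A (EW k)" "adm i k"
     "\<And>j. 1 \<le> j \<Longrightarrow> j \<le> n \<Longrightarrow> k j \<le> n + 2"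
proof -
  from assms consider "w \<in> Pos" | "w = local.short" | "w \<in> NegD" | "w \<in> NegI" | "w \<in> NegB" by (auto simp: Neg_def)
  then show ?thesis
  proof cases
    case 1 then show ?thesis using expansion by (auto simp: Pos_def)
  next
    case 2 then show ?thesis by (rule short)
  next
    case 3 then show ?thesis using defect by (auto simp: NegD_def)
  next
    case 4
    then obtain iA where "iA \<in> (SIGMA i:{1..n}. N (l i) (r i) \<union> N (l i) (l i))"
      "w = (\<lambda>(i, A). ins i A (EW (\<lambda>_. 0))) iA" unfolding NegI_def by blast
    then show ?thesis using ins[of "fst iA" "snd iA" "\<lambda>_. 0"] adm_zero by (cases iA) auto
  next
    case 5
    then obtain iA where iA: "iA \<in> (SIGMA i:{1..n}. N (l i) (l i))"
      "w = (\<lambda>(i, A). ins i A (EW (bad i A))) iA"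
      "\<exists>k. adm (fst iA) k \<and> \<not> psat (ins (fst iA) (snd iA) (EW k)) r l n 0 0" unfolding NegB_def by blast
    define i where "i = fst iA"
    define A where "A = snd iA"
    have *: "1 \<le> i" "i \<le> n" "A \<in> N (l i) (l i)" "w = ins i A (EW (bad i A))"
      using iA(1,2) by (auto simp: i_def A_def split_beta)
    obtain k where k: "adm i k" "\<not> psat (ins i A (EW k)) r l n 0 0" using iA(3) by (auto simp: i_def A_def)
    show ?thesis by (rule ins[OF *(1,2) _ *(4)]) (use * bad[OF k] in auto)
  qed
qed

lemma support:
  assumes "w \<in> Pos \<union> Neg" "word_len \<le> p"
  shows "w p = e"
  using assms(1)
proof (cases rule: Pos_Neg_cases)
  case (expansion t)
  have "once t j \<le> n + 2" for j by (simp add: once_def)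
  then have "cpos (once t) n < p" using EW_bound[of "once t"] assms(2) by (auto simp: word_len_def)
  then show ?thesis using expansion ew_beyond by simp
next
  case short
  then show ?thesis using assms(2) len_ge by (simp add: short_def)
next
  case (defect i A)
  then show ?thesis using assms(2) len_ge by (simp add: defect_def)
next
  case (ins i A k)
  have "cpos k n \<le> n * (n + 3)" by (rule EW_bound) (rule ins(6))
  then have c: "cpos k n < p - 1" using assms(2) by (simp add: word_len_def)
  moreover have "i < p" using c cpos_ge[of n k] ins by simp
  ultimately show ?thesis using ins ew_beyond by (simp add: ins_def)
qed

lemma EW_letters:
  assumes "adm i k"
  shows "EW k p \<in> insert e (can ` (L \<inter> (r ` {..n} \<union> l ` {1..n})))"
proof (cases rule: cpos_cases[of k n p])
  case beyond then show ?thesis by (simp add: ew_beyond)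
next
  case (hit h) then show ?thesis using r_in by (auto simp: ew_hit)
next
  case (gap h)
  have "k (Suc h) \<noteq> 0" using gap by (intro notI) simp
  then have "l (Suc h) \<noteq> bot" using assms gap(1) unfolding adm_def by fastforce
  then have "l (Suc h) \<in> L" using l_in[of "Suc h"] gap by auto
  then show ?thesis using ew_gap[OF gap, of r l] gap by auto
qed

lemma word_letters:
  assumes "w \<in> Pos \<union> Neg"
  shows "w p \<in> {e, full} \<union> can ` (L \<inter> (r ` {..n} \<union> l ` {1..n})) \<union>
    (\<Union>i\<le>n. N (r i) (r i)) \<union> (\<Union>i\<in>{1..n}. N (l i) (r i) \<union> N (l i) (l i))"
  using assms
proof (cases rule: Pos_Neg_cases)
  case (expansion t)
  then show ?thesis using EW_letters[OF adm_once, of t p] by auto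
next
  case short then show ?thesis by (simp add: short_def)
next
  case (defect i A) then show ?thesis by (auto simp: defect_def)
next
  case (ins i A k)
  then show ?thesis using EW_letters[OF ins(5)] by (auto simp: ins_def)
qed

text \<open>An example must mention its point, and a letter satisfying the non-trivial
  \<open>r n\<close> does.\<close>

lemma word_proper:
  assumes "w \<in> Pos \<union> Neg"
  shows "\<exists>p. S (w p) (r n)"
  using assms
proof (cases rule: Pos_Neg_cases)
  case (expansion t)
  then show ?thesis using EW_hit_S[of n "r n"] r_in' ent_refl by auto
next
  case short
  then show ?thesis using full r_in n_pos by (auto simp: short_def intro!: exI[of _ 0])
next
  case (defect i A)
  have "defect i A (if i = 0 then 1 else 0) = full" using n_pos by (simp add: defect_def)
  then show ?thesis using full[OF r_in[of n]] defect by (metis order_refl)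
next
  case (ins i A k)
  have "i \<le> cpos k n" using cpos_ge[of n k] ins by simp
  then have "w (Suc (cpos k n)) = EW k (cpos k n)" using ins by (simp add: ins_def)
  then show ?thesis using EW_hit_S[of n "r n" k] r_in'[of n] ent_refl by (metis order_refl)
qed

lemma Pos_card: "finite Pos" "card Pos \<le> n + 1"
  unfolding Pos_def using card_image_le[of "{..n}" "\<lambda>t. EW (once t)"] by auto

lemma Neg_card:
  assumes N: "\<And>x y. x \<in> r ` {..n} \<union> l ` {1..n} \<Longrightarrow> y \<in> r ` {..n} \<union> l ` {1..n} \<Longrightarrow> finite (N x y) \<and> card (N x y) \<le> v"
  shows "finite Neg" "card Neg \<le> 1 + (n + 1) * v + n * (2 * v) + n * v"
proof -
  let ?D = "SIGMA i:{..n}. N (r i) (r i)"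
  let ?I = "SIGMA i:{1..n}. N (l i) (r i) \<union> N (l i) (l i)"
  let ?B = "SIGMA i:{1..n}. N (l i) (l i)"
  have fin: "finite ?D" "finite ?I" "finite ?B" using N by auto
  have "card ?D = (\<Sum>i\<le>n. card (N (r i) (r i)))" using N by (intro card_SigmaI) auto
  also have "\<dots> \<le> (\<Sum>i\<le>n. v)" by (rule sum_mono) (use N in auto)
  finally have "card ?D \<le> (\<Sum>i\<le>n. v)" .
  then have D: "card ?D \<le> (n + 1) * v" by simp
  have u: "card (N (l i) (r i) \<union> N (l i) (l i)) \<le> 2 * v" if "i \<in> {1..n}" for i
    using card_Un_le[of "N (l i) (r i)" "N (l i) (l i)"] N[of "l i" "r i"] N[of "l i" "l i"] that by auto
  have "card ?I = (\<Sum>i\<in>{1..n}. card (N (l i) (r i) \<union> N (l i) (l i)))" using N by (intro card_SigmaI) auto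
  also have "\<dots> \<le> (\<Sum>i\<in>{1..n}. 2 * v)" by (rule sum_mono) (use u in auto)
  finally have "card ?I \<le> (\<Sum>i\<in>{1..n}. 2 * v)" .
  then have I: "card ?I \<le> n * (2 * v)" by simp
  have "card ?B = (\<Sum>i\<in>{1..n}. card (N (l i) (l i)))" using N by (intro card_SigmaI) auto
  also have "\<dots> \<le> (\<Sum>i\<in>{1..n}. v)" by (rule sum_mono) (use N in auto)
  finally have "card ?B \<le> (\<Sum>i\<in>{1..n}. v)" .
  then have B: "card ?B \<le> n * v" by simp
  have 1: "finite NegD" "card NegD \<le> (n + 1) * v"
    unfolding NegD_def using fin D card_image_le[OF fin(1), of "\<lambda>(i, A). defect i A"] by auto
  have 2: "finite NegI" "card NegI \<le> n * (2 * v)"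
  proof -
    let ?J = "(\<lambda>(i, A). ins i A (EW (\<lambda>_. 0))) ` ?I"
    have s: "NegI \<subseteq> ?J" by (auto simp: NegI_def)
    show "finite NegI" using s fin finite_subset by blast
    show "card NegI \<le> n * (2 * v)"
      using card_mono[OF _ s] fin I card_image_le[OF fin(2), of "\<lambda>(i, A). ins i A (EW (\<lambda>_. 0))"] by simp
  qed
  have 3: "finite NegB" "card NegB \<le> n * v"
  proof -
    let ?B' = "{iA \<in> ?B. \<exists>k. adm (fst iA) k \<and> \<not> psat (ins (fst iA) (snd iA) (EW k)) r l n 0 0}"
    have s: "?B' \<subseteq> ?B" by auto
    have fB: "finite ?B'" using s fin finite_subset by blast
    show "finite NegB" unfolding NegB_def using fB by blast
    show "card NegB \<le> n * v" unfolding NegB_def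
      using card_image_le[OF fB, of "\<lambda>(i, A). ins i A (EW (bad i A))"] card_mono[OF fin(3) s] B by linarith
  qed
  show "finite Neg" unfolding Neg_def using 1 2 3 by simp
  have "card Neg \<le> Suc (card (NegD \<union> NegI \<union> NegB))" unfolding Neg_def using 1 2 3 by (simp add: card_insert_if)
  also have "card (NegD \<union> NegI \<union> NegB) \<le> card NegD + card NegI + card NegB"
    using card_Un_le[of "NegD \<union> NegI" NegB] card_Un_le[of NegD NegI] by linarith
  finally show "card Neg \<le> 1 + (n + 1) * v + n * (2 * v) + n * v" using 1 2 3 by linarith
qed

end

subsection \<open>Static queries and instances\<close>

abbreviation holds where "holds A a x \<equiv> sat [A] a 0 x"

lemma EL_ELI: "x \<in> EL \<Sigma> \<Longrightarrow> x \<in> ELI \<Sigma>"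
  by (induction rule: EL.induct) (auto intro: ELI.intros)

lemma slice_single [simp]: "slice [A] 0 = A" by (simp add: slice_def)

lemma role_holds_ind: "role_holds A R a b \<Longrightarrow> a \<in> ind A \<and> b \<in> ind A"
  by (cases R) (force simp: ind_def)+

lemma holds_Fwd: "holds A a (Exists (Fwd P) x) \<longleftrightarrow> (\<exists>b. BFact P a b \<in> A \<and> holds A b x)"
  using role_holds_ind[of A "Fwd P" a] by auto

lemma holds_Inv: "holds A a (Exists (Inv P) x) \<longleftrightarrow> (\<exists>b. BFact P b a \<in> A \<and> holds A b x)"
  using role_holds_ind[of A "Inv P" a] by auto

lemma sat_slice: "x \<in> insert Bot (ELI \<Sigma>) \<Longrightarrow> sat D a l x \<longleftrightarrow> holds (slice D l) a x"
proof -
  have "sat D a l x \<longleftrightarrow> holds (slice D l) a x" if "x \<in> ELI \<Sigma>"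
    using that by (induction arbitrary: a rule: ELI.induct) auto
  then show "x \<in> insert Bot (ELI \<Sigma>) \<Longrightarrow> ?thesis" by auto
qed

fun rename :: "(nat \<Rightarrow> nat) \<Rightarrow> ('u, 'b) assertion \<Rightarrow> ('u, 'b) assertion" where
  "rename h (UFact A a) = UFact A (h a)"
| "rename h (BFact P a b) = BFact P (h a) (h b)"

lemma rename_rename [simp]: "rename g (rename h \<alpha>) = rename (g \<circ> h) \<alpha>" by (cases \<alpha>) auto

lemma rename_cong: "(\<And>k. g k = h k) \<Longrightarrow> rename g \<alpha> = rename h \<alpha>" by (cases \<alpha>) auto

lemma assertion_over_rename [simp]: "assertion_over \<Sigma> (rename h \<alpha>) = assertion_over \<Sigma> \<alpha>"
  by (cases \<alpha>) auto

lemma holds_hom: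
  assumes "x \<in> ELI \<Sigma>" "rename h ` A \<subseteq> B" "holds A a x"
  shows "holds B (h a) x"
  using assms(1,3)
proof (induction arbitrary: a rule: ELI.induct)
  case (ELI_Atom U)
  then show ?case using assms(2) by force
next
  case (ELI_Fwd P r)
  then obtain b where "BFact P a b \<in> A" "holds A b r" by (auto simp only: holds_Fwd)
  then show ?case using ELI_Fwd.IH assms(2) unfolding holds_Fwd by force
next
  case (ELI_Inv P r)
  then obtain b where "BFact P b a \<in> A" "holds A b r" by (auto simp only: holds_Inv)
  then show ?case using ELI_Inv.IH assms(2) unfolding holds_Inv by force
qed auto

text \<open>The tree-shaped instance of a query, with root 0. Even and odd names keep the two
  conjuncts apart while sharing the root, because \<open>2 * 0 - 1 = 0\<close> on naturals.\<close>

fun inst :: "('u, 'b) query \<Rightarrow> ('u, 'b) data" where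
  "inst (Atom A) = {UFact A 0}"
| "inst (Conj x y) = rename (\<lambda>k. 2 * k) ` inst x \<union> rename (\<lambda>k. 2 * k - 1) ` inst y"
| "inst (Exists (Fwd P) x) = insert (BFact P 0 1) (rename Suc ` inst x)"
| "inst (Exists (Inv P) x) = insert (BFact P 1 0) (rename Suc ` inst x)"
| "inst _ = {}"

lemma inst_finite: "finite (inst x)" by (induction x rule: inst.induct) auto

lemma inst_card: "card (inst x) \<le> qsize x"
proof (induction x rule: inst.induct)
  case (2 x y)
  have "card (inst (Conj x y)) \<le> card (rename (\<lambda>k. 2 * k) ` inst x) + card (rename (\<lambda>k. 2 * k - 1) ` inst y)"
    by (simp add: card_Un_le)
  also have "\<dots> \<le> card (inst x) + card (inst y)" by (intro add_mono card_image_le inst_finite)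
  finally show ?case using 2 by simp
next
  case (3 P x)
  have "card (inst (Exists (Fwd P) x)) \<le> Suc (card (rename Suc ` inst x))" by (simp add: card_insert_if inst_finite)
  also have "\<dots> \<le> Suc (card (inst x))" using card_image_le[OF inst_finite] by auto
  finally show ?case using 3 by simp
next
  case (4 P x)
  have "card (inst (Exists (Inv P) x)) \<le> Suc (card (rename Suc ` inst x))" by (simp add: card_insert_if inst_finite)
  also have "\<dots> \<le> Suc (card (inst x))" using card_image_le[OF inst_finite] by auto
  finally show ?case using 4 by simp
qed auto

lemma inst_data: "x \<in> ELI \<Sigma> \<Longrightarrow> data_instance \<Sigma> (inst x)"
  by (induction rule: ELI.induct) (auto simp: data_instance_def)

lemma inst_holds: "x \<in> ELI \<Sigma> \<Longrightarrow> holds (inst x) 0 x"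
proof (induction rule: ELI.induct)
  case (ELI_Conj x y)
  have "holds (inst (Conj x y)) (2 * 0) x" by (rule holds_hom[OF ELI_Conj.hyps(1) _ ELI_Conj.IH(1)]) simp
  moreover have "holds (inst (Conj x y)) (2 * 0 - 1) y" by (rule holds_hom[OF ELI_Conj.hyps(2) _ ELI_Conj.IH(2)]) simp
  ultimately show ?case by simp
next
  case (ELI_Fwd P r)
  have "holds (inst (Exists (Fwd P) r)) (Suc 0) r" by (rule holds_hom[OF ELI_Fwd.hyps(2) _ ELI_Fwd.IH]) auto
  then show ?case unfolding holds_Fwd by auto
next
  case (ELI_Inv P r)
  have "holds (inst (Exists (Inv P) r)) (Suc 0) r" by (rule holds_hom[OF ELI_Inv.hyps(2) _ ELI_Inv.IH]) auto
  then show ?case unfolding holds_Inv by auto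
qed auto

lemma inst_hom: "x \<in> ELI \<Sigma> \<Longrightarrow> holds B a x \<Longrightarrow> \<exists>h. h 0 = a \<and> rename h ` inst x \<subseteq> B"
proof (induction arbitrary: a rule: ELI.induct)
  case (ELI_Conj x y)
  then obtain g h where g: "g 0 = a" "rename g ` inst x \<subseteq> B" and h: "h 0 = a" "rename h ` inst y \<subseteq> B" by force
  \<comment> \<open>Even names follow \<open>g\<close> and odd names follow \<open>h\<close>. The
    root is the only name shared by both copies, and there the maps agree.\<close>
  define f where "f k = (if even k then g (k div 2) else h (Suc k div 2))" for k
  have "f (2 * k) = g k" "f (2 * k - 1) = h k" for k
    using g(1) h(1) by (cases k; simp add: f_def)+
  then have eq: "rename (f \<circ> (\<lambda>k. 2 * k)) = rename g" "rename (f \<circ> (\<lambda>k. 2 * k - 1)) = rename h"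
    by (auto intro!: ext rename_cong simp: o_def)
  have "f 0 = a" using g(1) by (simp add: f_def)
  moreover have "rename f ` inst (Conj x y) \<subseteq> B"
  proof
    fix \<beta> assume "\<beta> \<in> rename f ` inst (Conj x y)"
    then consider \<alpha> where "\<alpha> \<in> inst x" "\<beta> = rename f (rename (\<lambda>k. 2 * k) \<alpha>)"
      | \<alpha> where "\<alpha> \<in> inst y" "\<beta> = rename f (rename (\<lambda>k. 2 * k - 1) \<alpha>)" by auto
    then show "\<beta> \<in> B" using g(2) h(2) by cases (simp_all only: rename_rename eq, blast+)
  qed
  ultimately show ?case by blast
next
  case (ELI_Fwd P r)
  then obtain b where b: "BFact P a b \<in> B" "holds B b r" by (auto simp only: holds_Fwd)
  then obtain h where "h 0 = b" "rename h ` inst r \<subseteq> B" using ELI_Fwd.IH by blast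
  moreover have "case_nat a h \<circ> Suc = h" by auto
  ultimately show ?case using b by (intro exI[of _ "case_nat a h"]) (auto simp: image_image)
next
  case (ELI_Inv P r)
  then obtain b where b: "BFact P b a \<in> B" "holds B b r" by (auto simp only: holds_Inv)
  then obtain h where "h 0 = b" "rename h ` inst r \<subseteq> B" using ELI_Inv.IH by blast
  moreover have "case_nat a h \<circ> Suc = h" by auto
  ultimately show ?case using b by (intro exI[of _ "case_nat a h"]) (auto simp: image_image)
qed auto

text \<open>The right-hand side ranges over all sets of facts, also infinite ones and ones beyond
  the signature. The lower bound relies on this when it evaluates queries in an infinite
  model.\<close>

lemma inst_char:
  assumes x: "x \<in> ELI \<Sigma>" and y: "y \<in> insert Bot (ELI \<Sigma>)"
  shows "holds (inst x) 0 y \<longleftrightarrow> (\<forall>A a. holds A a x \<longrightarrow> holds A a y)"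
proof (cases "y = Bot")
  case True then show ?thesis using inst_holds[OF x] by auto
next
  case False
  then have "y \<in> ELI \<Sigma>" using y by blast
  show ?thesis
  proof
    assume y: "holds (inst x) 0 y"
    show "\<forall>A a. holds A a x \<longrightarrow> holds A a y"
      using inst_hom[OF x] holds_hom[OF \<open>y \<in> ELI \<Sigma>\<close> _ y] by metis
  qed (use inst_holds[OF x] in blast)
qed

lemma entails_iff:
  assumes x: "x \<in> insert Bot (ELI \<Sigma>)" and y: "y \<in> insert Bot (ELI \<Sigma>)"
  shows "entails \<Sigma> x y \<longleftrightarrow> (\<forall>A a. holds A a x \<longrightarrow> holds A a y)"
proof
  assume e: "entails \<Sigma> x y"
  show "\<forall>A a. holds A a x \<longrightarrow> holds A a y"
  proof (cases "x = Bot")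
    case False
    then have x': "x \<in> ELI \<Sigma>" using x by blast
    then have "temporal_instance \<Sigma> [inst x]" using inst_data by (simp add: temporal_instance_def)
    then have "holds (inst x) 0 y" using e inst_holds[OF x'] by (auto simp: entails_def)
    then show ?thesis using inst_char[OF x' y] by blast
  qed simp
next
  assume *: "\<forall>A a. holds A a x \<longrightarrow> holds A a y"
  show "entails \<Sigma> x y"
    unfolding entails_def
  proof (intro allI impI)
    fix D a l assume "sat D a l x"
    then have "holds (slice D l) a x" using sat_slice[OF x] by blast
    then show "sat D a l y" using * sat_slice[OF y] by blast
  qed
qed

definition everything :: "('u, 'b) signature \<Rightarrow> ('u, 'b) data" where
  "everything \<Sigma> = (\<lambda>A. UFact A 0) ` unary \<Sigma> \<union> (\<lambda>P. BFact P 0 0) ` binary \<Sigma>"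

lemma everything_holds: "x \<in> ELI \<Sigma> \<Longrightarrow> holds (everything \<Sigma>) 0 x"
proof (induction rule: ELI.induct)
  case (ELI_Fwd P r)
  then show ?case unfolding holds_Fwd by (auto simp: everything_def)
next
  case (ELI_Inv P r)
  then show ?case unfolding holds_Inv by (auto simp: everything_def)
qed (auto simp: everything_def)

lemma holds_empty: "x \<in> ELI \<Sigma> \<Longrightarrow> holds {} b x \<Longrightarrow> holds A a x"
  by (induction arbitrary: a b rule: ELI.induct) (auto simp: ind_def)

lemma holds_ind: "x \<in> ELI \<Sigma> \<Longrightarrow> holds A a x \<Longrightarrow> a \<notin> ind A \<Longrightarrow> holds {} b x"
proof (induction rule: ELI.induct)
  case (ELI_Atom U)
  then show ?case by (force simp: ind_def)
next
  case (ELI_Fwd P r)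
  then show ?case using role_holds_ind[of A "Fwd P" a] by auto
next
  case (ELI_Inv P r)
  then show ?case using role_holds_ind[of A "Inv P" a] by auto
qed auto

subsection \<open>Points avoiding given queries\<close>

text \<open>A query fails iff one of its conjuncts does. \<open>Bot\<close> is its own conjunct, so
  bottom left arguments need no separate treatment; \<open>Top\<close> has none, so no element can
  avoid it.\<close>

fun conjuncts :: "('u, 'b) query \<Rightarrow> ('u, 'b) query set" where
  "conjuncts Top = {}"
| "conjuncts (Conj x y) = conjuncts x \<union> conjuncts y"
| "conjuncts x = {x}"

fun subqueries :: "('u, 'b) query \<Rightarrow> ('u, 'b) query set" where
  "subqueries (Conj x y) = subqueries x \<union> subqueries y"
| "subqueries (Exists R x) = insert (Exists R x) (subqueries x)"
| "subqueries x = {x}"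

lemma subqueries_finite: "finite (subqueries x)" by (induction x) auto

lemma subqueries_card: "card (subqueries x) \<le> qsize x"
proof (induction x)
  case (Conj x y)
  then show ?case using card_Un_le[of "subqueries x" "subqueries y"] by simp
next
  case (Exists R x)
  then show ?case using subqueries_finite[of x] by (simp add: card_insert_if)
qed auto

lemma conjuncts_subqueries: "conjuncts x \<subseteq> subqueries x" by (induction x) auto

lemma subqueries_closed: "Exists R y \<in> subqueries x \<Longrightarrow> conjuncts y \<subseteq> subqueries x"
  by (induction x) (auto dest: set_mp[OF conjuncts_subqueries])

lemma holds_conjuncts: "x \<in> insert Bot (ELI \<Sigma>) \<Longrightarrow> holds A a x \<longleftrightarrow> (\<forall>c\<in>conjuncts x. holds A a c)"
proof -
  have "holds A a x \<longleftrightarrow> (\<forall>c\<in>conjuncts x. holds A a c)" if "x \<in> ELI \<Sigma>"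
    using that by (induction rule: ELI.induct) auto
  then show "x \<in> insert Bot (ELI \<Sigma>) \<Longrightarrow> ?thesis" by auto
qed

text \<open>In the instance below, an element \<open>C\<close> is the most general point at which all queries in
  \<open>C\<close> fail; the edges are exactly those compatible with this reading.\<close>

definition edge :: "'b \<Rightarrow> ('u, 'b) query set \<Rightarrow> ('u, 'b) query set \<Rightarrow> bool" where
  "edge P C C' \<longleftrightarrow> (\<forall>s. Exists (Fwd P) s \<in> C \<longrightarrow> conjuncts s \<inter> C' \<noteq> {}) \<and>
     (\<forall>s. Exists (Inv P) s \<in> C' \<longrightarrow> conjuncts s \<inter> C \<noteq> {})"

definition avoider :: "('u, 'b) signature \<Rightarrow> ('u, 'b) query set set \<Rightarrow> (('u, 'b) query set \<Rightarrow> nat) \<Rightarrow> ('u, 'b) data" where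
  "avoider \<Sigma> I h = {UFact A (h C) | A C. A \<in> unary \<Sigma> \<and> C \<in> I \<and> Atom A \<notin> C} \<union>
     {BFact P (h C) (h C') | P C C'. P \<in> binary \<Sigma> \<and> C \<in> I \<and> C' \<in> I \<and> edge P C C'}"

text \<open>By induction on \<open>s\<close>: an edge out of \<open>C\<close> forces, for each
  forward existential in \<open>C\<close>, a conjunct of its body into the target set, and dually
  for inverse roles. Injectivity recovers the set from its name.\<close>

lemma avoider_sound:
  assumes h: "inj_on h I" and s: "s \<in> insert Bot (ELI \<Sigma>)" and C: "C \<in> I" and H: "holds (avoider \<Sigma> I h) (h C) s"
  shows "conjuncts s \<inter> C = {}"
proof -
  have "s \<in> ELI \<Sigma>" using s H by auto
  then show ?thesis using C H
  proof (induction arbitrary: C rule: ELI.induct)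
    case (ELI_Atom A)
    then show ?case using h by (auto simp: avoider_def dest: inj_onD)
  next
    case (ELI_Fwd P r)
    from ELI_Fwd.prems obtain b where b: "BFact P (h C) b \<in> avoider \<Sigma> I h" "holds (avoider \<Sigma> I h) b r"
      unfolding holds_Fwd by blast
    then obtain C' where "C' \<in> I" "b = h C'" "edge P C C'"
      using h ELI_Fwd.prems(1) by (auto simp: avoider_def dest: inj_onD)
    then show ?case using ELI_Fwd.IH[of C'] b(2) by (auto simp: edge_def)
  next
    case (ELI_Inv P r)
    from ELI_Inv.prems obtain b where b: "BFact P b (h C) \<in> avoider \<Sigma> I h" "holds (avoider \<Sigma> I h) b r"
      unfolding holds_Inv by blast
    then obtain C' where "C' \<in> I" "b = h C'" "edge P C' C"
      using h ELI_Inv.prems(1) by (auto simp: avoider_def dest: inj_onD)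
    then show ?case using ELI_Inv.IH[of C'] b(2) by (auto simp: edge_def)
  qed auto
qed

text \<open>Sending \<open>d\<close> to the set of all members of \<open>S\<close> failing at
  \<open>d\<close> is a homomorphism. Inverse roles constrain an edge from both ends, so the whole
  failing set is recorded, which accounts for the power set.\<close>

lemma avoider_complete_ELI:
  assumes S: "\<And>R s. Exists R s \<in> S \<Longrightarrow> s \<in> ELI \<Sigma> \<and> conjuncts s \<subseteq> S" and I: "I = Pow S"
    and s: "s \<in> ELI \<Sigma>" and H: "holds A d s"
  shows "holds (avoider \<Sigma> I h) (h {c \<in> S. \<not> holds A d c}) s"
  using s H
proof (induction arbitrary: d rule: ELI.induct)
  case (ELI_Atom U)
  then show ?case by (auto simp: avoider_def I)
next
  let ?C = "\<lambda>d. {c \<in> S. \<not> holds A d c}"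
  have edge: "edge P (?C d) (?C d')" if "BFact P d d' \<in> A" for P d d'
    unfolding edge_def
  proof (intro conjI allI impI)
    fix s assume s: "Exists (Fwd P) s \<in> ?C d"
    then have "s \<in> ELI \<Sigma>" "conjuncts s \<subseteq> S" using S[of "Fwd P" s] by auto
    moreover have "\<not> holds A d' s" using s that holds_Fwd[of A d P s] by blast
    ultimately show "conjuncts s \<inter> ?C d' \<noteq> {}" using holds_conjuncts[of s \<Sigma> A d'] by blast
  next
    fix s assume s: "Exists (Inv P) s \<in> ?C d'"
    then have "s \<in> ELI \<Sigma>" "conjuncts s \<subseteq> S" using S[of "Inv P" s] by auto
    moreover have "\<not> holds A d s" using s that holds_Inv[of A d' P s] by blast
    ultimately show "conjuncts s \<inter> ?C d \<noteq> {}" using holds_conjuncts[of s \<Sigma> A d] by blast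
  qed
  { case (ELI_Fwd P r)
    then obtain b where b: "BFact P d b \<in> A" "holds A b r" unfolding holds_Fwd by blast
    then have "BFact P (h (?C d)) (h (?C b)) \<in> avoider \<Sigma> I h"
      using edge[OF b(1)] ELI_Fwd.hyps(1) unfolding avoider_def I by blast
    then show ?case using ELI_Fwd.IH[OF b(2)] unfolding holds_Fwd by blast
  next
    case (ELI_Inv P r)
    then obtain b where b: "BFact P b d \<in> A" "holds A b r" unfolding holds_Inv by blast
    then have "BFact P (h (?C b)) (h (?C d)) \<in> avoider \<Sigma> I h"
      using edge[OF b(1)] ELI_Inv.hyps(1) unfolding avoider_def I by blast
    then show ?case using ELI_Inv.IH[OF b(2)] unfolding holds_Inv by blast }
qed auto

text \<open>Without inverse roles an element only has to remember as many failing queries as its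
  predecessor, so sets of size two suffice for two queries.\<close>

lemma avoider_complete_EL:
  assumes S: "\<And>R s. Exists R s \<in> S \<Longrightarrow> s \<in> EL \<Sigma> \<and> conjuncts s \<subseteq> S" "\<And>P s. Exists (Inv P) s \<notin> S" "finite S"
    and I: "I = {C. C \<subseteq> S \<and> card C \<le> 2}"
    and s: "s \<in> EL \<Sigma>" and H: "holds A d s" and C: "C \<in> I" "\<And>c. c \<in> C \<Longrightarrow> \<not> holds A d c"
  shows "holds (avoider \<Sigma> I h) (h C) s"
  using s H C
proof (induction arbitrary: d C rule: EL.induct)
  case (EL_Atom U)
  then have "Atom U \<notin> C" by blast
  then show ?case using EL_Atom unfolding avoider_def by auto
next
  case (EL_Fwd P r)
  then obtain b where b: "BFact P d b \<in> A" "holds A b r" unfolding holds_Fwd by blast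
  have "\<exists>c. c \<in> conjuncts s \<and> \<not> holds A b c" if "Exists (Fwd P) s \<in> C" for s
  proof -
    have "s \<in> EL \<Sigma>" using S(1) that EL_Fwd.prems(2) I by blast
    moreover have "\<not> holds A b s" using EL_Fwd.prems(3)[OF that] b holds_Fwd[of A d P s] by blast
    ultimately show ?thesis using holds_conjuncts[of s \<Sigma> A b] EL_ELI by blast
  qed
  note ex = this
  \<comment> \<open>For each forward existential along \<open>P\<close> in \<open>C\<close>,
    \<open>f\<close> selects a conjunct of its body that fails at the successor. The target set
    keeps only these, so it is no larger than \<open>C\<close>.\<close>
  define f where "f e = (case e of Exists R s \<Rightarrow> SOME c. c \<in> conjuncts s \<and> \<not> holds A b c | _ \<Rightarrow> e)" for e
  have f: "f (Exists (Fwd P) s) \<in> conjuncts s \<and> \<not> holds A b (f (Exists (Fwd P) s))" if "Exists (Fwd P) s \<in> C" for s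
    unfolding f_def query.case by (rule someI_ex) (rule ex[OF that])
  define C0 where "C0 = {e \<in> C. \<exists>s. e = Exists (Fwd P) s}"
  have CS: "C \<subseteq> S" "card C \<le> 2" "finite C" using EL_Fwd.prems(2) I S(3) finite_subset by auto
  have "card (f ` C0) \<le> 2"
    using card_image_le[of C0 f] card_mono[of C C0] CS by (force simp: C0_def)
  moreover have "f ` C0 \<subseteq> S" using f S(1) CS(1) by (fastforce simp: C0_def)
  ultimately have D: "f ` C0 \<in> I" using I by blast
  have "edge P C (f ` C0)"
    unfolding edge_def
  proof (intro conjI allI impI)
    fix s assume "Exists (Fwd P) s \<in> C"
    then show "conjuncts s \<inter> f ` C0 \<noteq> {}" using f[of s] by (auto simp: C0_def)
  next
    fix s assume "Exists (Inv P) s \<in> f ` C0"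
    then show "conjuncts s \<inter> C \<noteq> {}" using S(2) \<open>f ` C0 \<subseteq> S\<close> by blast
  qed
  then have "BFact P (h C) (h (f ` C0)) \<in> avoider \<Sigma> I h"
    using D EL_Fwd.prems(2) EL_Fwd.hyps(1) unfolding avoider_def by blast
  moreover have "holds (avoider \<Sigma> I h) (h (f ` C0)) r"
    by (rule EL_Fwd.IH[OF b(2) D]) (use f in \<open>auto simp: C0_def\<close>)
  ultimately show ?case unfolding holds_Fwd by blast
qed auto

lemma avoider_data:
  fixes \<Sigma> :: "('u, 'b) signature"
  assumes "relational_signature \<Sigma>" "finite I"
  shows "data_instance \<Sigma> (avoider \<Sigma> I h)"
    "card (avoider \<Sigma> I h) \<le> (card (unary \<Sigma>) + card (binary \<Sigma>)) * card I ^ 2"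
proof -
  let ?U = "(\<lambda>(A, C). UFact A (h C)) ` (unary \<Sigma> \<times> I) :: ('u, 'b) data"
  let ?B = "(\<lambda>(P, C, C'). BFact P (h C) (h C')) ` (binary \<Sigma> \<times> I \<times> I) :: ('u, 'b) data"
  have sub: "avoider \<Sigma> I h \<subseteq> ?U \<union> ?B"
  proof
    fix \<alpha> assume "\<alpha> \<in> avoider \<Sigma> I h"
    then consider A C where "\<alpha> = UFact A (h C)" "A \<in> unary \<Sigma>" "C \<in> I"
      | P C C' where "\<alpha> = BFact P (h C) (h C')" "P \<in> binary \<Sigma>" "C \<in> I" "C' \<in> I"
      unfolding avoider_def by blast
    then show "\<alpha> \<in> ?U \<union> ?B"
    proof cases
      case (1 A C) then show ?thesis by (intro UnI1 image_eqI[of _ _ "(A, C)"]) simp_all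
    next
      case (2 P C C') then show ?thesis by (intro UnI2 image_eqI[of _ _ "(P, C, C')"]) simp_all
    qed
  qed
  have fin: "finite (unary \<Sigma>)" "finite (binary \<Sigma>)" using assms by (auto simp: relational_signature_def)
  have f: "finite (?U \<union> ?B)" using fin assms(2) by auto
  show "data_instance \<Sigma> (avoider \<Sigma> I h)"
    using finite_subset[OF sub f] by (auto simp: data_instance_def avoider_def)
  have "card (avoider \<Sigma> I h) \<le> card ?U + card ?B"
    using card_mono[OF f sub] card_Un_le[of ?U ?B] by linarith
  also have "\<dots> \<le> card (unary \<Sigma>) * card I + card (binary \<Sigma>) * (card I * card I)"
    using card_image_le[of "unary \<Sigma> \<times> I" "\<lambda>(A, C). UFact A (h C) :: ('u, 'b) assertion"]
      card_image_le[of "binary \<Sigma> \<times> I \<times> I" "\<lambda>(P, C, C'). BFact P (h C) (h C') :: ('u, 'b) assertion"] fin assms(2)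
    by (simp add: card_cartesian_product)
  also have "\<dots> \<le> card (unary \<Sigma>) * (card I * card I) + card (binary \<Sigma>) * (card I * card I)"
    by (simp add: mult_le_mono2 le_square)
  finally show "card (avoider \<Sigma> I h) \<le> (card (unary \<Sigma>) + card (binary \<Sigma>)) * card I ^ 2"
    by (simp add: power2_eq_square add_mult_distrib)
qed

text \<open>Letters are pointed at 0, so the distinguished element receives that name.\<close>

definition pointing :: "'c set \<Rightarrow> 'c \<Rightarrow> 'c \<Rightarrow> nat" where
  "pointing I c = (SOME h. inj_on h I \<and> h c = 0)"

lemma pointing:
  assumes "finite I" "c \<in> I"
  shows "inj_on (pointing I c) I" "pointing I c c = 0"
proof -
  obtain g :: "'a \<Rightarrow> nat" where g: "inj_on g I" using finite_imp_inj_to_nat_seg assms(1) by blast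
  have "inj_on (\<lambda>x. if x = c then 0 else Suc (g x)) I" using g by (auto simp: inj_on_def)
  then have "\<exists>h :: 'a \<Rightarrow> nat. inj_on h I \<and> h c = 0" by (intro exI[of _ "\<lambda>x. if x = c then 0 else Suc (g x)"]) simp
  from someI_ex[OF this] show "inj_on (pointing I c) I" "pointing I c c = 0" unfolding pointing_def by blast+
qed

definition avoiders where
  "avoiders \<Sigma> I x y = (\<lambda>C. avoider \<Sigma> I (pointing I C)) ` {C \<in> I. conjuncts x \<inter> C \<noteq> {} \<and> conjuncts y \<inter> C \<noteq> {}}"

lemma avoiders_avoid:
  assumes "finite I" "A \<in> avoiders \<Sigma> I x y" "x \<in> insert Bot (ELI \<Sigma>)" "y \<in> insert Bot (ELI \<Sigma>)"
  shows "\<not> holds A 0 x \<and> \<not> holds A 0 y"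
proof -
  from assms(2) obtain C where C: "C \<in> I" "conjuncts x \<inter> C \<noteq> {}" "conjuncts y \<inter> C \<noteq> {}"
    "A = avoider \<Sigma> I (pointing I C)" by (auto simp: avoiders_def)
  show ?thesis
    using avoider_sound[OF pointing(1)[OF assms(1) C(1)] _ C(1)] pointing(2)[OF assms(1) C(1)] C assms(3,4) by metis
qed

lemma avoiders_card: "finite I \<Longrightarrow> finite (avoiders \<Sigma> I x y) \<and> card (avoiders \<Sigma> I x y) \<le> card I"
proof
  let ?J = "{C \<in> I. conjuncts x \<inter> C \<noteq> {} \<and> conjuncts y \<inter> C \<noteq> {}}"
  assume I: "finite I"
  then have J: "finite ?J" "card ?J \<le> card I" by (auto intro: card_mono)
  show "finite (avoiders \<Sigma> I x y)" unfolding avoiders_def using J(1) by blast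
  show "card (avoiders \<Sigma> I x y) \<le> card I"
    unfolding avoiders_def using card_image_le[OF J(1)] J(2) le_trans by blast
qed

definition pool where "pool x y = subqueries x \<union> subqueries y"

text \<open>One failing conjunct of \<open>x\<close> and one of \<open>y\<close> are enough to start
  from.\<close>

definition small where "small x y = {C. C \<subseteq> pool x y \<and> card C \<le> 2}"

lemma pool_finite: "finite (pool x y)" by (simp add: pool_def subqueries_finite)

lemma pool_card: "card (pool x y) \<le> qsize x + qsize y"
  using card_Un_le[of "subqueries x" "subqueries y"] subqueries_card[of x] subqueries_card[of y]
  unfolding pool_def by linarith

lemma pool_conjuncts: "conjuncts x \<subseteq> pool x y" "conjuncts y \<subseteq> pool x y"
  using conjuncts_subqueries unfolding pool_def by blast+

lemma subqueries_ELI: "x \<in> insert Bot (ELI \<Sigma>) \<Longrightarrow> Exists R s \<in> subqueries x \<Longrightarrow> s \<in> ELI \<Sigma>"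
proof -
  have "Exists R s \<in> subqueries x \<Longrightarrow> s \<in> ELI \<Sigma>" if "x \<in> ELI \<Sigma>"
    using that by (induction rule: ELI.induct) auto
  then show "x \<in> insert Bot (ELI \<Sigma>) \<Longrightarrow> Exists R s \<in> subqueries x \<Longrightarrow> s \<in> ELI \<Sigma>" by auto
qed

lemma subqueries_EL: "x \<in> insert Bot (EL \<Sigma>) \<Longrightarrow> Exists R s \<in> subqueries x \<Longrightarrow> s \<in> EL \<Sigma> \<and> (\<exists>P. R = Fwd P)"
proof -
  have "Exists R s \<in> subqueries x \<Longrightarrow> s \<in> EL \<Sigma> \<and> (\<exists>P. R = Fwd P)" if "x \<in> EL \<Sigma>"
    using that by (induction rule: EL.induct) auto
  then show "x \<in> insert Bot (EL \<Sigma>) \<Longrightarrow> Exists R s \<in> subqueries x \<Longrightarrow> s \<in> EL \<Sigma> \<and> (\<exists>P. R = Fwd P)" by auto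
qed

lemma avoiders_complete_ELI:
  assumes x: "x \<in> insert Bot (ELI \<Sigma>)" and y: "y \<in> insert Bot (ELI \<Sigma>)" and z: "z \<in> ELI \<Sigma>"
    and n: "\<not> holds (inst z) 0 x" "\<not> holds (inst z) 0 y"
  shows "\<exists>A\<in>avoiders \<Sigma> (Pow (pool x y)) x y. holds A 0 z"
proof -
  let ?S = "pool x y" and ?C = "{c \<in> pool x y. \<not> holds (inst z) 0 c}"
  let ?h = "pointing (Pow ?S) ?C"
  have S: "s \<in> ELI \<Sigma> \<and> conjuncts s \<subseteq> ?S" if "Exists R s \<in> ?S" for R s
    using that x y subqueries_ELI subqueries_closed unfolding pool_def by blast
  have "holds (avoider \<Sigma> (Pow ?S) ?h) (?h ?C) z"
    by (rule avoider_complete_ELI[OF S refl z inst_holds[OF z]])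
  moreover have "?h ?C = 0" by (rule pointing) (auto simp: pool_finite)
  moreover have "conjuncts x \<inter> ?C \<noteq> {}" using n(1) holds_conjuncts[OF x] pool_conjuncts(1)[of x y] by blast
  moreover have "conjuncts y \<inter> ?C \<noteq> {}" using n(2) holds_conjuncts[OF y] pool_conjuncts(2)[of y x] by blast
  moreover have "?C \<in> Pow ?S" by blast
  ultimately show ?thesis unfolding avoiders_def
    by (intro bexI[of _ "avoider \<Sigma> (Pow ?S) ?h"] imageI CollectI conjI) (simp_all only: not_False_eq_True)
qed

lemma small_finite: "finite (small x y)"
  by (rule finite_subset[of _ "Pow (pool x y)"]) (auto simp: small_def pool_finite)

lemma avoiders_complete_EL:
  assumes x: "x \<in> insert Bot (EL \<Sigma>)" and y: "y \<in> insert Bot (EL \<Sigma>)" and z: "z \<in> EL \<Sigma>"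
    and n: "\<not> holds (inst z) 0 x" "\<not> holds (inst z) 0 y"
  shows "\<exists>A\<in>avoiders \<Sigma> (small x y) x y. holds A 0 z"
proof -
  let ?S = "pool x y"
  have x': "x \<in> insert Bot (ELI \<Sigma>)" and y': "y \<in> insert Bot (ELI \<Sigma>)" using x y EL_ELI by auto
  obtain c where c: "c \<in> conjuncts x" "\<not> holds (inst z) 0 c" using n(1) holds_conjuncts[OF x'] by blast
  obtain d where d: "d \<in> conjuncts y" "\<not> holds (inst z) 0 d" using n(2) holds_conjuncts[OF y'] by blast
  have C: "{c, d} \<in> small x y"
    using c d pool_conjuncts[of x y] pool_conjuncts[of y x] by (auto simp: small_def card_insert_if)
  let ?h = "pointing (small x y) {c, d}"
  have S: "s \<in> EL \<Sigma> \<and> conjuncts s \<subseteq> ?S" if "Exists R s \<in> ?S" for R s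
    using that x y subqueries_EL subqueries_closed unfolding pool_def by blast
  have S2: "Exists (Inv P) s \<notin> ?S" for P s
    using x y subqueries_EL unfolding pool_def by blast
  have "holds (avoider \<Sigma> (small x y) ?h) (?h {c, d}) z"
    by (rule avoider_complete_EL[OF S S2 pool_finite _ z inst_holds[OF EL_ELI[OF z]] C])
      (use c d in \<open>auto simp: small_def\<close>)
  moreover have "?h {c, d} = 0" by (rule pointing[OF small_finite C])
  ultimately show ?thesis unfolding avoiders_def using C c d by (auto intro!: bexI[of _ "{c, d}"])
qed

lemma small_card: "card (small x y) \<le> (card (pool x y) + 1) ^ 2"
proof -
  let ?S = "pool x y"
  let ?F = "\<lambda>(a, b). (case a of None \<Rightarrow> {} | Some c \<Rightarrow> {c}) \<union> (case b of None \<Rightarrow> {} | Some c \<Rightarrow> {c})"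
  let ?O = "insert None (Some ` ?S)"
  have "small x y \<subseteq> ?F ` (?O \<times> ?O)"
  proof
    fix C assume C: "C \<in> small x y"
    then have CS: "C \<subseteq> ?S" "card C \<le> 2" by (auto simp: small_def)
    then have "finite C" using pool_finite finite_subset by blast
    then have "card C = 0 \<Longrightarrow> C = {}" by simp
    moreover have "card C = 0 \<or> card C = 1 \<or> card C = 2" using CS(2) by linarith
    ultimately consider "C = {}" | c where "C = {c}" | c d where "C = {c, d}"
      by (metis card_1_singletonE card_2_iff)
    then show "C \<in> ?F ` (?O \<times> ?O)"
    proof cases
      case 1 then show ?thesis by (intro image_eqI[of _ _ "(None, None)"]) auto
    next
      case (2 c) then show ?thesis using CS(1) by (intro image_eqI[of _ _ "(Some c, None)"]) auto
    next
      case (3 c d) then show ?thesis using CS(1) by (intro image_eqI[of _ _ "(Some c, Some d)"]) auto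
    qed
  qed
  moreover have fO: "finite (?O \<times> ?O)" using pool_finite by auto
  ultimately have "card (small x y) \<le> card (?O \<times> ?O)"
    using card_mono[of "?F ` (?O \<times> ?O)"] card_image_le[OF fO, of ?F] by (meson finite_imageI le_trans)
  also have "card ?O = card ?S + 1" using pool_finite[of x y] by (subst card_insert_disjoint) (auto simp: card_image)
  then have "card (?O \<times> ?O) = (card ?S + 1) ^ 2" by (simp only: card_cartesian_product power2_eq_square)
  finally show ?thesis .
qed

subsection \<open>Upper bounds\<close>

definition lq :: "(('u, 'b) query \<times> ('u, 'b) query) list \<Rightarrow> nat \<Rightarrow> ('u, 'b) query" where
  "lq ps i = fst (ps ! (i - 1))"

definition rq :: "('u, 'b) query \<Rightarrow> (('u, 'b) query \<times> ('u, 'b) query) list \<Rightarrow> nat \<Rightarrow> ('u, 'b) query" where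
  "rq r ps i = (r # map snd ps) ! i"

text \<open>A trivial \<open>s\<close> makes \<open>l U s\<close> true everywhere: time continues
  beyond the listed instances, and the next point is a witness with an empty gap.\<close>

lemma sat_snoc_trivial:
  assumes "s \<in> ELI \<Sigma>" "holds {} 0 s"
  shows "sat D a p (path_query r (ps @ [(l, s)])) \<longleftrightarrow> sat D a p (path_query r ps)"
proof (induction ps arbitrary: r p)
  case Nil
  have "sat D a m s" for m using sat_slice[of s \<Sigma> D a m] holds_empty[OF assms] assms(1) by blast
  then show ?case by (auto intro!: exI[of _ "Suc p"])
next
  case (Cons lr ps)
  obtain l' r' where "lr = (l', r')" by (cases lr)
  then show ?case using Cons.IH by simp
qed

lemma qsize_snoc: "qsize (path_query r ps) \<le> qsize (path_query r (ps @ [(l, s)]))"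
proof (induction ps arbitrary: r)
  case (Cons lr ps)
  obtain l' r' where "lr = (l', r')" by (cases lr)
  then show ?case using Cons.IH by simp
qed simp

text \<open>Afterwards the last conjunct fails on the empty instance, which confines every embedding
  to the listed part of a word.\<close>

lemma trim:
  assumes "\<And>l s. (l, s) \<in> set ps \<Longrightarrow> s \<in> ELI \<Sigma>"
  shows "\<exists>ps'. set ps' \<subseteq> set ps \<and> (ps' = [] \<or> \<not> holds {} 0 (snd (last ps'))) \<and>
    (\<forall>D a p. sat D a p (path_query r ps') \<longleftrightarrow> sat D a p (path_query r ps)) \<and>
    qsize (path_query r ps') \<le> qsize (path_query r ps)"
  using assms
proof (induction ps rule: rev_induct)
  case (snoc p ps)
  obtain l s where p: "p = (l, s)" by (cases p)
  show ?case
  proof (cases "holds {} 0 s")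
    case True
    obtain ps' where ps': "set ps' \<subseteq> set ps" "ps' = [] \<or> \<not> holds {} 0 (snd (last ps'))"
      "\<And>D a p. sat D a p (path_query r ps') \<longleftrightarrow> sat D a p (path_query r ps)"
      "qsize (path_query r ps') \<le> qsize (path_query r ps)"
      using snoc.IH snoc.prems by (metis Un_iff set_append)
    have s: "s \<in> ELI \<Sigma>" using snoc.prems p by auto
    show ?thesis
      using ps' sat_snoc_trivial[OF s True] qsize_snoc[of r ps l s] unfolding p by (intro exI[of _ ps']) auto
  next
    case False
    then show ?thesis by (intro exI[of _ "ps @ [p]"]) (simp add: p)
  qed
qed auto

lemma qsize_parts:
  "length ps \<le> qsize (path_query r ps)" "qsize r \<le> qsize (path_query r ps)"
proof (induction ps arbitrary: r)
  case (Cons lr ps)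
  obtain l' r' where lr: "lr = (l', r')" by (cases lr)
  { case 1 then show ?case using Cons.IH(1)[of r'] lr by simp }
  { case 2 then show ?case using lr by simp }
qed auto

lemma qsize_components:
  "(l, s) \<in> set ps \<Longrightarrow> qsize l \<le> qsize (path_query r ps) \<and> qsize s \<le> qsize (path_query r ps)"
proof (induction ps arbitrary: r)
  case (Cons lr ps)
  obtain l' r' where lr: "lr = (l', r')" by (cases lr)
  show ?case
  proof (cases "(l, s) = lr")
    case True
    then show ?thesis using lr qsize_parts(2)[of s ps] by simp
  next
    case False
    then have "qsize l \<le> qsize (path_query r' ps) \<and> qsize s \<le> qsize (path_query r' ps)"
      using Cons by simp
    then show ?thesis using lr by simp
  qed
qed simp

section \<open>Example sets, uniformly for both languages\<close>

locale description =
  fixes \<Sigma> :: "('u, 'b) signature" and L :: "('u, 'b) query set"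
    and I :: "('u, 'b) query \<Rightarrow> ('u, 'b) query \<Rightarrow> ('u, 'b) query set set" and \<iota> :: "nat \<Rightarrow> nat"
  assumes sig: "relational_signature \<Sigma>"
    and L: "L \<subseteq> ELI \<Sigma>"
    and I_fin: "finite (I x y)"
    and I_card: "qsize x \<le> s \<Longrightarrow> qsize y \<le> s \<Longrightarrow> card (I x y) \<le> \<iota> s"
    and I_complete: "x \<in> insert Bot L \<Longrightarrow> y \<in> insert Bot L \<Longrightarrow> z \<in> L \<Longrightarrow>
      \<not> holds (inst z) 0 x \<Longrightarrow> \<not> holds (inst z) 0 y \<Longrightarrow> \<exists>A\<in>avoiders \<Sigma> (I x y) x y. holds A 0 z"
begin

definition truth :: "('u, 'b) data \<times> nat \<Rightarrow> ('u, 'b) query \<Rightarrow> bool" where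
  "truth = (\<lambda>(A, a) x. holds A a x)"

definition avoid where "avoid x y = (\<lambda>A. (A, 0::nat)) ` avoiders \<Sigma> (I x y) x y"

lemma L': "x \<in> insert Bot L \<Longrightarrow> x \<in> insert Bot (ELI \<Sigma>)" "x \<in> L \<Longrightarrow> x \<in> ELI \<Sigma>" using L by auto

sublocale letters truth L Bot "\<lambda>x. (inst x, 0)" "({}, 0)" "(everything \<Sigma>, 0)" avoid
proof
  fix x y z A a
  show "x \<in> L \<Longrightarrow> y \<in> insert Bot L \<Longrightarrow> truth (inst x, 0) y = (\<forall>a. truth a x \<longrightarrow> truth a y)"
    using inst_char[of x \<Sigma> y] L' by (simp add: truth_def)
  show "\<not> truth a Bot" by (simp add: truth_def split_beta)
  show "x \<in> L \<Longrightarrow> truth ({}, 0) x \<Longrightarrow> truth a x"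
    using holds_empty[of x \<Sigma>] L' by (simp add: truth_def split_beta)
  show "x \<in> L \<Longrightarrow> truth (everything \<Sigma>, 0) x" using everything_holds[of x \<Sigma>] L'(2)[of x] by (simp add: truth_def)
  show "A \<in> avoid x y \<Longrightarrow> x \<in> insert Bot L \<Longrightarrow> y \<in> insert Bot L \<Longrightarrow> \<not> truth A x \<and> \<not> truth A y"
    using avoiders_avoid[OF I_fin] L' by (auto simp: avoid_def truth_def)
  assume x: "x \<in> insert Bot L" "y \<in> insert Bot L" "z \<in> L"
    and n: "\<not> (\<forall>a. truth a z \<longrightarrow> truth a x)" "\<not> (\<forall>a. truth a z \<longrightarrow> truth a y)"
  have "\<not> holds (inst z) 0 x" "\<not> holds (inst z) 0 y"
    using n inst_char[of z \<Sigma> x] inst_char[of z \<Sigma> y] L' x by (auto simp: truth_def)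
  then show "\<exists>A\<in>avoid x y. truth A z" using I_complete[OF x] by (auto simp: avoid_def truth_def)
qed

lemma entails_ent: "x \<in> insert Bot L \<Longrightarrow> y \<in> insert Bot L \<Longrightarrow> entails \<Sigma> x y \<longleftrightarrow> ent x y"
  unfolding ent_def using entails_iff[of x \<Sigma> y] L' by (simp add: truth_def)

abbreviation word where "word D a \<equiv> (\<lambda>p. (slice D p, a))"

lemma sat_truth: "x \<in> insert Bot L \<Longrightarrow> sat D a p x \<longleftrightarrow> truth (slice D p, a) x"
  using sat_slice[of x \<Sigma> D a p] L' by (simp add: truth_def)

definition wf where "wf r ps \<longleftrightarrow> r \<in> L \<and> (\<forall>(l, s)\<in>set ps. (l \<in> L \<or> l = Bot) \<and> s \<in> L)"

lemma wf_trim: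
  assumes "wf r ps"
  shows "\<exists>ps'. wf r ps' \<and> set ps' \<subseteq> set ps \<and> (ps' = [] \<or> \<not> holds {} 0 (snd (last ps'))) \<and>
    (\<forall>D a p. sat D a p (path_query r ps') \<longleftrightarrow> sat D a p (path_query r ps)) \<and>
    qsize (path_query r ps') \<le> qsize (path_query r ps)"
proof -
  have "s \<in> ELI \<Sigma>" if "(l, s) \<in> set ps" for l s using assms that L by (auto simp: wf_def)
  then obtain ps' where "set ps' \<subseteq> set ps" "ps' = [] \<or> \<not> holds {} 0 (snd (last ps'))"
    "\<forall>D a p. sat D a p (path_query r ps') \<longleftrightarrow> sat D a p (path_query r ps)"
    "qsize (path_query r ps') \<le> qsize (path_query r ps)"
    using trim[of ps \<Sigma> r] by blast
  moreover have "wf r ps'" using assms calculation(1) by (auto simp: wf_def)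
  ultimately show ?thesis by blast
qed

lemma wf_r: "wf r ps \<Longrightarrow> i \<le> length ps \<Longrightarrow> rq r ps i \<in> L"
  by (cases i) (auto simp: wf_def rq_def split_beta)

lemma wf_l: "wf r ps \<Longrightarrow> 1 \<le> i \<Longrightarrow> i \<le> length ps \<Longrightarrow> lq ps i \<in> insert Bot L"
  using nth_mem[of "i - 1" ps] by (auto simp: wf_def lq_def split_beta)

lemma sat_path:
  assumes wf: "wf r ps"
  shows "sat D a p (path_query r ps) \<longleftrightarrow> psat (word D a) (rq r ps) (lq ps) (length ps) 0 p"
proof -
  let ?n = "length ps"
  have "sat D a p (path_query (rq r ps i) (drop i ps)) \<longleftrightarrow> psat (word D a) (rq r ps) (lq ps) ?n i p"
    if "i \<le> ?n" for i p
    using that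
  proof (induction i arbitrary: p rule: inc_induct)
    case base
    show ?case using sat_truth[of "rq r ps ?n"] wf_r[OF wf] by (simp add: psat_last)
  next
    case (step i)
    have d: "drop i ps = (lq ps (Suc i), rq r ps (Suc i)) # drop (Suc i) ps"
      using step(2) by (simp add: Cons_nth_drop_Suc[symmetric] lq_def rq_def)
    show ?case
      unfolding d psat_step[OF step(2)] using step.IH sat_truth[of "rq r ps i"] sat_truth[of "lq ps (Suc i)"]
        wf_r[OF wf, of i] wf_l[OF wf, of "Suc i"] step(2) by auto
  qed
  from this[of 0 p] show ?thesis by (simp add: rq_def)
qed

definition rank where "rank = card (unary \<Sigma>) + card (binary \<Sigma>)"

text \<open>The factors bound the number of words, their length, and the facts in one letter. The
  last adds up the bounds for \<open>inst\<close>, \<open>everything\<close> and the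
  avoiders.\<close>

definition bound where
  "bound s = (s + 2 + (4 * s + 1) * \<iota> s) * (s * (s + 3) + 2) * (s + rank + rank * \<iota> s ^ 2)"

lemma everything_data: "data_instance \<Sigma> (everything \<Sigma>)" "card (everything \<Sigma>) \<le> rank"
proof -
  have f: "finite (unary \<Sigma>)" "finite (binary \<Sigma>)" using sig by (auto simp: relational_signature_def)
  then show "data_instance \<Sigma> (everything \<Sigma>)" by (auto simp: data_instance_def everything_def)
  have "card (everything \<Sigma>) \<le> card ((\<lambda>A. UFact A 0 :: ('u, 'b) assertion) ` unary \<Sigma>) + card ((\<lambda>P. BFact P 0 0 :: ('u, 'b) assertion) ` binary \<Sigma>)"
    unfolding everything_def by (rule card_Un_le)
  also have "\<dots> \<le> rank" unfolding rank_def by (intro add_mono card_image_le f)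
  finally show "card (everything \<Sigma>) \<le> rank" .
qed

lemma everything_ind: "0 \<in> ind (everything \<Sigma>)"
  using sig by (force simp: relational_signature_def everything_def ind_def)

definition small_letter where
  "small_letter s A \<longleftrightarrow> data_instance \<Sigma> (fst A) \<and> card (fst A) \<le> s + rank + rank * \<iota> s ^ 2 \<and> snd A = (0::nat)"

lemma small_letters:
  "small_letter s ({}, 0)" "small_letter s (everything \<Sigma>, 0)"
  "x \<in> L \<Longrightarrow> qsize x \<le> s \<Longrightarrow> small_letter s (inst x, 0)"
  "qsize x \<le> s \<Longrightarrow> qsize y \<le> s \<Longrightarrow> A \<in> avoid x y \<Longrightarrow> small_letter s A"
proof -
  show "small_letter s ({}, 0)" by (simp add: small_letter_def data_instance_def)
  show "small_letter s (everything \<Sigma>, 0)" using everything_data by (simp add: small_letter_def)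
  show "x \<in> L \<Longrightarrow> qsize x \<le> s \<Longrightarrow> small_letter s (inst x, 0)"
    using inst_card[of x] inst_data[of x \<Sigma>] L' by (simp add: small_letter_def)
  assume x: "qsize x \<le> s" "qsize y \<le> s" and "A \<in> avoid x y"
  then obtain h where A: "A = (avoider \<Sigma> (I x y) h, 0)" by (auto simp: avoid_def avoiders_def)
  note d = avoider_data[OF sig I_fin, of x y h]
  have "rank * card (I x y) ^ 2 \<le> rank * \<iota> s ^ 2" using I_card[OF x] by (intro mult_le_mono2 power_mono) auto
  then have "card (avoider \<Sigma> (I x y) h) \<le> rank * \<iota> s ^ 2" using d(2) unfolding rank_def by linarith
  then show "small_letter s A" using d(1) A by (simp add: small_letter_def)
qed

lemma avoid_card: "qsize x \<le> s \<Longrightarrow> qsize y \<le> s \<Longrightarrow> finite (avoid x y) \<and> card (avoid x y) \<le> \<iota> s"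
proof -
  assume x: "qsize x \<le> s" "qsize y \<le> s"
  have a: "finite (avoiders \<Sigma> (I x y) x y)" "card (avoiders \<Sigma> (I x y) x y) \<le> card (I x y)"
    using avoiders_card[OF I_fin] by auto
  then show ?thesis unfolding avoid_def
    using card_image_le[OF a(1), of "\<lambda>A. (A, 0::nat)"] I_card[OF x] by (auto intro: le_trans)
qed

definition example where
  "example k w = (map (\<lambda>p. fst (w p)) [0..<k], 0::nat)" for w :: "nat \<Rightarrow> ('u, 'b) data \<times> nat"

lemma example_word:
  assumes "\<And>p. snd (w p) = 0" "\<And>p. k \<le> p \<Longrightarrow> w p = ({}, 0)"
  shows "word (fst (example k w)) 0 = w"
proof
  fix p show "(slice (fst (example k w)) p, 0) = w p"
    using assms(1)[of p] assms(2)[of p] by (cases "p < k") (auto simp: slice_def example_def prod_eq_iff)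
qed

lemma example_tsize:
  assumes "\<And>p. small_letter s (w p)"
  shows "tsize (fst (example k w)) \<le> k * (s + rank + rank * \<iota> s ^ 2)"
proof -
  have "tsize (fst (example k w)) = (\<Sum>p<k. card (fst (w p)))"
    by (simp add: tsize_def example_def interv_sum_list_conv_sum_set_nat o_def atLeast0LessThan)
  also have "\<dots> \<le> (\<Sum>p<k. s + rank + rank * \<iota> s ^ 2)"
    by (rule sum_mono) (use assms in \<open>simp add: small_letter_def\<close>)
  finally show ?thesis by simp
qed

lemma example_pointed:
  assumes "\<And>p. small_letter s (w p)" "p < k" "0 \<in> ind (fst (w p))"
  shows "pointed_instance \<Sigma> (example k w)"
proof -
  have "0 \<in> tind (fst (example k w))" unfolding tind_def example_def using assms(2,3) by (auto intro!: bexI[of _ p])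
  then show ?thesis using assms(1,2)
    by (auto simp: pointed_instance_def example_def temporal_instance_def small_letter_def)
qed

lemma esize_bound:
  assumes "finite P" "finite Q" "\<And>w. w \<in> P \<union> Q \<Longrightarrow> tsize (fst (example k w)) \<le> T"
  shows "esize (example k ` P, example k ` Q) \<le> (card P + card Q) * T"
proof -
  have 1: "(\<Sum>(D, a)\<in>example k ` X. tsize D) \<le> card X * T" if X: "finite X" "X \<subseteq> P \<union> Q" for X
  proof -
    have "(\<Sum>(D, a)\<in>example k ` X. tsize D) \<le> of_nat (card (example k ` X)) * T"
      by (rule sum_bounded_above) (use assms(3) X(2) in \<open>auto simp: split_beta\<close>)
    also have "\<dots> \<le> card X * T" using card_image_le[OF X(1), of "example k"] by (simp add: mult_le_mono1)
    finally show ?thesis .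
  qed
  show ?thesis using 1[OF assms(1)] 1[OF assms(2)] by (simp add: esize_def add_mult_distrib)
qed

lemma characterise_long:
  assumes wf: "wf r ps" and ne: "ps \<noteq> []" and lst: "\<not> holds {} 0 (snd (last ps))"
    and peer: "\<And>l s. (l, s) \<in> set ps \<Longrightarrow> l = Bot \<or> (\<not> ent l s \<and> \<not> ent s l)"
    and s: "qsize (path_query r ps) \<le> s"
  shows "\<exists>E. example_set \<Sigma> E \<and> uniquely_characterises \<Sigma> E (path_query r ps) (path_queries L) \<and> esize E \<le> bound s"
proof -
  define n where "n = length ps"
  let ?r = "rq r ps" and ?l = "lq ps"
  have lastq: "?r n = snd (last ps)" using ne by (simp add: rq_def n_def last_conv_nth nth_Cons' )
  have mem: "(?l i, ?r i) \<in> set ps" if "1 \<le> i" "i \<le> n" for i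
    using that nth_mem[of "i-1" ps] by (simp add: lq_def rq_def n_def nth_Cons')
  interpret P: peerless_seq truth L Bot "\<lambda>x. (inst x, 0)" "({}, 0)" "(everything \<Sigma>, 0)" avoid n ?r ?l
  proof
    fix i
    show "1 \<le> n" using ne by (simp add: n_def Suc_leI)
    show "i \<le> n \<Longrightarrow> ?r i \<in> L" using wf_r[OF wf] by (simp add: n_def)
    show "\<not> truth ({}, 0) (?r n)" using lst lastq by (simp add: truth_def)
    assume i: "1 \<le> i" "i \<le> n"
    show li: "?l i \<in> insert Bot L" using wf_l[OF wf] i by (simp add: n_def)
    have ri: "?r i \<in> L" using wf_r[OF wf] i by (simp add: n_def)
    show "\<not> ent (?r i) (?l i)" using peer[OF mem[OF i]] not_ent_bot[OF ri] by auto
    show "?l i \<noteq> Bot \<Longrightarrow> \<not> ent (?l i) (?r i)" using peer[OF mem[OF i]] by auto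
  qed
  have ns: "n \<le> s" using qsize_parts(1)[of ps r] s by (simp add: n_def)
  have comp: "qsize x \<le> s" if "x \<in> ?r ` {..n} \<union> ?l ` {1..n}" for x
  proof -
    have "qsize (?r i) \<le> s" if "i \<le> n" for i
      using qsize_parts(2)[of r ps] qsize_components[of "?l i" "?r i" ps r] mem[of i] s that
      by (cases "i = 0") (auto simp: rq_def)
    moreover have "qsize (?l i) \<le> s" if "1 \<le> i" "i \<le> n" for i
      using qsize_components[of "?l i" "?r i" ps r] mem[of i] s that by auto
    ultimately show ?thesis using that by auto
  qed
  let ?k = "P.word_len"
  have sl: "small_letter s (w p)" if w: "w \<in> P.Pos \<union> P.Neg" for w p
  proof -
    from P.word_letters[OF w, of p] consider "w p = ({}, 0)" | "w p = (everything \<Sigma>, 0)"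
      | x where "x \<in> L" "x \<in> ?r ` {..n} \<union> ?l ` {1..n}" "w p = (inst x, 0)"
      | i where "i \<le> n" "w p \<in> avoid (?r i) (?r i)"
      | i where "1 \<le> i" "i \<le> n" "w p \<in> avoid (?l i) (?r i)"
      | i where "1 \<le> i" "i \<le> n" "w p \<in> avoid (?l i) (?l i)"
      by auto
    then show ?thesis
    proof cases
      case 1 then show ?thesis using small_letters(1) by simp
    next
      case 2 then show ?thesis using small_letters(2) by simp
    next
      case (3 x) then show ?thesis using small_letters(3)[OF 3(1) comp] by simp
    next
      case (4 i) show ?thesis by (rule small_letters(4)[OF comp comp 4(2)]) (use 4 in auto)
    next
      case (5 i) show ?thesis by (rule small_letters(4)[OF comp comp 5(3)]) (use 5 in auto)
    next
      case (6 i) show ?thesis by (rule small_letters(4)[OF comp comp 6(3)]) (use 6 in auto)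
    qed
  qed
  have ew: "word (fst (example ?k w)) 0 = w" if w: "w \<in> P.Pos \<union> P.Neg" for w
    using sl[OF w] P.support[OF w] by (intro example_word) (auto simp: small_letter_def)
  have pt: "pointed_instance \<Sigma> (example ?k w)" if w: "w \<in> P.Pos \<union> P.Neg" for w
  proof -
    obtain p where p: "truth (w p) (?r n)" using P.word_proper[OF w] by blast
    have pk: "p < ?k"
    proof (rule ccontr)
      assume "\<not> p < ?k"
      then have "w p = ({}, 0)" using P.support[OF w, of p] by simp
      then show False using p P.last by simp
    qed
    have "snd (w p) = 0" using sl[OF w, of p] by (simp add: small_letter_def)
    then have "holds (fst (w p)) 0 (?r n)" using p by (simp add: truth_def split_beta)
    then have "0 \<in> ind (fst (w p))"
      using holds_ind[of "?r n" \<Sigma> "fst (w p)" 0 0] P.last P.r_in[of n] L' by (auto simp: truth_def)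
    then show ?thesis by (intro example_pointed[OF _ pk]) (rule sl[OF w])
  qed
  have Ncard: "finite (avoid x y) \<and> card (avoid x y) \<le> \<iota> s"
    if "x \<in> ?r ` {..n} \<union> ?l ` {1..n}" "y \<in> ?r ` {..n} \<union> ?l ` {1..n}" for x y
    by (rule avoid_card[OF comp[OF that(1)] comp[OF that(2)]])
  have neg: "finite P.Neg" "card P.Neg \<le> 1 + (n + 1) * \<iota> s + n * (2 * \<iota> s) + n * \<iota> s"
    by (rule P.Neg_card; rule Ncard; assumption)+
  let ?E = "(example ?k ` P.Pos, example ?k ` P.Neg)"
  have satE: "sat (fst (example ?k w)) (snd (example ?k w)) 0 (path_query r' ps') \<longleftrightarrow> psat w (rq r' ps') (lq ps') (length ps') 0 0"
    if "w \<in> P.Pos \<union> P.Neg" "wf r' ps'" for w r' ps'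
    using sat_path[OF that(2), of "fst (example ?k w)" 0 0] ew[OF that(1)] by (simp add: example_def)
  have "example_set \<Sigma> ?E" using P.Pos_card(1) neg(1) pt by (auto simp: example_set_def)
  moreover have "uniquely_characterises \<Sigma> ?E (path_query r ps) (path_queries L)"
    unfolding uniquely_characterises_def
  proof (intro conjI ballI impI)
    show "fits (path_query r ps) ?E"
      using satE[OF _ wf] P.Pos_sat P.Neg_unsat by (auto simp: fits_def split_beta n_def)
    fix q' assume q': "q' \<in> path_queries L" "fits q' ?E"
    then obtain r' ps0 where ps0: "q' = path_query r' ps0" "wf r' ps0" by (auto simp: path_queries_def wf_def)
    obtain ps' where wf': "wf r' ps'" and ps': "set ps' \<subseteq> set ps0" "ps' = [] \<or> \<not> holds {} 0 (snd (last ps'))"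
      "\<And>D a p. sat D a p (path_query r' ps') \<longleftrightarrow> sat D a p q'"
      using wf_trim[OF ps0(2)] unfolding ps0(1) by metis
    have "psat w ?r ?l n 0 p \<longleftrightarrow> psat w (rq r' ps') (lq ps') (length ps') 0 p" for w p
    proof (rule P.unique)
      show "i \<le> length ps' \<Longrightarrow> rq r' ps' i \<in> L" for i by (rule wf_r[OF wf'])
      show "1 \<le> i \<Longrightarrow> i \<le> length ps' \<Longrightarrow> lq ps' i \<in> insert Bot L" for i by (rule wf_l[OF wf'])
      show "\<not> truth ({}, 0) (rq r' ps' (length ps'))" if "1 \<le> length ps'"
        using ps'(2) that by (auto simp: truth_def rq_def last_conv_nth nth_Cons')
      show "psat w (rq r' ps') (lq ps') (length ps') 0 0" if "w \<in> P.Pos" for w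
        using q'(2) satE[OF _ wf', of w] ps'(3) that by (auto simp: fits_def split_beta)
      show "\<not> psat w (rq r' ps') (lq ps') (length ps') 0 0" if "w \<in> P.Neg" for w
        using q'(2) satE[OF _ wf', of w] ps'(3) that by (auto simp: fits_def split_beta)
    qed
    then have "sat D a p (path_query r ps) \<longleftrightarrow> sat D a p q'" for D a p
      using sat_path[OF wf] sat_path[OF wf'] ps'(3) by (simp add: n_def)
    then show "equivalent \<Sigma> (path_query r ps) q'" by (simp add: equivalent_def entails_def)
  qed
  moreover have "esize ?E \<le> bound s"
  proof -
    have "esize ?E \<le> (card P.Pos + card P.Neg) * (?k * (s + rank + rank * \<iota> s ^ 2))"
      by (rule esize_bound[OF P.Pos_card(1) neg(1) example_tsize]) (rule sl)
    also have "\<dots> \<le> (s + 2 + (4 * s + 1) * \<iota> s) * ((s * (s + 3) + 2) * (s + rank + rank * \<iota> s ^ 2))"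
    proof (intro mult_le_mono)
      have "card P.Pos + card P.Neg \<le> n + 1 + (1 + (n + 1) * \<iota> s + n * (2 * \<iota> s) + n * \<iota> s)"
        using P.Pos_card(2) neg(2) by linarith
      also have "\<dots> = n + 2 + (4 * n + 1) * \<iota> s" by (simp add: algebra_simps)
      also have "\<dots> \<le> s + 2 + (4 * s + 1) * \<iota> s" using ns by (intro add_mono mult_le_mono) auto
      finally show "card P.Pos + card P.Neg \<le> s + 2 + (4 * s + 1) * \<iota> s" .
      show "?k \<le> s * (s + 3) + 2" unfolding P.word_len_def using ns by (intro add_mono mult_le_mono) auto
    qed auto
    finally show ?thesis unfolding bound_def by (simp only: mult.assoc)
  qed
  ultimately show ?thesis by blast
qed

text \<open>\<open>peerless_seq\<close> requires at least one \<open>U\<close>. Here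
  \<open>Z\<close> excludes every trimmed query with a \<open>U\<close>, because all its later
  instances are empty; the words \<open>W A\<close> then determine the static query at time
  0.\<close>

lemma characterise_short:
  assumes r: "r \<in> L" and s: "qsize r \<le> s"
  shows "\<exists>E. example_set \<Sigma> E \<and> uniquely_characterises \<Sigma> E r (path_queries L) \<and> esize E \<le> bound s"
proof -
  \<comment> \<open>The instance at time 1 ensures that the point 0 occurs, which \<open>A\<close>
    alone need not guarantee.\<close>
  define W where "W A p = (if p = 0 then A else if p = 1 then (everything \<Sigma>, 0) else ({}, 0))"
    for A :: "('u, 'b) data \<times> nat" and p :: nat
  define Z :: "nat \<Rightarrow> ('u, 'b) data \<times> nat" where "Z p = (if p = 0 then (everything \<Sigma>, 0) else ({}, 0))" for p
  let ?P = "{Z, W (inst r, 0)}" and ?N = "W ` avoid r r"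
  let ?E = "(example 2 ` ?P, example 2 ` ?N)"
  have sl: "small_letter s (w p)" if "w \<in> ?P \<union> ?N" for w p
    using that small_letters(1,2) small_letters(3)[OF r s] small_letters(4)[OF s s] by (auto simp: W_def Z_def)
  have ev: "0 \<in> ind (fst (Z 0))" "0 \<in> ind (fst (W A 1))" for A
    using everything_ind by (auto simp: W_def Z_def)
  have pt: "pointed_instance \<Sigma> (example 2 w)" if w: "w \<in> ?P \<union> ?N" for w
    using example_pointed[OF sl[OF w], of 0 2] example_pointed[OF sl[OF w], of 1 2] ev w by auto
  have ew: "word (fst (example 2 w)) 0 = w" if w: "w \<in> ?P \<union> ?N" for w
    by (rule example_word) (use sl[OF w] w in \<open>auto simp: small_letter_def W_def Z_def\<close>)
  have satE: "sat (fst (example 2 w)) (snd (example 2 w)) 0 (path_query r' ps') \<longleftrightarrow> psat w (rq r' ps') (lq ps') (length ps') 0 0"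
    if "w \<in> ?P \<union> ?N" "wf r' ps'" for w r' ps'
    using sat_path[OF that(2), of "fst (example 2 w)" 0 0] ew[OF that(1)] by (simp add: example_def)
  have satE0: "sat (fst (example 2 w)) (snd (example 2 w)) 0 x \<longleftrightarrow> truth (w 0) x" if "w \<in> ?P \<union> ?N" "x \<in> L" for w x
    using satE[of w x "[]"] that by (simp add: wf_def psat_last rq_def)
  have fin: "finite (avoid r r)" "card (avoid r r) \<le> \<iota> s" using avoid_card[OF s s] by auto
  have "example_set \<Sigma> ?E" using pt fin by (auto simp: example_set_def)
  moreover have "uniquely_characterises \<Sigma> ?E r (path_queries L)"
    unfolding uniquely_characterises_def
  proof (intro conjI ballI impI)
    have "truth (Z 0) r" "truth (W (inst r, 0) 0) r" using full[OF r] can_self[OF r] by (auto simp: Z_def W_def)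
    moreover have "\<not> truth (W A 0) r" if "A \<in> avoid r r" for A using N_avoids[OF that] r by (auto simp: W_def)
    ultimately show "fits r ?E" using satE0[OF _ r] by (auto simp: fits_def split_beta)
    fix q' assume q': "q' \<in> path_queries L" "fits q' ?E"
    then obtain r' ps0 where ps0: "q' = path_query r' ps0" "wf r' ps0" by (auto simp: path_queries_def wf_def)
    obtain ps' where wf': "wf r' ps'" and ps': "set ps' \<subseteq> set ps0" "ps' = [] \<or> \<not> holds {} 0 (snd (last ps'))"
      "\<And>D a p. sat D a p (path_query r' ps') \<longleftrightarrow> sat D a p q'"
      using wf_trim[OF ps0(2)] unfolding ps0(1) by metis
    then have r': "r' \<in> L" by (simp add: wf_def)
    have "ps' = []"
    proof (rule ccontr)
      assume ne: "ps' \<noteq> []"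
      have "psat Z (rq r' ps') (lq ps') (length ps') 0 0"
        using q'(2) satE[OF _ wf', of Z] ps'(3) by (auto simp: fits_def split_beta)
      then obtain f where f: "f 0 = 0" "emb Z (rq r' ps') (lq ps') (length ps') 0 f" by (auto simp: psat_def)
      have "length ps' \<le> f (length ps')" using emb_mono[OF f(2), of 0 "length ps'"] f(1) by simp
      then have "Z (f (length ps')) = ({}, 0)" using ne by (auto simp: Z_def)
      then have "truth ({}, 0) (rq r' ps' (length ps'))" using emb_S[OF f(2), of "length ps'"] by simp
      then show False using ps'(2) ne by (auto simp: truth_def rq_def last_conv_nth nth_Cons')
    qed
    then have sq: "sat D a p q' \<longleftrightarrow> sat D a p r'" for D a p using ps'(3)[of D a p] by simp
    have "truth (W (inst r, 0) 0) r'"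
      using q'(2) satE0[OF _ r', of "W (inst r, 0)"] sq by (auto simp: fits_def split_beta)
    then have 1: "ent r r'" using can_ent[OF r] r' by (simp add: W_def)
    have 2: "ent r' r"
    proof (rule ccontr)
      assume "\<not> ent r' r"
      then obtain A where A: "A \<in> avoid r r" "truth A r'" using N_ex[of r r r'] r r' by blast
      then have "truth (W A 0) r'" by (simp add: W_def)
      then show False using q'(2) satE0[OF _ r', of "W A"] sq A(1) by (auto simp: fits_def split_beta)
    qed
    have "sat D a p r \<longleftrightarrow> sat D a p q'" for D a p
      using 1 2 entD sat_truth[of r] sat_truth[of r'] r r' sq by blast
    then show "equivalent \<Sigma> r q'" by (simp add: equivalent_def entails_def)
  qed
  moreover have "esize ?E \<le> bound s"
  proof -
    have "esize ?E \<le> (card ?P + card ?N) * (2 * (s + rank + rank * \<iota> s ^ 2))"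
      by (rule esize_bound[OF _ _ example_tsize]) (use sl fin in auto)
    also have "\<dots> \<le> (s + 2 + (4 * s + 1) * \<iota> s) * ((s * (s + 3) + 2) * (s + rank + rank * \<iota> s ^ 2))"
    proof (intro mult_le_mono)
      have "card ?P \<le> 2" by (simp add: card_insert_if)
      moreover have "card ?N \<le> \<iota> s" using card_image_le[OF fin(1), of W] fin(2) by linarith
      ultimately show "card ?P + card ?N \<le> s + 2 + (4 * s + 1) * \<iota> s" by simp
    qed auto
    finally show ?thesis unfolding bound_def by (simp only: mult.assoc)
  qed
  ultimately show ?thesis by blast
qed

lemma uniquely_characterises_cong:
  "(\<And>D a p. sat D a p q = sat D a p q') \<Longrightarrow> uniquely_characterises \<Sigma> E q Q = uniquely_characterises \<Sigma> E q' Q"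
  by (simp add: uniquely_characterises_def fits_def equivalent_def entails_def)

lemma characterise:
  assumes q: "q \<in> peerless \<Sigma> L"
  shows "\<exists>E. example_set \<Sigma> E \<and> uniquely_characterises \<Sigma> E q (path_queries L) \<and> esize E \<le> bound (qsize q)"
proof -
  from q obtain r ps where ps: "q = path_query r ps" "wf r ps"
    "\<And>l s. (l, s) \<in> set ps \<Longrightarrow> l = Bot \<or> (\<not> entails \<Sigma> l s \<and> \<not> entails \<Sigma> s l)"
    by (fastforce simp: peerless_def wf_def)
  obtain ps' where wf': "wf r ps'" and ps': "set ps' \<subseteq> set ps" "ps' = [] \<or> \<not> holds {} 0 (snd (last ps'))"
    "\<And>D a p. sat D a p (path_query r ps') \<longleftrightarrow> sat D a p q" "qsize (path_query r ps') \<le> qsize q"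
    using wf_trim[OF ps(2)] unfolding ps(1) by metis
  have "\<exists>E. example_set \<Sigma> E \<and> uniquely_characterises \<Sigma> E (path_query r ps') (path_queries L) \<and> esize E \<le> bound (qsize q)"
  proof (cases "ps' = []")
    case True
    then show ?thesis using characterise_short[of r "qsize q"] wf' ps'(4) by (simp add: wf_def)
  next
    case False
    show ?thesis
    proof (rule characterise_long[OF wf' False _ _ ps'(4)])
      show "\<not> holds {} 0 (snd (last ps'))" using ps'(2) False by blast
      fix l s assume m: "(l, s) \<in> set ps'"
      then have "l \<in> insert Bot L" "s \<in> insert Bot L" using wf' by (auto simp: wf_def)
      then show "l = Bot \<or> (\<not> ent l s \<and> \<not> ent s l)" using ps(3)[of l s] m ps'(1) entails_ent by blast
    qed
  qed
  then show ?thesis using uniquely_characterises_cong[OF ps'(3)] by simp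
qed

end

lemma EL_characterisable:
  fixes \<Sigma> :: "('u, 'b) signature"
  assumes "relational_signature \<Sigma>"
  shows "polynomially_characterisable \<Sigma> (peerless \<Sigma> (EL \<Sigma>)) (path_queries (EL \<Sigma>))"
proof -
  interpret description \<Sigma> "EL \<Sigma>" small "\<lambda>s. (2 * s + 1) ^ 2"
  proof
    show "EL \<Sigma> \<subseteq> ELI \<Sigma>" using EL_ELI by blast
    fix x y z :: "('u, 'b) query" and s
    show "finite (small x y)" by (rule small_finite)
    show "card (small x y) \<le> (2 * s + 1) ^ 2" if "qsize x \<le> s" "qsize y \<le> s"
    proof -
      have "card (pool x y) + 1 \<le> 2 * s + 1" using pool_card[of x y] that by linarith
      then show ?thesis using small_card[of x y] power_mono[of "card (pool x y) + 1" "2 * s + 1" 2] by linarith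
    qed
    assume "x \<in> insert Bot (EL \<Sigma>)" "y \<in> insert Bot (EL \<Sigma>)" "z \<in> EL \<Sigma>"
      "\<not> holds (inst z) 0 x" "\<not> holds (inst z) 0 y"
    then show "\<exists>A\<in>avoiders \<Sigma> (small x y) x y. holds A 0 z" by (rule avoiders_complete_EL)
  qed (rule assms)
  let ?g = "[:1, 2:] ^ 2 :: nat poly"
  let ?f = "([:2, 1:] + [:1, 4:] * ?g) * [:2, 3, 1:] * ([:rank, 1:] + [:rank:] * ?g ^ 2)"
  have "poly ?f s = bound s" for s
  proof -
    have "poly ?g s = (2 * s + 1) ^ 2" by (simp add: mult.commute)
    moreover have "poly [:2, 1:] s = s + 2" "poly [:1, 4:] s = 4 * s + 1" "poly [:2, 3, 1:] s = s * (s + 3) + 2"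
      "poly [:rank, 1:] s = s + rank" "poly [:rank:] s = rank" by simp_all
    ultimately show ?thesis unfolding bound_def by (simp only: poly_add poly_mult poly_power)
  qed
  then show ?thesis using characterise unfolding polynomially_characterisable_def by metis
qed

lemma ELI_characterisable:
  fixes \<Sigma> :: "('u, 'b) signature"
  assumes "relational_signature \<Sigma>"
  shows "exponentially_characterisable \<Sigma> (peerless \<Sigma> (ELI \<Sigma>)) (path_queries (ELI \<Sigma>))"
proof -
  interpret description \<Sigma> "ELI \<Sigma>" "\<lambda>x y. Pow (pool x y)" "\<lambda>s. 2 ^ (2 * s)"
  proof
    fix x y z :: "('u, 'b) query" and s
    show "finite (Pow (pool x y))" by (simp add: pool_finite)
    show "card (Pow (pool x y)) \<le> 2 ^ (2 * s)" if "qsize x \<le> s" "qsize y \<le> s"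
      using pool_card[of x y] that by (simp add: card_Pow pool_finite)
    assume "x \<in> insert Bot (ELI \<Sigma>)" "y \<in> insert Bot (ELI \<Sigma>)" "z \<in> ELI \<Sigma>"
      "\<not> holds (inst z) 0 x" "\<not> holds (inst z) 0 y"
    then show "\<exists>A\<in>avoiders \<Sigma> (Pow (pool x y)) x y. holds A 0 z" by (rule avoiders_complete_ELI)
  qed (use assms in auto)
  \<comment> \<open>The coefficients collect the exponents \<open>7 * s + 3\<close>,
    \<open>s * (s + 3) + 2\<close> and \<open>5 * s + 2 * rank\<close> of the three factors of
    \<open>bound\<close>.\<close>
  let ?f = "[:5 + 2 * rank, 15, 1:]"
  have lt: "k \<le> 2 ^ k" for k :: nat using less_exp[of k] by simp
  have "bound s \<le> 2 ^ poly ?f s" for s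
  proof -
    have one: "1 \<le> (2::nat) ^ k" for k by simp
    have "s + 2 + (4 * s + 1) * 2 ^ (2 * s) \<le> (s + 2) * 2 ^ (2 * s) + (4 * s + 1) * 2 ^ (2 * s)"
      using mult_le_mono2[OF one[of "2 * s"], of "s + 2"] by (intro add_mono) simp_all
    also have "\<dots> = (5 * s + 3) * 2 ^ (2 * s)" by (simp add: algebra_simps)
    also have "\<dots> \<le> 2 ^ (5 * s + 3) * 2 ^ (2 * s)" by (intro mult_le_mono1 lt)
    finally have a: "s + 2 + (4 * s + 1) * 2 ^ (2 * s) \<le> 2 ^ (7 * s + 3)" by (simp add: power_add[symmetric] algebra_simps)
    have "s + rank + rank * (2 ^ (2 * s)) ^ 2 \<le> (s + rank) * 2 ^ (4 * s) + rank * 2 ^ (4 * s)"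
      by (simp add: power_mult[symmetric])
    also have "\<dots> = (s + 2 * rank) * 2 ^ (4 * s)" by (simp add: algebra_simps)
    also have "\<dots> \<le> 2 ^ (s + 2 * rank) * 2 ^ (4 * s)" by (intro mult_le_mono1 lt)
    finally have c: "s + rank + rank * (2 ^ (2 * s)) ^ 2 \<le> 2 ^ (5 * s + 2 * rank)" by (simp add: power_add[symmetric] algebra_simps)
    have "bound s \<le> 2 ^ (7 * s + 3) * 2 ^ (s * (s + 3) + 2) * 2 ^ (5 * s + 2 * rank)"
      unfolding bound_def by (intro mult_le_mono a c lt)
    also have "\<dots> = 2 ^ (7 * s + 3 + (s * (s + 3) + 2) + (5 * s + 2 * rank))" by (simp only: power_add)
    also have "7 * s + 3 + (s * (s + 3) + 2) + (5 * s + 2 * rank) = poly ?f s" by (simp add: algebra_simps)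
    finally show ?thesis .
  qed
  then show ?thesis using characterise le_trans unfolding exponentially_characterisable_def by meson
qed

subsection \<open>The lower bound\<close>

definition conj_all :: "('u, 'b) query list \<Rightarrow> ('u, 'b) query" where
  "conj_all xs = foldr Conj xs Top"

lemma holds_conj_all: "sat D a p (conj_all xs) \<longleftrightarrow> (\<forall>x\<in>set xs. sat D a p x)"
  by (induction xs) (auto simp: conj_all_def)

lemma conj_all_ELI: "(\<And>x. x \<in> set xs \<Longrightarrow> x \<in> ELI \<Sigma>) \<Longrightarrow> conj_all xs \<in> ELI \<Sigma>"
  by (induction xs) (auto simp: conj_all_def intro: ELI.intros)

lemma qsize_conj_all: "(\<And>x. x \<in> set xs \<Longrightarrow> qsize x \<le> k) \<Longrightarrow> qsize (conj_all xs) \<le> 1 + length xs * (k + 1)"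
proof (induction xs)
  case (Cons x xs)
  then have "qsize x \<le> k" "qsize (conj_all xs) \<le> 1 + length xs * (k + 1)" by auto
  then show ?case by (simp add: conj_all_def)
qed (simp add: conj_all_def)

primrec down :: "'b \<Rightarrow> nat \<Rightarrow> ('u, 'b) query" where
  "down P 0 = Top"
| "down P (Suc n) = Exists (Fwd P) (down P n)"

primrec up :: "'b \<Rightarrow> nat \<Rightarrow> ('u, 'b) query \<Rightarrow> ('u, 'b) query" where
  "up P 0 q = q"
| "up P (Suc n) q = Exists (Inv P) (up P n q)"

text \<open>Going up \<open>i\<close> edges and then down \<open>i + 2\<close>: in the models below, a point at the foot of a
  chain of length \<open>i\<close> whose top starts a long descending path satisfies exactly the \<open>i\<close>-th of these.\<close>

definition feature :: "'b \<Rightarrow> nat \<Rightarrow> ('u, 'b) query" where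
  "feature P i = up P i (down P (Suc (Suc i)))"

definition all_features :: "'b \<Rightarrow> nat \<Rightarrow> ('u, 'b) query" where
  "all_features P m = Exists (Fwd P) (conj_all (map (\<lambda>i. Exists (Inv P) (feature P i)) [1..<Suc m]))"

text \<open>These are left arguments of rival queries only; the characterised query, whose size is
  measured, is built from \<open>all_features\<close> alone.\<close>

definition separator :: "'b \<Rightarrow> nat \<Rightarrow> nat set \<Rightarrow> ('u, 'b) query" where
  "separator P m X = Conj (conj_all (map (feature P) (filter (\<lambda>i. i \<notin> X) [1..<Suc m])))
     (conj_all (map (\<lambda>i. Exists (Fwd P) (conj_all (map (\<lambda>j. Exists (Inv P) (feature P j))
        (filter (\<lambda>j. j \<noteq> i) [1..<Suc m])))) (filter (\<lambda>i. i \<in> X) [1..<Suc m])))"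

lemma down_ELI: "P \<in> binary \<Sigma> \<Longrightarrow> down P n \<in> ELI \<Sigma>"
  by (induction n) (auto intro: ELI.intros)

lemma up_ELI: "P \<in> binary \<Sigma> \<Longrightarrow> q \<in> ELI \<Sigma> \<Longrightarrow> up P n q \<in> ELI \<Sigma>"
  by (induction n) (auto intro: ELI.intros)

lemma feature_ELI: "P \<in> binary \<Sigma> \<Longrightarrow> feature P i \<in> ELI \<Sigma>"
  unfolding feature_def by (intro up_ELI down_ELI)

lemma all_features_ELI: "P \<in> binary \<Sigma> \<Longrightarrow> all_features P m \<in> ELI \<Sigma>"
  unfolding all_features_def by (auto intro!: ELI.intros conj_all_ELI feature_ELI)

lemma separator_ELI: "P \<in> binary \<Sigma> \<Longrightarrow> separator P m X \<in> ELI \<Sigma>"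
  unfolding separator_def by (auto intro!: ELI.intros conj_all_ELI feature_ELI)

lemma qsize_down: "qsize (down P n) = 2 * n + 1" by (induction n) auto

lemma qsize_up: "qsize (up P n q) = 2 * n + qsize q" by (induction n) auto

lemma qsize_feature: "qsize (feature P i) = 4 * i + 5"
  by (simp add: feature_def qsize_down qsize_up del: down.simps)

lemma qsize_all_features: "qsize (all_features P m :: ('u, 'b) query) \<le> 4 * m ^ 2 + 8 * m + 3"
proof -
  have "qsize (conj_all (map (\<lambda>i. Exists (Inv P) (feature P i)) [1..<Suc m]) :: ('u, 'b) query) \<le> 1 + m * (4 * m + 7 + 1)"
    by (rule order_trans[OF qsize_conj_all[where k = "4 * m + 7"]]) (auto simp: qsize_feature simp del: upt_Suc)
  then show ?thesis by (simp add: all_features_def power2_eq_square algebra_simps)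
qed

lemma holds_conj_filter:
  "sat D a p (conj_all (map f (filter Q [1..<Suc m]))) \<longleftrightarrow> (\<forall>i\<in>{1..m}. Q i \<longrightarrow> sat D a p (f i))"
  by (auto simp: holds_conj_all simp del: upt_Suc)

lemma holds_separator:
  "holds A a (separator P m X) \<longleftrightarrow> (\<forall>i\<in>{1..m}. i \<notin> X \<longrightarrow> holds A a (feature P i)) \<and>
     (\<forall>i\<in>{1..m}. i \<in> X \<longrightarrow>
        (\<exists>b. BFact P a b \<in> A \<and> (\<forall>j\<in>{1..m}. j \<noteq> i \<longrightarrow> holds A b (Exists (Inv P) (feature P j)))))"
  unfolding separator_def sat.simps(4) holds_conj_filter holds_Fwd ..

lemma holds_all_features:
  "holds A a (all_features P m) \<longleftrightarrow>
     (\<exists>b. BFact P a b \<in> A \<and> (\<forall>j\<in>{1..m}. holds A b (Exists (Inv P) (feature P j))))"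
  using holds_conj_filter[of "[A]" _ 0 "\<lambda>j. Exists (Inv P) (feature P j)" "\<lambda>_. True" m]
  unfolding all_features_def holds_Fwd by (simp del: upt_Suc sat.simps(5))

text \<open>For \<open>i\<close> in \<open>X\<close> but not in \<open>Y\<close>, the separator of
  \<open>X\<close> yields a successor seeing all features except possibly the \<open>i\<close>-th
  through \<open>P^-\<close>. The point itself is a predecessor of that successor and has feature
  \<open>i\<close> because of \<open>Y\<close>.\<close>

lemma separators_clash:
  assumes "X \<subseteq> {1..m}" "Y \<subseteq> {1..m}" "X \<noteq> Y" "holds A a (separator P m X)" "holds A a (separator P m Y)"
  shows "holds A a (all_features P m)"
proof -
  have *: "holds A a (all_features P m)"
    if Y: "i \<in> {1..m}" "i \<in> X" "i \<notin> Y" "holds A a (separator P m X)" "holds A a (separator P m Y)" for X Y i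
  proof -
    have f: "holds A a (feature P i)" using Y(1,3,5) unfolding holds_separator by blast
    obtain b where b: "BFact P a b \<in> A" "\<And>j. j \<in> {1..m} \<Longrightarrow> j \<noteq> i \<Longrightarrow> holds A b (Exists (Inv P) (feature P j))"
      using Y(1,2,4) unfolding holds_separator by blast
    moreover have "holds A b (Exists (Inv P) (feature P i))" unfolding holds_Inv using b(1) f by blast
    ultimately show ?thesis unfolding holds_all_features by blast
  qed
  from assms(1-3) consider i where "i \<in> {1..m}" "i \<in> X" "i \<notin> Y" | i where "i \<in> {1..m}" "i \<in> Y" "i \<notin> X" by blast
  then show ?thesis using *[of _ X Y] *[of _ Y X] assms(4,5) by cases blast+
qed

text \<open>A model of a separator that falsifies \<open>all_features P m\<close> at \<open>Root\<close>.\<close>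

datatype node = Root | Mid nat | Foot nat | Chain nat nat | Tail nat

fun code :: "node \<Rightarrow> nat" where
  "code Root = prod_encode (0, 0)"
| "code (Mid i) = prod_encode (1, i)"
| "code (Foot i) = prod_encode (2, i)"
| "code (Chain i a) = prod_encode (3, prod_encode (i, a))"
| "code (Tail c) = prod_encode (4, c)"

lemma code_inj: "code x = code y \<longleftrightarrow> x = y"
  by (cases x; cases y) (auto simp: inj_eq[OF inj_prod_encode])

text \<open>\<open>Mid i\<close> sees the features of all feet \<open>j \<noteq> i\<close>, and the
  root supplies exactly those outside \<open>X\<close>; since \<open>i\<close> is in
  \<open>X\<close>, only feature \<open>i\<close> is missing. \<open>Tail (Suc i)\<close> gives the
  top of chain \<open>i\<close> a descent of length \<open>i + 2\<close>.\<close>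

inductive arc :: "nat \<Rightarrow> nat set \<Rightarrow> node \<Rightarrow> node \<Rightarrow> bool" for m X where
  "i \<in> X \<Longrightarrow> arc m X Root (Mid i)"
| "1 \<le> j \<Longrightarrow> j \<noteq> i \<Longrightarrow> i \<in> X \<Longrightarrow> arc m X (Foot j) (Mid i)"
| "1 \<le> i \<Longrightarrow> i \<le> m \<Longrightarrow> i \<notin> X \<Longrightarrow> arc m X (Chain i 1) Root"
| "1 \<le> i \<Longrightarrow> arc m X (Chain i 1) (Foot i)"
| "1 \<le> a \<Longrightarrow> a < i \<Longrightarrow> arc m X (Chain i (Suc a)) (Chain i a)"
| "1 \<le> i \<Longrightarrow> arc m X (Chain i i) (Tail (Suc i))"
| "arc m X (Tail (Suc c)) (Tail c)"

inductive_cases arc_Root: "arc m X Root y" and arc_Mid: "arc m X (Mid i) y" and arc_Foot: "arc m X (Foot i) y"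
  and arc_Chain: "arc m X (Chain i a) y"
  and arc_to_Root: "arc m X y Root" and arc_to_Mid: "arc m X y (Mid i)" and arc_to_Foot: "arc m X y (Foot i)"
  and arc_to_Chain: "arc m X y (Chain i a)"

definition model :: "'b \<Rightarrow> nat \<Rightarrow> nat set \<Rightarrow> ('u, 'b) data" where
  "model P m X = {BFact P (code x) (code y) | x y. arc m X x y}"

definition tr :: "'b \<Rightarrow> nat \<Rightarrow> nat set \<Rightarrow> node \<Rightarrow> ('u, 'b) query \<Rightarrow> bool" where
  "tr P m X x q = holds (model P m X) (code x) q"

lemma tr_Fwd: "tr P m X x (Exists (Fwd P) q) \<longleftrightarrow> (\<exists>y. arc m X x y \<and> tr P m X y q)"
  unfolding tr_def holds_Fwd by (auto simp: model_def code_inj)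

lemma tr_Inv: "tr P m X x (Exists (Inv P) q) \<longleftrightarrow> (\<exists>y. arc m X y x \<and> tr P m X y q)"
  unfolding tr_def holds_Inv by (auto simp: model_def code_inj)

lemma tr_Top: "tr P m X x Top" by (simp add: tr_def)

lemma down_Tail: "tr P m X (Tail c) (down P c)"
  by (induction c) (auto simp: tr_Fwd tr_Top intro: arc.intros)

lemma down_Mid: "tr P m X (Mid i) (down P n) \<Longrightarrow> n = 0"
  by (cases n) (auto simp: tr_Fwd elim: arc_Mid)

lemma down_Root: "tr P m X Root (down P n) \<Longrightarrow> n \<le> 1"
  by (cases n) (auto simp: tr_Fwd elim!: arc_Root dest!: down_Mid)

lemma down_Foot: "tr P m X (Foot i) (down P n) \<Longrightarrow> n \<le> 1"
  by (cases n) (auto simp: tr_Fwd elim!: arc_Foot dest!: down_Mid)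

text \<open>Below the top the only descent takes \<open>a - 1\<close> steps along the chain, one to
  the root or the foot, and one to some \<open>Mid\<close>. This is why \<open>feature\<close> asks
  for two more steps down than up.\<close>

lemma down_Chain: "1 \<le> a \<Longrightarrow> a < i \<Longrightarrow> tr P m X (Chain i a) (down P n :: ('u, 'b) query) \<Longrightarrow> n \<le> Suc a"
proof (induction a arbitrary: n)
  case (Suc a)
  show ?case
  proof (cases n)
    case n: (Suc k)
    then obtain y where y: "arc m X (Chain i (Suc a)) y" "tr P m X y (down P k :: ('u, 'b) query)"
      using Suc.prems(3) by (auto simp: tr_Fwd)
    from y(1) have "y = Root \<or> y = Foot i \<or> (1 \<le> a \<and> y = Chain i a)"
      using Suc.prems(2) by (auto elim!: arc_Chain)
    then show ?thesis
      using y(2) down_Root down_Foot Suc.IH[of k] Suc.prems(2) n by fastforce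
  qed simp
qed simp

lemma up_Chain:
  assumes "1 \<le> a" "a \<le> i"
  shows "tr P m X (Chain i a) (up P n q) \<longleftrightarrow> a + n \<le> i \<and> tr P m X (Chain i (a + n)) q"
  using assms
proof (induction n arbitrary: a)
  case (Suc n)
  have "tr P m X (Chain i a) (up P (Suc n) q) \<longleftrightarrow> a < i \<and> tr P m X (Chain i (Suc a)) (up P n q)"
    using Suc.prems arc.intros(5)[of a i m X] by (auto simp: tr_Inv elim!: arc_to_Chain)
  then show ?case using Suc.IH[of "Suc a"] Suc.prems by (auto simp del: up.simps)
qed simp

text \<open>If \<open>i < Suc j\<close>, the chain is too short for the climb. If
  \<open>i > Suc j\<close>, the climb ends below the top, where \<open>down_Chain\<close> bounds the
  descent.\<close>

lemma feature_Chain: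
  assumes "1 \<le> i"
  shows "tr P m X (Chain i 1) (up P j (down P (Suc (Suc (Suc j)))) :: ('u, 'b) query) \<longleftrightarrow> i = Suc j"
proof -
  let ?q = "down P (Suc (Suc (Suc j))) :: ('u, 'b) query"
  have "tr P m X (Chain (Suc j) (Suc j)) ?q"
    using down_Tail[of P m X "Suc (Suc j)"] arc.intros(6)[of "Suc j" m X]
    unfolding down.simps(2)[of P "Suc (Suc j)"] tr_Fwd by auto
  moreover have short: "\<not> tr P m X (Chain i (Suc j)) ?q" if "Suc j < i"
    using down_Chain[OF _ that] by fastforce
  ultimately show ?thesis
    using up_Chain[of 1 i P m X j ?q] short assms by (auto simp del: down.simps simp: le_less)
qed

lemma feature_Inv:
  "tr P m X x (feature P (Suc j) :: ('u, 'b) query) \<longleftrightarrow>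
     (\<exists>y. arc m X y x \<and> tr P m X y (up P j (down P (Suc (Suc (Suc j)))) :: ('u, 'b) query))"
  unfolding feature_def up.simps tr_Inv ..

lemma feature_Root:
  assumes "1 \<le> j" "j \<le> m"
  shows "tr P m X Root (feature P j) \<longleftrightarrow> j \<notin> X"
proof -
  obtain k where j: "j = Suc k" using assms by (cases j) auto
  have "arc m X y Root \<longleftrightarrow> (\<exists>i. y = Chain i 1 \<and> 1 \<le> i \<and> i \<le> m \<and> i \<notin> X)" for y
    by (auto elim: arc_to_Root intro: arc.intros(3)[simplified])
  then show ?thesis unfolding j feature_Inv using feature_Chain assms j by metis
qed

lemma feature_Foot:
  assumes "1 \<le> j" "1 \<le> i"
  shows "tr P m X (Foot i) (feature P j) \<longleftrightarrow> i = j"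
proof -
  obtain k where j: "j = Suc k" using assms by (cases j) auto
  have "arc m X y (Foot i) \<longleftrightarrow> y = Chain i 1" for y
    using assms by (auto elim: arc_to_Foot intro: arc.intros(4)[simplified])
  then show ?thesis unfolding j feature_Inv using feature_Chain assms j by metis
qed

lemma model_separates:
  assumes X: "X \<subseteq> {1..m}"
  shows "holds (model P m X :: ('u, 'b) data) (code Root) (separator P m X)"
    "\<not> holds (model P m X :: ('u, 'b) data) (code Root) (all_features P m)"
proof -
  have "tr P m X (Mid i) (Exists (Inv P) (feature P j) :: ('u, 'b) query)" if "i \<in> X" "1 \<le> j" "j \<noteq> i" for i j
    unfolding tr_Inv using feature_Foot[of j j P m X] that arc.intros(2)[of j i X m] by blast
  then have "holds (model P m X :: ('u, 'b) data) (code (Mid i)) (Exists (Inv P) (feature P j))"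
    if "i \<in> X" "j \<in> {1..m}" "j \<noteq> i" for i j using that unfolding tr_def by auto
  moreover have "BFact P (code Root) (code (Mid i)) \<in> (model P m X :: ('u, 'b) data)" if "i \<in> X" for i
    using that arc.intros(1) unfolding model_def by blast
  moreover have "holds (model P m X :: ('u, 'b) data) (code Root) (feature P i)" if "i \<in> {1..m}" "i \<notin> X" for i
    using that feature_Root[of i m P X] unfolding tr_def by auto
  ultimately show "holds (model P m X :: ('u, 'b) data) (code Root) (separator P m X)"
    unfolding holds_separator by blast
  show "\<not> holds (model P m X :: ('u, 'b) data) (code Root) (all_features P m)"
  proof
    assume "holds (model P m X :: ('u, 'b) data) (code Root) (all_features P m)"
    then obtain b where b: "BFact P (code Root) b \<in> (model P m X :: ('u, 'b) data)"
      "\<And>j. j \<in> {1..m} \<Longrightarrow> holds (model P m X :: ('u, 'b) data) b (Exists (Inv P) (feature P j))"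
      unfolding holds_all_features by blast
    from b(1) obtain z where z: "arc m X Root z" "b = code z" unfolding model_def by (auto simp: code_inj simp del: code.simps)
    from z(1) obtain i where i: "i \<in> X" "z = Mid i" by (rule arc_Root)
    have im: "1 \<le> i" "i \<le> m" using X i(1) by auto
    then have "tr P m X (Mid i) (Exists (Inv P) (feature P i) :: ('u, 'b) query)" using b(2)[of i] z i unfolding tr_def by auto
    then obtain y where y: "arc m X y (Mid i)" "tr P m X y (feature P i :: ('u, 'b) query)" unfolding tr_Inv by blast
    from y(1) consider "y = Root" | j where "y = Foot j" "1 \<le> j" "j \<noteq> i" by (auto elim: arc_to_Mid)
    then show False
    proof cases
      case 1 then show False using y(2) i(1) by (simp add: feature_Root[OF im])
    next
      case (2 j) then show False using y(2) by (simp add: feature_Foot[OF im(1) 2(2)])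
    qed
  qed
qed

lemma sat_next: "sat D a p (path_query Top [(Bot, x)]) \<longleftrightarrow> sat D a (Suc p) x"
proof
  assume "sat D a p (path_query Top [(Bot, x)])"
  then obtain k where k: "p < k" "sat D a k x" "\<And>j. \<not> (p < j \<and> j < k)" by auto
  have "k = Suc p" using k(1) k(3)[of "Suc p"] by linarith
  then show "sat D a (Suc p) x" using k(2) by simp
qed (auto intro!: exI[of _ "Suc p"])

lemma sat_until: "sat D a p (path_query Top [(y, x)]) \<longleftrightarrow>
    (\<exists>k>p. sat D a k x \<and> (\<forall>j. p < j \<and> j < k \<longrightarrow> sat D a j y))"
  by simp

text \<open>Each rival with a separator as left argument is strictly weaker than the given query, so
  only a negative example can refute it. By \<open>separators_clash\<close> no example does so for
  two sets.\<close>

lemma many_negatives: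
  fixes \<Sigma> :: "('u, 'b) signature"
  assumes P: "P \<in> binary \<Sigma>" and E: "example_set \<Sigma> E"
    and char: "uniquely_characterises \<Sigma> E (path_query Top [(Bot, all_features P m)]) (path_queries (ELI \<Sigma>))"
  shows "2 ^ m \<le> esize E"
proof -
  obtain Ep En where E2: "E = (Ep, En)" by (cases E)
  let ?r = "all_features P m :: ('u, 'b) query" and ?l = "separator P m :: nat set \<Rightarrow> ('u, 'b) query"
  let ?q = "path_query Top [(Bot, ?r)]" and ?q' = "\<lambda>X. path_query Top [(?l X, ?r)]"
  have r: "?r \<in> ELI \<Sigma>" by (rule all_features_ELI[OF P])
  have l: "?l X \<in> ELI \<Sigma>" for X by (rule separator_ELI[OF P])
  have "\<exists>e\<in>En. holds (slice (fst e) 1) (snd e) (?l X) \<and> \<not> holds (slice (fst e) 1) (snd e) ?r"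
    if X: "X \<subseteq> {1..m}" for X
  proof -
    \<comment> \<open>\<open>all_features\<close> fails at time 1 and holds at time 2, while the
      separator bridges time 1; so \<open>?D\<close> satisfies the rival only.\<close>
    let ?D = "[{}, inst (?l X), inst ?r]"
    have "\<not> holds (inst (?l X)) 0 ?r" using inst_char[OF l, of ?r X] r model_separates[OF X, of P] by blast
    then have "\<not> sat ?D 0 1 ?r" using sat_slice[of ?r \<Sigma> ?D 0 1] r by (simp add: slice_def)
    then have "\<not> sat ?D 0 0 ?q" unfolding sat_next by simp
    moreover have "sat ?D 0 0 (?q' X)"
    proof -
      have "slice ?D 1 = inst (?l X)" "slice ?D 2 = inst ?r" by (simp_all add: slice_def)
      then have "sat ?D 0 1 (?l X)" "sat ?D 0 2 ?r"
        using sat_slice[of "?l X" \<Sigma> ?D 0 1] sat_slice[of ?r \<Sigma> ?D 0 2] inst_holds[OF l] inst_holds[OF r] r l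
        by simp_all
      moreover have "sat ?D 0 j (?l X)" if "0 < j \<and> j < 2" for j
      proof -
        have "j = 1" using that by linarith
        then show ?thesis using calculation(1) by (simp only:)
      qed
      ultimately show ?thesis unfolding sat_until by (intro exI[of _ 2]) simp_all
    qed
    moreover have "temporal_instance \<Sigma> ?D" using inst_data[OF l] inst_data[OF r]
      by (auto simp: temporal_instance_def data_instance_def)
    ultimately have "\<not> equivalent \<Sigma> ?q (?q' X)" unfolding equivalent_def entails_def by blast
    moreover have "?q' X \<in> path_queries (ELI \<Sigma>)" using r l ELI.ELI_Top
      unfolding path_queries_def by (intro CollectI exI[of _ Top] exI[of _ "[(?l X, ?r)]"]) auto
    ultimately have nf: "\<not> fits (?q' X) E" "fits ?q E" using char unfolding uniquely_characterises_def by blast+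
    have weaker: "sat D a p (?q' X)" if "sat D a p ?q" for D a p
    proof -
      have "sat D a (Suc p) ?r" using that unfolding sat_next .
      then show ?thesis unfolding sat_until by (intro exI[of _ "Suc p"]) auto
    qed
    obtain D a where e: "(D, a) \<in> En" "sat D a 0 (?q' X)" using nf weaker unfolding fits_def E2 by blast
    have "\<not> sat D a 0 ?q" using nf(2) e(1) unfolding fits_def E2 by blast
    then have n1: "\<not> sat D a 1 ?r" unfolding sat_next by simp
    from e(2) obtain u where u: "0 < u" "sat D a u ?r" "\<And>k. 0 < k \<Longrightarrow> k < u \<Longrightarrow> sat D a k (?l X)"
      unfolding sat_until by blast
    then have "u \<noteq> 1" using n1 by auto
    then have "sat D a 1 (?l X)" using u(1) u(3)[of 1] by linarith
    then have "holds (slice D 1) a (?l X)" "\<not> holds (slice D 1) a ?r"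
      using n1 sat_slice[of ?r \<Sigma> D a 1] sat_slice[of "?l X" \<Sigma> D a 1] r l by blast+
    then show ?thesis using e(1) by (intro bexI[of _ "(D, a)"]) simp_all
  qed
  then obtain g where g: "\<And>X. X \<subseteq> {1..m} \<Longrightarrow> g X \<in> En \<and> holds (slice (fst (g X)) 1) (snd (g X)) (?l X) \<and>
      \<not> holds (slice (fst (g X)) 1) (snd (g X)) ?r" by metis
  have "inj_on g (Pow {1..m})"
  proof (rule inj_onI)
    fix X Y assume X: "X \<in> Pow {1..m}" "Y \<in> Pow {1..m}" "g X = g Y"
    show "X = Y"
    proof (rule ccontr)
      assume "X \<noteq> Y"
      then show False using separators_clash[of X m Y "slice (fst (g X)) 1" "snd (g X)" P] g[of X] g[of Y] X by auto
    qed
  qed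
  then have "card (Pow {1..m}) = card (g ` Pow {1..m})" by (simp add: card_image)
  also have "\<dots> \<le> card En" using E g by (intro card_mono) (auto simp: example_set_def E2)
  finally have "2 ^ m \<le> card En" by (simp add: card_Pow)
  \<comment> \<open>Every example mentions its point and hence has at least one fact, so the number
    of examples bounds their total size from below.\<close>
  also have "card En \<le> (\<Sum>(D, a)\<in>En. tsize D)"
  proof -
    have "1 \<le> tsize (fst e)" if "e \<in> En" for e
    proof -
      have pt: "pointed_instance \<Sigma> e" using E that by (auto simp: example_set_def E2)
      then obtain A where A: "A \<in> set (fst e)" "snd e \<in> ind A" by (auto simp: pointed_instance_def tind_def)
      then have "finite A" "A \<noteq> {}" using pt by (auto simp: pointed_instance_def temporal_instance_def data_instance_def ind_def)
      then have "1 \<le> card A" by (simp add: Suc_le_eq card_gt_0_iff)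
      also have "card A \<le> tsize (fst e)" unfolding tsize_def by (rule member_le_sum_list) (use A in auto)
      finally show ?thesis .
    qed
    then have "(\<Sum>e\<in>En. 1) \<le> (\<Sum>e\<in>En. tsize (fst e))" by (intro sum_mono)
    then show ?thesis by (simp add: split_beta)
  qed
  finally show ?thesis by (simp add: esize_def E2)
qed

section \<open>Exponential against polynomial growth\<close>

lemma poly_nat_bound: "\<exists>C d. \<forall>x. poly (f :: nat poly) x \<le> C * (x + 1) ^ d"
proof (induction f)
  case (pCons a p)
  then obtain C d where C: "\<And>x. poly p x \<le> C * (x + 1) ^ d" by blast
  have "poly (pCons a p) x \<le> (a + C) * (x + 1) ^ Suc d" for x
  proof -
    have "a * 1 \<le> a * (x + 1) ^ Suc d" by (intro mult_le_mono2 one_le_power) simp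
    moreover have "x * poly p x \<le> (x + 1) * (C * (x + 1) ^ d)" by (intro mult_le_mono C) simp
    ultimately show ?thesis by (simp add: algebra_simps)
  qed
  then show ?case by blast
qed (intro exI[of _ 0], simp)

lemma square_less_exp: "5 \<le> k \<Longrightarrow> k ^ 2 < (2::nat) ^ k"
proof (induction k rule: dec_induct)
  case (step k)
  have "2 * k + 1 \<le> k * k" using mult_le_mono1[OF step(1), of k] step(1) by linarith
  then show ?case using step by (simp add: power2_eq_square)
qed simp

lemma exp_beats_poly: "\<exists>m. C * (m + 1) ^ d < (2::nat) ^ m"
proof -
  \<comment> \<open>For \<open>m = 2 ^ k - 1\<close> the left side is at most
    \<open>2 ^ (C + k * d)\<close>. The choice of \<open>k\<close> makes this exponent smaller than
    \<open>k ^ 2\<close>, which in turn is below \<open>2 ^ k\<close>.\<close>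
  define k where "k = C + d + 6"
  have "k ^ 2 < 2 ^ k" by (rule square_less_exp) (simp add: k_def)
  moreover have "C + k * d + 1 \<le> k ^ 2"
  proof -
    have "C + k * d + 1 \<le> k * C + k * d + k * 1" by (intro add_mono) (auto simp: k_def)
    also have "\<dots> = k * (C + d + 1)" by (simp add: algebra_simps)
    also have "\<dots> \<le> k * k" by (intro mult_le_mono2) (simp add: k_def)
    finally show ?thesis by (simp add: power2_eq_square)
  qed
  ultimately have less: "C + k * d < 2 ^ k - 1" by linarith
  have "C * (2 ^ k - 1 + 1) ^ d = C * 2 ^ (k * d)" by (simp add: power_mult)
  also have "\<dots> \<le> 2 ^ C * 2 ^ (k * d)" by (intro mult_le_mono1) (simp add: less_imp_le)
  also have "\<dots> = 2 ^ (C + k * d)" by (simp add: power_add)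
  also have "\<dots> < 2 ^ (2 ^ k - 1)" using less by (intro power_strict_increasing) auto
  finally show ?thesis by blast
qed

lemma ELI_not_polynomial:
  fixes \<Sigma> :: "('u, 'b) signature"
  assumes "binary \<Sigma> \<noteq> {}"
  shows "\<not> polynomially_characterisable \<Sigma> (peerless \<Sigma> (ELI \<Sigma>)) (path_queries (ELI \<Sigma>))"
proof
  assume "polynomially_characterisable \<Sigma> (peerless \<Sigma> (ELI \<Sigma>)) (path_queries (ELI \<Sigma>))"
  then obtain f where f: "\<And>q. q \<in> peerless \<Sigma> (ELI \<Sigma>) \<Longrightarrow> \<exists>E. example_set \<Sigma> E \<and>
    uniquely_characterises \<Sigma> E q (path_queries (ELI \<Sigma>)) \<and> esize E \<le> poly f (qsize q)"
    unfolding polynomially_characterisable_def by blast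
  obtain P where P: "P \<in> binary \<Sigma>" using assms by blast
  obtain C d where C: "\<And>x. poly f x \<le> C * (x + 1) ^ d" using poly_nat_bound by blast
  \<comment> \<open>The query has size quadratic in \<open>m\<close>, at most
    \<open>8 * (m + 1) ^ 2\<close>; hence the factor \<open>8 ^ d\<close> and the exponent
    \<open>2 * d\<close>.\<close>
  obtain m where m: "C * 8 ^ d * (m + 1) ^ (2 * d) < 2 ^ m" using exp_beats_poly by blast
  let ?q = "path_query Top [(Bot, all_features P m)] :: ('u, 'b) query"
  have "?q \<in> peerless \<Sigma> (ELI \<Sigma>)"
    using all_features_ELI[OF P] ELI.ELI_Top unfolding peerless_def
    by (intro CollectI exI[of _ Top] exI[of _ "[(Bot, all_features P m)]"]) auto
  then obtain E where E: "example_set \<Sigma> E" "uniquely_characterises \<Sigma> E ?q (path_queries (ELI \<Sigma>))"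
    "esize E \<le> poly f (qsize ?q)" using f by blast
  have "qsize ?q + 1 \<le> 8 * (m + 1) ^ 2"
  proof -
    have "qsize ?q + 1 = 5 + qsize (all_features P m :: ('u, 'b) query)" by simp
    moreover have "8 * (m + 1) ^ 2 = 8 * m ^ 2 + 16 * m + 8" by (simp add: power2_eq_square algebra_simps)
    moreover have "qsize (all_features P m :: ('u, 'b) query) \<le> 4 * m ^ 2 + 8 * m + 3" by (rule qsize_all_features)
    ultimately show ?thesis by linarith
  qed
  then have "(qsize ?q + 1) ^ d \<le> (8 * (m + 1) ^ 2) ^ d" by (intro power_mono) auto
  also have "\<dots> = 8 ^ d * (m + 1) ^ (2 * d)" by (simp add: power_mult_distrib power_mult)
  finally have "C * (qsize ?q + 1) ^ d \<le> C * 8 ^ d * (m + 1) ^ (2 * d)" using mult_le_mono2 by (simp only: mult.assoc)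
  then have "2 ^ m \<le> C * 8 ^ d * (m + 1) ^ (2 * d)"
    using many_negatives[OF P E(1,2)] E(3) C[of "qsize ?q"] by linarith
  then show False using m by linarith
qed

theorem theorem28:
  fixes \<Sigma> :: "('u, 'b) signature"
  assumes "relational_signature \<Sigma>"
  shows "polynomially_characterisable \<Sigma> (peerless \<Sigma> (EL \<Sigma>)) (path_queries (EL \<Sigma>))
    \<and> exponentially_characterisable \<Sigma> (peerless \<Sigma> (ELI \<Sigma>)) (path_queries (ELI \<Sigma>))
    \<and> (binary \<Sigma> \<noteq> {} \<longrightarrow>
         \<not> polynomially_characterisable \<Sigma> (peerless \<Sigma> (ELI \<Sigma>)) (path_queries (ELI \<Sigma>)))"
  by (intro conjI impI EL_characterisable[OF assms] ELI_characterisable[OF assms] ELI_not_polynomial)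

end
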